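(* Let $(M,\mathcal H,\mathcal X)$ be a complete pre-isotropic contact structure related to a proper submersion $\pi:M\to W$, and let $\mathcal F=\ker\pi_*$. Then every point of $M$ has an open, $\mathcal X$-invariant neighborhood $U$ on which the contact structure can be represented by a local contact form $\alpha_U$ (i.e. $\mathcal H|_U=\ker\alpha_U$) such that: (i) $\alpha_U$ is invariant by all elements of $\mathcal X$, i.e. $\mathcal L_Y\alpha_U=0$ for all $Y\in\mathcal X$; (ii) the restriction of $\mathcal F$ to $U$ is $\alpha_U$-complete.
   Context: All objects are smooth. A contact manifold $(M,\mathcal H)$ is a connected $(2n+1)$-dimensional manifold with a hyperplane distribution $\mathcal H$ that is locally the kernel of a contact form, i.e. of a 1-form $\alpha$ with $\alpha\wedge(d\alpha)^n\ne0$ (a global contact form need not exist). A subspace $\mathcal V\subset\mathcal H_x$ is isotropic if $d\alpha|_{\mathcal V}=0$ (independent of the local contact form $\alpha$). A contact vector field (infinitesimal contact automorphism) is a vector field whose local flow preserves $\mathcal H$. Let $\pi:M\to W$ be a proper submersion onto a $p$-dimensional manifold $W$, $p\ge n$, and $\mathcal F=\ker\pi_*$. The triple $(M,\mathcal H,\mathcal X)$ is a complete pre-isotropic contact structure if: (i) $\mathcal F$ is pre-isotropic, i.e. $\mathcal F$ is transversal to $\mathcal H$ and $\mathcal G=\mathcal F\cap\mathcal H$ is an isotropic subbundle of $\mathcal H$ (equivalently, $\mathcal G$ is a foliation); (ii) $\mathcal X$ is an Abelian Lie algebra of infinitesimal contact automorphisms of $\mathcal H$ which has the fibers of $\pi$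 as orbits (fibers need not be connected; the orbits are their connected components, so the elements of $\mathcal X$ are tangent to the fibers and span $\mathcal F_x$ at each $x\in M$). For a contact form $\alpha$ on $U$, the Reeb field $Z$ is given by $i_Z\alpha=1$, $i_Zd\alpha=0$. For a function $f$ on $U$, $X_f$ denotes the unique infinitesimal automorphism of $\mathcal H$ with $i_{X_f}\alpha=f$, and the Jacobi bracket is $[f,g]=i_{[X_f,X_g]}\alpha$. A foliation $\mathcal F$ on $U$ is $\alpha$-complete if for any pair $f_1,f_2$ of (local) first integrals of $\mathcal F$ (functions whose differential vanishes on $\mathcal F$; $f_i$ may be constant), $[f_1,f_2]$ is also a first integral of $\mathcal F$ (possibly a constant). *)

theory Defs
  imports "HOL-Analysis.Analysis" "HOL-Combinatorics.Permutations"
begin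

section \<open>Smooth manifolds and smooth maps\<close>

text \<open>\<open>Ck_on k S f\<close> is meant for open \<open>S\<close> and a finite-dimensional domain, where continuity of the
  iterated directional derivatives is continuity of the iterated derivatives.\<close>

primrec Ck_on ::
  "nat \<Rightarrow> 'a::real_normed_vector set \<Rightarrow> ('a \<Rightarrow> 'b::real_normed_vector) \<Rightarrow> bool" where
  "Ck_on 0 S f \<longleftrightarrow> continuous_on S f"
| "Ck_on (Suc k) S f \<longleftrightarrow> (\<forall>x\<in>S. f differentiable (at x)) \<and>
     (\<forall>v. Ck_on k S (\<lambda>x. frechet_derivative f (at x) v))"

definition smooth_on ::
  "'a::real_normed_vector set \<Rightarrow> ('a \<Rightarrow> 'b::real_normed_vector) \<Rightarrow> bool" where
  "smooth_on S f \<longleftrightarrow> (\<forall>k. Ck_on k S f)"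

text \<open>A chart is a domain with a coordinate map; the values of the map off the domain are irrelevant.\<close>

type_synonym ('a, 'e) chart = "'a set \<times> ('a \<Rightarrow> 'e)"

text \<open>The manifold is the whole (Hausdorff, second countable) type. The model is a normed space of
  dimension \<open>d\<close>; the class of Euclidean spaces would exclude \<open>d = 0\<close>.\<close>

definition smooth_manifold ::
  "nat \<Rightarrow> ('a::{t2_space, second_countable_topology}, 'e::real_normed_vector) chart set \<Rightarrow> bool" where
  "smooth_manifold d A \<longleftrightarrow>
     (\<exists>B::'e set. finite B \<and> independent B \<and> span B = UNIV \<and> card B = d) \<and>
     (\<forall>(U, \<phi>)\<in>A. open U \<and> open (\<phi> ` U) \<and> homeomorphism U (\<phi> ` U) \<phi> (inv_into U \<phi>)) \<and>
     (\<Union>(U, \<phi>)\<in>A. U) = UNIV \<and>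
     (\<forall>(U, \<phi>)\<in>A. \<forall>(V, \<psi>)\<in>A. smooth_on (\<phi> ` (U \<inter> V)) (\<psi> \<circ> inv_into U \<phi>))"

definition smooth_map_on ::
  "('a::topological_space, 'e::real_normed_vector) chart set \<Rightarrow>
   ('b::topological_space, 'f::real_normed_vector) chart set \<Rightarrow> 'a set \<Rightarrow> ('a \<Rightarrow> 'b) \<Rightarrow> bool" where
  "smooth_map_on A B S f \<longleftrightarrow> continuous_on S f \<and>
     (\<forall>(U, \<phi>)\<in>A. \<forall>(V, \<psi>)\<in>B.
        smooth_on (\<phi> ` (U \<inter> S \<inter> f -` V)) (\<psi> \<circ> f \<circ> inv_into U \<phi>))"

definition real_atlas :: "(real, real) chart set" where
  "real_atlas = {(UNIV, id)}"

definition prod_atlas ::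
  "('a, 'e) chart set \<Rightarrow> ('b, 'f) chart set \<Rightarrow> ('a \<times> 'b, 'e \<times> 'f) chart set" where
  "prod_atlas A B = {(U \<times> V, map_prod \<phi> \<psi>) | U \<phi> V \<psi>. (U, \<phi>) \<in> A \<and> (V, \<psi>) \<in> B}"

abbreviation smooth_fun ::
  "('a::topological_space, 'e::real_normed_vector) chart set \<Rightarrow> 'a set \<Rightarrow> ('a \<Rightarrow> real) \<Rightarrow> bool" where
  "smooth_fun A S f \<equiv> smooth_map_on A real_atlas S f"

definition smooth_near ::
  "('a::topological_space, 'e::real_normed_vector) chart set \<Rightarrow> 'a \<Rightarrow> ('a \<Rightarrow> real) \<Rightarrow> bool" where
  "smooth_near A x f \<longleftrightarrow> (\<exists>V. open V \<and> x \<in> V \<and> smooth_fun A V f)"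


section \<open>Tangent vectors, vector fields, differentials\<close>

text \<open>Tangent vectors at \<open>x\<close> are the derivations at \<open>x\<close> of the functions that are smooth near \<open>x\<close>.
  They are set to 0 on all other functions, so that equality of tangent vectors is equality
  in HOL. That derivations are local is a consequence: the indicator function of a neighbourhood
  of \<open>x\<close> is smooth near \<open>x\<close>.\<close>

type_synonym 'a tvec = "('a \<Rightarrow> real) \<Rightarrow> real"

definition tangent_space ::
  "('a::topological_space, 'e::real_normed_vector) chart set \<Rightarrow> 'a \<Rightarrow> 'a tvec set" where
  "tangent_space A x = {v.
     (\<forall>f. \<not> smooth_near A x f \<longrightarrow> v f = 0) \<and>
     (\<forall>f g a b. smooth_near A x f \<and> smooth_near A x g \<longrightarrow>
        v (\<lambda>y. a * f y + b * g y) = a * v f + b * v g) \<and>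
     (\<forall>f g. smooth_near A x f \<and> smooth_near A x g \<longrightarrow>
        v (\<lambda>y. f y * g y) = f x * v g + g x * v f)}"

definition tlincomb :: "real \<Rightarrow> 'a tvec \<Rightarrow> real \<Rightarrow> 'a tvec \<Rightarrow> 'a tvec" where
  "tlincomb a u b v = (\<lambda>f. a * u f + b * v f)"

definition tzero :: "'a tvec" where
  "tzero = (\<lambda>f. 0)"

definition differential ::
  "('a::topological_space, 'e::real_normed_vector) chart set \<Rightarrow>
   ('b::topological_space, 'f::real_normed_vector) chart set \<Rightarrow>
   ('a \<Rightarrow> 'b) \<Rightarrow> 'a \<Rightarrow> 'a tvec \<Rightarrow> 'b tvec" where
  "differential A B F x v = (\<lambda>g. if smooth_near B (F x) g then v (g \<circ> F) else 0)"

definition vector_field ::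
  "('a::topological_space, 'e::real_normed_vector) chart set \<Rightarrow> 'a set \<Rightarrow> ('a \<Rightarrow> 'a tvec) \<Rightarrow> bool" where
  "vector_field A V X \<longleftrightarrow> (\<forall>x\<in>V. X x \<in> tangent_space A x) \<and>
     (\<forall>W f. open W \<and> W \<subseteq> V \<and> smooth_fun A W f \<longrightarrow> smooth_fun A W (\<lambda>x. X x f))"

definition lie_bracket ::
  "('a::topological_space, 'e::real_normed_vector) chart set \<Rightarrow>
   ('a \<Rightarrow> 'a tvec) \<Rightarrow> ('a \<Rightarrow> 'a tvec) \<Rightarrow> 'a \<Rightarrow> 'a tvec" where
  "lie_bracket A X Y x =
     (\<lambda>f. if smooth_near A x f then X x (\<lambda>y. Y y f) - Y x (\<lambda>y. X y f) else 0)"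

definition local_extension ::
  "('a::topological_space, 'e::real_normed_vector) chart set \<Rightarrow> 'a \<Rightarrow> 'a tvec \<Rightarrow> ('a \<Rightarrow> 'a tvec) \<Rightarrow> bool"
  where
  "local_extension A x v X \<longleftrightarrow> (\<exists>W. open W \<and> x \<in> W \<and> vector_field A W X \<and> X x = v)"


section \<open>Differential forms\<close>

definition one_form ::
  "('a::topological_space, 'e::real_normed_vector) chart set \<Rightarrow> 'a set \<Rightarrow> ('a \<Rightarrow> 'a tvec \<Rightarrow> real) \<Rightarrow> bool"
  where
  "one_form A V \<alpha> \<longleftrightarrow>
     (\<forall>x\<in>V. \<forall>u\<in>tangent_space A x. \<forall>v\<in>tangent_space A x. \<forall>a b.
        \<alpha> x (tlincomb a u b v) = a * \<alpha> x u + b * \<alpha> x v) \<and>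
     (\<forall>W X. open W \<and> W \<subseteq> V \<and> vector_field A W X \<longrightarrow> smooth_fun A W (\<lambda>x. \<alpha> x (X x)))"

text \<open>\<open>d\<alpha>(X, Y) = X(\<alpha>(Y)) - Y(\<alpha>(X)) - \<alpha>([X, Y])\<close> and \<open>(\<L>\<^sub>Y\<alpha>)(X) = Y(\<alpha>(X)) - \<alpha>([Y, X])\<close>;
  both are tensorial in the fields on which the forms are evaluated, so the value at a point is the
  common value for all local extensions.\<close>

definition ext_deriv ::
  "('a::topological_space, 'e::real_normed_vector) chart set \<Rightarrow> ('a \<Rightarrow> 'a tvec \<Rightarrow> real) \<Rightarrow>
   'a \<Rightarrow> 'a tvec \<Rightarrow> 'a tvec \<Rightarrow> real" where
  "ext_deriv A \<alpha> x u v = (THE r. \<exists>X Y. local_extension A x u X \<and> local_extension A x v Y \<and>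
     r = X x (\<lambda>y. \<alpha> y (Y y)) - Y x (\<lambda>y. \<alpha> y (X y)) - \<alpha> x (lie_bracket A X Y x))"

definition lie_deriv_form ::
  "('a::topological_space, 'e::real_normed_vector) chart set \<Rightarrow> ('a \<Rightarrow> 'a tvec) \<Rightarrow>
   ('a \<Rightarrow> 'a tvec \<Rightarrow> real) \<Rightarrow> 'a \<Rightarrow> 'a tvec \<Rightarrow> real" where
  "lie_deriv_form A Y \<alpha> x v = (THE r. \<exists>X. local_extension A x v X \<and>
     r = Y x (\<lambda>y. \<alpha> y (X y)) - \<alpha> x (lie_bracket A Y X x))"

text \<open>\<open>a \<and> \<omega>\<^sup>n\<close> for a linear form \<open>a\<close> and an alternating 2-form \<open>\<omega>\<close>, evaluated on the \<open>2n + 1\<close>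
  vectors \<open>v 0, \<dots>, v (2n)\<close>: the alternating sum of the tensor product, divided by
  \<open>1! (2!)\<^sup>n\<close>.\<close>

definition wedge_power ::
  "nat \<Rightarrow> ('v \<Rightarrow> real) \<Rightarrow> ('v \<Rightarrow> 'v \<Rightarrow> real) \<Rightarrow> (nat \<Rightarrow> 'v) \<Rightarrow> real" where
  "wedge_power n a \<omega> v = (\<Sum>\<sigma> | \<sigma> permutes {..2 * n}. of_int (sign \<sigma>) * a (v (\<sigma> 0)) *
     (\<Prod>i<n. \<omega> (v (\<sigma> (2 * i + 1))) (v (\<sigma> (2 * i + 2))))) / 2 ^ n"


section \<open>Contact structures\<close>

definition contact_form ::
  "nat \<Rightarrow> ('a::topological_space, 'e::real_normed_vector) chart set \<Rightarrow> 'a set \<Rightarrow>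
   ('a \<Rightarrow> 'a tvec \<Rightarrow> real) \<Rightarrow> bool" where
  "contact_form n A U \<alpha> \<longleftrightarrow> open U \<and> one_form A U \<alpha> \<and>
     (\<forall>x\<in>U. \<exists>v. (\<forall>i\<le>2 * n. v i \<in> tangent_space A x) \<and>
        wedge_power n (\<alpha> x) (ext_deriv A \<alpha> x) v \<noteq> 0)"

definition represents ::
  "nat \<Rightarrow> ('a::topological_space, 'e::real_normed_vector) chart set \<Rightarrow> ('a \<Rightarrow> 'a tvec set) \<Rightarrow>
   'a set \<Rightarrow> ('a \<Rightarrow> 'a tvec \<Rightarrow> real) \<Rightarrow> bool" where
  "represents n A H U \<alpha> \<longleftrightarrow> contact_form n A U \<alpha> \<and>
     (\<forall>x\<in>U. H x = {v \<in> tangent_space A x. \<alpha> x v = 0})"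

definition contact_manifold ::
  "nat \<Rightarrow> ('a::{t2_space, second_countable_topology}, 'e::real_normed_vector) chart set \<Rightarrow>
   ('a \<Rightarrow> 'a tvec set) \<Rightarrow> bool" where
  "contact_manifold n A H \<longleftrightarrow> smooth_manifold (2 * n + 1) A \<and> connected (UNIV :: 'a set) \<and>
     (\<forall>x. \<exists>U \<alpha>. x \<in> U \<and> represents n A H U \<alpha>)"

definition isotropic ::
  "nat \<Rightarrow> ('a::topological_space, 'e::real_normed_vector) chart set \<Rightarrow> ('a \<Rightarrow> 'a tvec set) \<Rightarrow>
   'a \<Rightarrow> 'a tvec set \<Rightarrow> bool" where
  "isotropic n A H x S \<longleftrightarrow> S \<subseteq> H x \<and>
     (\<forall>U \<alpha>. x \<in> U \<and> represents n A H U \<alpha> \<longrightarrow> (\<forall>u\<in>S. \<forall>v\<in>S. ext_deriv A \<alpha> x u v = 0))"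


section \<open>Flows and contact vector fields\<close>

definition integral_curve ::
  "('a::topological_space, 'e::real_normed_vector) chart set \<Rightarrow> ('a \<Rightarrow> 'a tvec) \<Rightarrow> real set \<Rightarrow>
   (real \<Rightarrow> 'a) \<Rightarrow> bool" where
  "integral_curve A X I \<gamma> \<longleftrightarrow> open I \<and> is_interval I \<and> continuous_on I \<gamma> \<and>
     (\<forall>t\<in>I. \<forall>f. smooth_near A (\<gamma> t) f \<longrightarrow>
        ((\<lambda>s. f (\<gamma> s)) has_real_derivative X (\<gamma> t) f) (at t))"

definition local_flow ::
  "('a::topological_space, 'e::real_normed_vector) chart set \<Rightarrow> 'a set \<Rightarrow> ('a \<Rightarrow> 'a tvec) \<Rightarrow>
   real \<Rightarrow> 'a set \<Rightarrow> (real \<Rightarrow> 'a \<Rightarrow> 'a) \<Rightarrow> bool" where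
  "local_flow A V X \<epsilon> U \<Phi> \<longleftrightarrow>
     smooth_map_on (prod_atlas real_atlas A) A ({-\<epsilon><..<\<epsilon>} \<times> U) (\<lambda>(t, y). \<Phi> t y) \<and>
     (\<forall>y\<in>U. \<Phi> 0 y = y \<and> (\<forall>t\<in>{-\<epsilon><..<\<epsilon>}. \<Phi> t y \<in> V) \<and>
        integral_curve A X {-\<epsilon><..<\<epsilon>} (\<lambda>t. \<Phi> t y))"

text \<open>The local flow of a smooth field exists near every point and is unique, so ``there is a local flow
  near \<open>x\<close> that preserves \<open>H\<close>'' and ``the local flow near \<open>x\<close> preserves \<open>H\<close>'' agree.\<close>

definition contact_field ::
  "('a::topological_space, 'e::real_normed_vector) chart set \<Rightarrow> ('a \<Rightarrow> 'a tvec set) \<Rightarrow> 'a set \<Rightarrow>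
   ('a \<Rightarrow> 'a tvec) \<Rightarrow> bool" where
  "contact_field A H V X \<longleftrightarrow> vector_field A V X \<and>
     (\<forall>x\<in>V. \<exists>\<epsilon>>0. \<exists>U \<Phi>. open U \<and> x \<in> U \<and> U \<subseteq> V \<and> local_flow A V X \<epsilon> U \<Phi> \<and>
        (\<forall>t\<in>{-\<epsilon><..<\<epsilon>}. \<forall>y\<in>U. differential A A (\<Phi> t) y ` H y = H (\<Phi> t y)))"

definition orbit ::
  "('a::topological_space, 'e::real_normed_vector) chart set \<Rightarrow> ('a \<Rightarrow> 'a tvec) set \<Rightarrow> 'a \<Rightarrow> 'a set" where
  "orbit A \<X> x = {y. (\<lambda>y z. \<exists>Y\<in>\<X>. \<exists>I \<gamma> s t. integral_curve A Y I \<gamma> \<and> s \<in> I \<and> t \<in> I \<and>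
     \<gamma> s = y \<and> \<gamma> t = z)\<^sup>*\<^sup>* x y}"

definition invariant_set ::
  "('a::topological_space, 'e::real_normed_vector) chart set \<Rightarrow> ('a \<Rightarrow> 'a tvec) set \<Rightarrow> 'a set \<Rightarrow> bool" where
  "invariant_set A \<X> U \<longleftrightarrow> (\<forall>x\<in>U. orbit A \<X> x \<subseteq> U)"

definition abelian_contact_algebra ::
  "('a::topological_space, 'e::real_normed_vector) chart set \<Rightarrow> ('a \<Rightarrow> 'a tvec set) \<Rightarrow>
   ('a \<Rightarrow> 'a tvec) set \<Rightarrow> bool" where
  "abelian_contact_algebra A H \<X> \<longleftrightarrow>
     (\<forall>X\<in>\<X>. contact_field A H UNIV X) \<and>
     (\<lambda>x. tzero) \<in> \<X> \<and>
     (\<forall>X\<in>\<X>. \<forall>Y\<in>\<X>. \<forall>a b. (\<lambda>x. tlincomb a (X x) b (Y x)) \<in> \<X>) \<and>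
     (\<forall>X\<in>\<X>. \<forall>Y\<in>\<X>. \<forall>x. lie_bracket A X Y x = tzero)"


section \<open>Complete pre-isotropic contact structures\<close>

definition proper_submersion ::
  "('a::topological_space, 'e::real_normed_vector) chart set \<Rightarrow>
   ('b::topological_space, 'f::real_normed_vector) chart set \<Rightarrow> ('a \<Rightarrow> 'b) \<Rightarrow> bool" where
  "proper_submersion A B \<pi> \<longleftrightarrow> smooth_map_on A B UNIV \<pi> \<and>
     (\<forall>x. differential A B \<pi> x ` tangent_space A x = tangent_space B (\<pi> x)) \<and>
     (\<forall>K. compact K \<longrightarrow> compact (\<pi> -` K))"

definition vertical ::
  "('a::topological_space, 'e::real_normed_vector) chart set \<Rightarrow>
   ('b::topological_space, 'f::real_normed_vector) chart set \<Rightarrow> ('a \<Rightarrow> 'b) \<Rightarrow> 'a \<Rightarrow> 'a tvec set" where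
  "vertical A B \<pi> x = {v \<in> tangent_space A x. differential A B \<pi> x v = tzero}"

text \<open>Since \<open>H\<close> has codimension 1 and \<open>F\<close> constant rank, transversality makes \<open>F \<inter> H\<close> a subbundle.\<close>

definition pre_isotropic ::
  "nat \<Rightarrow> ('a::topological_space, 'e::real_normed_vector) chart set \<Rightarrow> ('a \<Rightarrow> 'a tvec set) \<Rightarrow>
   ('a \<Rightarrow> 'a tvec set) \<Rightarrow> bool" where
  "pre_isotropic n A H F \<longleftrightarrow>
     (\<forall>x. \<forall>v\<in>tangent_space A x. \<exists>u\<in>F x. \<exists>w\<in>H x. v = tlincomb 1 u 1 w) \<and>
     (\<forall>x. isotropic n A H x (F x \<inter> H x))"

text \<open>The last condition follows from the one on orbits; it is stated for definiteness. As \<open>\<X>\<close> is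
  a linear space, the span of its values at \<open>x\<close> is the set of its values at \<open>x\<close>.\<close>

definition complete_pre_isotropic ::
  "nat \<Rightarrow> ('a::{t2_space, second_countable_topology}, 'e::real_normed_vector) chart set \<Rightarrow>
   ('b::{t2_space, second_countable_topology}, 'f::real_normed_vector) chart set \<Rightarrow>
   ('a \<Rightarrow> 'a tvec set) \<Rightarrow> ('a \<Rightarrow> 'a tvec) set \<Rightarrow> ('a \<Rightarrow> 'b) \<Rightarrow> bool" where
  "complete_pre_isotropic n A B H \<X> \<pi> \<longleftrightarrow>
     pre_isotropic n A H (vertical A B \<pi>) \<and>
     abelian_contact_algebra A H \<X> \<and>
     (\<forall>x. orbit A \<X> x = connected_component_set (\<pi> -` {\<pi> x}) x) \<and>
     (\<forall>x. (\<lambda>Y. Y x) ` \<X> = vertical A B \<pi> x)"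


section \<open>Jacobi bracket and completeness\<close>

definition first_integral ::
  "('a::topological_space, 'e::real_normed_vector) chart set \<Rightarrow> ('a \<Rightarrow> 'a tvec set) \<Rightarrow> 'a set \<Rightarrow>
   ('a \<Rightarrow> real) \<Rightarrow> bool" where
  "first_integral A F V f \<longleftrightarrow> smooth_fun A V f \<and> (\<forall>x\<in>V. \<forall>v\<in>F x. v f = 0)"

text \<open>\<open>contact_hamiltonian A H \<alpha> V f X\<close> says that \<open>X\<close> is the field \<open>X\<^sub>f\<close> on \<open>V\<close>; it is a relation
  because a field on \<open>V\<close> has arbitrary values outside \<open>V\<close>.\<close>

definition contact_hamiltonian ::
  "('a::topological_space, 'e::real_normed_vector) chart set \<Rightarrow> ('a \<Rightarrow> 'a tvec set) \<Rightarrow>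
   ('a \<Rightarrow> 'a tvec \<Rightarrow> real) \<Rightarrow> 'a set \<Rightarrow> ('a \<Rightarrow> real) \<Rightarrow> ('a \<Rightarrow> 'a tvec) \<Rightarrow> bool" where
  "contact_hamiltonian A H \<alpha> V f X \<longleftrightarrow> contact_field A H V X \<and> (\<forall>x\<in>V. \<alpha> x (X x) = f x)"

definition is_jacobi_bracket ::
  "('a::topological_space, 'e::real_normed_vector) chart set \<Rightarrow> ('a \<Rightarrow> 'a tvec set) \<Rightarrow>
   ('a \<Rightarrow> 'a tvec \<Rightarrow> real) \<Rightarrow> 'a set \<Rightarrow> ('a \<Rightarrow> real) \<Rightarrow> ('a \<Rightarrow> real) \<Rightarrow> ('a \<Rightarrow> real) \<Rightarrow> bool" where
  "is_jacobi_bracket A H \<alpha> V f g h \<longleftrightarrow>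
     (\<exists>X Y. contact_hamiltonian A H \<alpha> V f X \<and> contact_hamiltonian A H \<alpha> V g Y \<and>
        (\<forall>x\<in>V. h x = \<alpha> x (lie_bracket A X Y x)))"

definition complete_foliation ::
  "('a::topological_space, 'e::real_normed_vector) chart set \<Rightarrow> ('a \<Rightarrow> 'a tvec set) \<Rightarrow>
   ('a \<Rightarrow> 'a tvec \<Rightarrow> real) \<Rightarrow> 'a set \<Rightarrow> ('a \<Rightarrow> 'a tvec set) \<Rightarrow> bool" where
  "complete_foliation A H \<alpha> U F \<longleftrightarrow>
     (\<forall>V f g h. open V \<and> V \<subseteq> U \<and> first_integral A F V f \<and> first_integral A F V g \<and>
        is_jacobi_bracket A H \<alpha> V f g h \<longrightarrow> first_integral A F V h)"

end

(* Transversality provides, at each point, a field Y in \<X> that is not in H there. On the open set U where Y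
   is not in H, let \<alpha> be the form with kernel H and \<alpha>(Y) = 1. A contact field Z satisfies \<alpha>([Z, W]) = 0
   for sections W of H; if also [Z, Y] = 0, then Z(\<alpha>(W)) = \<alpha>([Z, W]) for every field W, since W is a
   section of H plus a multiple of Y. This is the invariance of \<alpha>. If f is a first integral and Z is in \<X>,
   then [Z, X_f] is an infinitesimal contact automorphism with Hamiltonian Z f = 0, so it vanishes by
   nondegeneracy; the Jacobi identity then gives Z [f, g] = \<alpha>([Z, [X_f, X_g]]) = 0. *)

theory Submission
  imports Defs
begin

section \<open>Smooth functions on normed spaces\<close>

text \<open>Commutativity also makes \<open>U\<close> invariant: for \<open>X\<close>,
  \<open>Y\<close>, \<open>Z\<close> in \<open>\<X>\<close>, the value on \<open>Y\<close> of the
  form normalised by \<open>Z\<close> is constant along integral curves of \<open>X\<close>, so the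
  condition that \<open>Y\<close> is not in H spreads along orbits. Since H may have no global
  contact form, \<alpha> is given by a description in terms of H and \<open>Y\<close>; the local
  quotients then agree by themselves. A contact field is defined by its flow, so the bracket
  condition \<alpha>([Z, W]) = 0 has to be extracted from the flow, which takes the symmetry of
  second derivatives. The field [Z, X_f] comes without a flow; it inherits the bracket condition
  from Z and X_f by the Jacobi identity, and this condition is all that the nondegeneracy argument
  asks for. Nondegeneracy of d\<alpha> on H must itself be read off from a nonzero alternating sum
  over permutations. Tangent vectors are derivations, so the coordinates behind these computations
  rest on Hadamard's lemma.\<close>

lemma frechet_derivative_eqI:
  "(f has_derivative f') (at x) \<Longrightarrow> frechet_derivative f (at x) v = f' v"
  using frechet_derivative_at by metis

text \<open>\<open>frechet_derivative\<close> is a choice among the candidates satisfying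
  \<open>has_derivative\<close>. Both functions have the same candidates at \<open>x\<close>, so the
  choices coincide even where no derivative exists.\<close>

lemma frechet_derivative_cong_open:
  assumes "open S" "x \<in> S" "\<And>y. y \<in> S \<Longrightarrow> f y = g y"
  shows "frechet_derivative f (at x) = frechet_derivative g (at x)"
proof -
  have "(f has_derivative D) (at x) \<longleftrightarrow> (g has_derivative D) (at x)" for D
    using has_derivative_transform_within_open[OF _ assms(1,2)] assms(3) by metis
  then show ?thesis
    by (simp add: frechet_derivative_def)
qed

lemma differentiable_cong_open:
  assumes "open S" "x \<in> S" "\<And>y. y \<in> S \<Longrightarrow> f y = g y"
  shows "f differentiable (at x) \<longleftrightarrow> g differentiable (at x)"
  unfolding differentiable_def
  using has_derivative_transform_within_open[OF _ assms(1,2)] assms(3) by metis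

lemma Ck_on_cong:
  assumes "open S" "\<And>x. x \<in> S \<Longrightarrow> f x = g x"
  shows "Ck_on k S f \<longleftrightarrow> Ck_on k S g"
  using assms(2)
proof (induction k arbitrary: f g)
  case 0
  then show ?case by (auto intro: continuous_on_cong)
next
  case (Suc k)
  have "Ck_on k S (\<lambda>x. frechet_derivative f (at x) v) \<longleftrightarrow> Ck_on k S (\<lambda>x. frechet_derivative g (at x) v)" for v
    by (rule Suc.IH) (metis frechet_derivative_cong_open[OF assms(1)] Suc.prems)
  moreover have "(\<forall>x\<in>S. f differentiable (at x)) \<longleftrightarrow> (\<forall>x\<in>S. g differentiable (at x))"
    using differentiable_cong_open[OF assms(1)] Suc.prems by blast
  ultimately show ?case by simp
qed

lemma Ck_on_subset: "Ck_on k S f \<Longrightarrow> T \<subseteq> S \<Longrightarrow> Ck_on k T f"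
  by (induction k arbitrary: f) (auto intro: continuous_on_subset)

lemma Ck_on_local:
  assumes "\<And>x. x \<in> S \<Longrightarrow> \<exists>T. open T \<and> x \<in> T \<and> Ck_on k T f"
  shows "Ck_on k S f"
  using assms
proof (induction k arbitrary: f)
  case 0
  show ?case
    unfolding Ck_on.simps
  proof (intro continuous_at_imp_continuous_on ballI)
    fix x assume "x \<in> S"
    then show "isCont f x"
      using "0.prems"[of x] by (auto simp: continuous_on_eq_continuous_at)
  qed
next
  case (Suc k)
  have "Ck_on k S (\<lambda>x. frechet_derivative f (at x) v)" for v
  proof (rule Suc.IH)
    fix x assume "x \<in> S"
    then show "\<exists>T. open T \<and> x \<in> T \<and> Ck_on k T (\<lambda>x. frechet_derivative f (at x) v)"
      using Suc.prems[of x] by auto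
  qed
  then show ?case using Suc.prems by fastforce
qed

lemma Ck_on_SucD: "Ck_on (Suc k) S f \<Longrightarrow> Ck_on k S f"
proof (induction k arbitrary: f)
  case 0
  then show ?case
    by (auto intro!: continuous_at_imp_continuous_on differentiable_imp_continuous_within)
next
  case (Suc k)
  have "Ck_on k S (\<lambda>x. frechet_derivative f (at x) v)" for v
    by (rule Suc.IH) (use Suc.prems in simp)
  with Suc.prems show ?case by simp
qed

text \<open>Allows a computed derivative \<open>f'\<close> in place of the chosen
  \<open>frechet_derivative\<close>; the closure rules below feed it the familiar formulas of
  calculus.\<close>

lemma Ck_on_SucI:
  assumes "open S" "\<And>x. x \<in> S \<Longrightarrow> (f has_derivative f' x) (at x)"
    "\<And>v. Ck_on k S (\<lambda>x. f' x v)"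
  shows "Ck_on (Suc k) S f"
proof -
  have "Ck_on k S (\<lambda>x. frechet_derivative f (at x) v)" for v
    using assms(3)[of v] Ck_on_cong[OF assms(1), of "\<lambda>x. frechet_derivative f (at x) v" "\<lambda>x. f' x v" k]
      assms(2) frechet_derivative_eqI by metis
  then show ?thesis using assms(2) by (auto simp: differentiable_def)
qed

lemma Ck_on_SucE:
  assumes "Ck_on (Suc k) S f"
  shows "x \<in> S \<Longrightarrow> (f has_derivative frechet_derivative f (at x)) (at x)"
    and "Ck_on k S (\<lambda>x. frechet_derivative f (at x) v)"
  using assms frechet_derivative_works by auto

lemma Ck_on_const: "Ck_on k S (\<lambda>x. c)"
  by (induction k arbitrary: c) auto

lemma Ck_on_bounded_linear:
  assumes "bounded_linear h" "open S" "Ck_on k S f"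
  shows "Ck_on k S (\<lambda>x. h (f x))"
  using assms(3)
proof (induction k arbitrary: f)
  case 0
  then show ?case
    using bounded_linear.continuous_on[OF assms(1)] by simp
next
  case (Suc k)
  show ?case
    by (rule Ck_on_SucI[OF assms(2) bounded_linear.has_derivative[OF assms(1) Ck_on_SucE(1)[OF Suc.prems]]])
      (use Suc Ck_on_SucE(2) in blast)+
qed

lemma Ck_on_id: "open S \<Longrightarrow> Ck_on k S (\<lambda>x. x)"
proof (cases k)
  case (Suc j)
  assume "open S"
  then show ?thesis unfolding Suc
    by (rule Ck_on_SucI[where f' = "\<lambda>x v. v"]) (auto simp: Ck_on_const)
qed auto

lemma Ck_on_add:
  assumes "open S" "Ck_on k S f" "Ck_on k S g"
  shows "Ck_on k S (\<lambda>x. f x + g x)"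
  using assms(2,3)
proof (induction k arbitrary: f g)
  case 0
  then show ?case by (auto intro: continuous_intros)
next
  case (Suc k)
  show ?case
    by (rule Ck_on_SucI[OF assms(1) has_derivative_add[OF Ck_on_SucE(1)[OF Suc.prems(1)] Ck_on_SucE(1)[OF Suc.prems(2)]]])
      (use Suc Ck_on_SucE(2) in blast)+
qed

lemma Ck_on_scaleR:
  fixes f :: "'a::real_normed_vector \<Rightarrow> real" and g :: "'a \<Rightarrow> 'b::real_normed_vector"
  assumes "open S" "Ck_on k S f" "Ck_on k S g"
  shows "Ck_on k S (\<lambda>x. f x *\<^sub>R g x)"
  using assms(2,3)
proof (induction k arbitrary: f g)
  case 0
  then show ?case by (auto intro: continuous_intros)
next
  case (Suc k)
  show ?case
    by (rule Ck_on_SucI[OF assms(1) has_derivative_scaleR[OF Ck_on_SucE(1)[OF Suc.prems(1)] Ck_on_SucE(1)[OF Suc.prems(2)]]])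
      (auto intro!: Ck_on_add[OF assms(1)] Suc.IH Ck_on_SucE(2) Ck_on_SucD[OF Suc.prems(1)]
        Ck_on_SucD[OF Suc.prems(2)] Suc.prems)
qed

lemma Ck_on_mult:
  fixes f g :: "'a::real_normed_vector \<Rightarrow> real"
  shows "open S \<Longrightarrow> Ck_on k S f \<Longrightarrow> Ck_on k S g \<Longrightarrow> Ck_on k S (\<lambda>x. f x * g x)"
  using Ck_on_scaleR[of S k f g] by simp

lemma Ck_on_sum:
  assumes "open S" "\<And>i. i \<in> I \<Longrightarrow> Ck_on k S (f i)"
  shows "Ck_on k S (\<lambda>x. \<Sum>i\<in>I. f i x)"
  using assms(2)
  by (induction I rule: infinite_finite_induct) (auto intro: Ck_on_const Ck_on_add[OF assms(1)])

text \<open>The derivative -(1/f) Df (1/f) contains 1/f itself, one order of smoothness lower, so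
  the induction on \<open>k\<close> can keep \<open>f\<close> fixed.\<close>

lemma Ck_on_inverse:
  fixes f :: "'a::real_normed_vector \<Rightarrow> real"
  assumes "open S" "Ck_on k S f" "\<And>x. x \<in> S \<Longrightarrow> f x \<noteq> 0"
  shows "Ck_on k S (\<lambda>x. inverse (f x))"
  using assms(2)
proof (induction k)
  case 0
  then show ?case using assms(3) by (auto intro: continuous_intros)
next
  case (Suc k)
  have "((\<lambda>x. inverse (f x)) has_derivative
      (\<lambda>h. - (inverse (f x) * frechet_derivative f (at x) h * inverse (f x)))) (at x)" if "x \<in> S" for x
    using Deriv.has_derivative_inverse[OF assms(3)[OF that] Ck_on_SucE(1)[OF Suc.prems that]] by simp
  moreover have "Ck_on k S (\<lambda>x. - (inverse (f x) * frechet_derivative f (at x) h * inverse (f x)))" for h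
  proof -
    have i: "Ck_on k S (\<lambda>x. inverse (f x))"
      using Suc Ck_on_SucD by blast
    have "Ck_on k S (\<lambda>x. (-1) * ((inverse (f x) * frechet_derivative f (at x) h) * inverse (f x)))"
      by (intro Ck_on_mult assms(1) Ck_on_const i Ck_on_SucE(2)[OF Suc.prems])
    then show ?thesis by simp
  qed
  ultimately show ?case by (rule Ck_on_SucI[OF assms(1)])
qed

text \<open>\<open>Ck_on\<close> controls derivatives in fixed directions only, while the chain rule
  takes Dg in the direction \<open>?Df x v\<close>, which moves with \<open>x\<close>. Expanding
  that direction in \<open>Basis\<close> leaves a sum of products covered by the earlier rules; this
  is the role of the Euclidean space in the middle.\<close>

lemma Ck_on_compose:
  fixes f :: "'a::real_normed_vector \<Rightarrow> 'b::euclidean_space" and g :: "'b \<Rightarrow> 'c::real_normed_vector"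
  assumes "open S" "Ck_on k S f" "Ck_on k T g" "f ` S \<subseteq> T"
  shows "Ck_on k S (\<lambda>x. g (f x))"
  using assms(2,3)
proof (induction k arbitrary: g)
  case 0
  then show ?case using assms(4) by (auto intro: continuous_on_compose2)
next
  case (Suc k)
  let ?Df = "\<lambda>x. frechet_derivative f (at x)" and ?Dg = "\<lambda>x. frechet_derivative g (at x)"
  have g: "(g has_derivative ?Dg y) (at y)" if "y \<in> T" for y
    using Ck_on_SucE(1)[OF Suc.prems(2) that] .
  have d: "((\<lambda>x. g (f x)) has_derivative (\<lambda>v. ?Dg (f x) (?Df x v))) (at x)" if "x \<in> S" for x
    by (rule has_derivative_compose[OF Ck_on_SucE(1)[OF Suc.prems(1) that] g]) (use that assms(4) in auto)
  have e: "?Dg (f x) (?Df x v) = (\<Sum>b\<in>Basis. (?Df x v \<bullet> b) *\<^sub>R ?Dg (f x) b)" if "x \<in> S" for x v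
  proof -
    interpret linear "?Dg (f x)"
      using g[of "f x"] that assms(4) has_derivative_linear by blast
    show ?thesis
      by (subst euclidean_representation[of "?Df x v", symmetric]) (simp add: sum scale)
  qed
  have c: "Ck_on k S (\<lambda>x. \<Sum>b\<in>Basis. (?Df x v \<bullet> b) *\<^sub>R ?Dg (f x) b)" for v
  proof (intro Ck_on_sum Ck_on_scaleR assms(1))
    fix b :: 'b assume "b \<in> Basis"
    show "Ck_on k S (\<lambda>x. ?Df x v \<bullet> b)"
      by (rule Ck_on_bounded_linear[OF bounded_linear_inner_left assms(1) Ck_on_SucE(2)[OF Suc.prems(1)]])
    show "Ck_on k S (\<lambda>x. ?Dg (f x) b)"
      by (rule Suc.IH[OF Ck_on_SucD[OF Suc.prems(1)] Ck_on_SucE(2)[OF Suc.prems(2)]])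
  qed
  show ?case
  proof (rule Ck_on_SucI[OF assms(1) d])
    show "Ck_on k S (\<lambda>x. ?Dg (f x) (?Df x v))" for v
      by (rule iffD2[OF Ck_on_cong[OF assms(1) e] c])
  qed
qed

lemma smooth_onD_derivative:
  assumes "smooth_on S f" "x \<in> S"
  shows "(f has_derivative frechet_derivative f (at x)) (at x)"
  using assms Ck_on_SucE(1)[of 0] unfolding smooth_on_def by blast

section \<open>Rules for smooth functions on open sets\<close>

lemma smooth_on_derivative:
  "smooth_on S f \<Longrightarrow> smooth_on S (\<lambda>x. frechet_derivative f (at x) v)"
  using Ck_on_SucE(2) unfolding smooth_on_def by blast

lemma smooth_on_imp_continuous_on: "smooth_on S f \<Longrightarrow> continuous_on S f"
  unfolding smooth_on_def using Ck_on.simps(1) by blast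

lemma smooth_on_subset: "smooth_on S f \<Longrightarrow> T \<subseteq> S \<Longrightarrow> smooth_on T f"
  unfolding smooth_on_def using Ck_on_subset by blast

lemma smooth_on_cong:
  "open S \<Longrightarrow> (\<And>x. x \<in> S \<Longrightarrow> f x = g x) \<Longrightarrow> smooth_on S f \<longleftrightarrow> smooth_on S g"
  unfolding smooth_on_def using Ck_on_cong by blast

lemma smooth_on_local:
  "(\<And>x. x \<in> S \<Longrightarrow> \<exists>T. open T \<and> x \<in> T \<and> smooth_on T f) \<Longrightarrow> smooth_on S f"
  unfolding smooth_on_def using Ck_on_local by metis

lemma smooth_on_const: "smooth_on S (\<lambda>x. c)"
  by (simp add: smooth_on_def Ck_on_const)

lemma smooth_on_id: "open S \<Longrightarrow> smooth_on S (\<lambda>x. x)"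
  by (simp add: smooth_on_def Ck_on_id)

lemma smooth_on_bounded_linear:
  "bounded_linear h \<Longrightarrow> open S \<Longrightarrow> smooth_on S f \<Longrightarrow> smooth_on S (\<lambda>x. h (f x))"
  by (simp add: smooth_on_def Ck_on_bounded_linear)

lemma smooth_on_add:
  "open S \<Longrightarrow> smooth_on S f \<Longrightarrow> smooth_on S g \<Longrightarrow> smooth_on S (\<lambda>x. f x + g x)"
  by (simp add: smooth_on_def Ck_on_add)

lemma smooth_on_mult:
  fixes f g :: "'a::real_normed_vector \<Rightarrow> real"
  shows "open S \<Longrightarrow> smooth_on S f \<Longrightarrow> smooth_on S g \<Longrightarrow> smooth_on S (\<lambda>x. f x * g x)"
  by (simp add: smooth_on_def Ck_on_mult)

lemma smooth_on_inverse:
  fixes f :: "'a::real_normed_vector \<Rightarrow> real"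
  shows "open S \<Longrightarrow> smooth_on S f \<Longrightarrow> (\<And>x. x \<in> S \<Longrightarrow> f x \<noteq> 0) \<Longrightarrow> smooth_on S (\<lambda>x. inverse (f x))"
  by (simp add: smooth_on_def Ck_on_inverse)

lemma smooth_on_compose:
  fixes f :: "'a::real_normed_vector \<Rightarrow> 'b::euclidean_space" and g :: "'b \<Rightarrow> 'c::real_normed_vector"
  assumes "open S" "smooth_on S f" "smooth_on T g" "f ` S \<subseteq> T"
  shows "smooth_on S (\<lambda>x. g (f x))"
  using assms Ck_on_compose unfolding smooth_on_def by blast

section \<open>Symmetry of second derivatives\<close>

lemma has_real_derivative_along_line:
  fixes f :: "'a::real_normed_vector \<Rightarrow> real"
  assumes "(f has_derivative f') (at (p + t *\<^sub>R v))"
  shows "((\<lambda>t. f (p + t *\<^sub>R v)) has_real_derivative f' v) (at t)"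
proof -
  have "((\<lambda>t. p + t *\<^sub>R v) has_derivative (\<lambda>s. s *\<^sub>R v)) (at t)"
    by (auto intro!: derivative_eq_intros)
  from has_derivative_compose[OF this assms]
  have "((\<lambda>t. f (p + t *\<^sub>R v)) has_derivative (\<lambda>s. f' (s *\<^sub>R v))) (at t)" .
  moreover have "f' (s *\<^sub>R v) = f' v * s" for s
    using linear_scale[OF has_derivative_linear[OF assms], of s v] by simp
  ultimately show ?thesis
    by (simp add: has_field_derivative_def)
qed

text \<open>The second difference is G(h) - G(0) for G(s) = f(x + h v + s u) - f(x + s u). The mean
  value theorem for G produces \<open>s\<close>; applied next to the derivative of f along u as a
  function on the segment from x + s u to x + s u + h v, it produces \<open>t\<close>.\<close>

lemma second_difference_mean_value:
  fixes f :: "'a::real_normed_vector \<Rightarrow> real"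
  assumes "smooth_on S f" "h > 0"
    and "\<And>s t. 0 \<le> s \<Longrightarrow> s \<le> h \<Longrightarrow> 0 \<le> t \<Longrightarrow> t \<le> h \<Longrightarrow> x + s *\<^sub>R u + t *\<^sub>R v \<in> S"
  shows "\<exists>s t. 0 \<le> s \<and> s \<le> h \<and> 0 \<le> t \<and> t \<le> h \<and>
    f (x + h *\<^sub>R u + h *\<^sub>R v) - f (x + h *\<^sub>R u) - f (x + h *\<^sub>R v) + f x =
    h * h * frechet_derivative (\<lambda>y. frechet_derivative f (at y) u) (at (x + s *\<^sub>R u + t *\<^sub>R v)) v"
proof -
  let ?D = "\<lambda>y. frechet_derivative f (at y) u"
  let ?G = "\<lambda>s. f ((x + h *\<^sub>R v) + s *\<^sub>R u) - f (x + s *\<^sub>R u)"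
  have line: "((\<lambda>t. g (p + t *\<^sub>R w)) has_real_derivative frechet_derivative g (at (p + t *\<^sub>R w)) w) (at t)"
    if "smooth_on S g" "p + t *\<^sub>R w \<in> S" for g :: "'a \<Rightarrow> real" and p w t
    using has_real_derivative_along_line[OF smooth_onD_derivative[OF that]] .
  have G: "(?G has_real_derivative ?D (x + h *\<^sub>R v + s *\<^sub>R u) - ?D (x + s *\<^sub>R u)) (at s)"
    if "0 \<le> s" "s \<le> h" for s
  proof (rule DERIV_diff)
    have "x + h *\<^sub>R v + s *\<^sub>R u \<in> S" "x + s *\<^sub>R u \<in> S"
      using assms(3)[OF that, of h] assms(3)[OF that, of 0] assms(2) by (simp_all add: ac_simps)
    then show "((\<lambda>s. f ((x + h *\<^sub>R v) + s *\<^sub>R u)) has_real_derivative ?D (x + h *\<^sub>R v + s *\<^sub>R u)) (at s)"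
      "((\<lambda>s. f (x + s *\<^sub>R u)) has_real_derivative ?D (x + s *\<^sub>R u)) (at s)"
      using line[OF assms(1)] by blast+
  qed
  obtain s where s: "0 < s" "s < h"
    "?G h - ?G 0 = (h - 0) * (?D (x + h *\<^sub>R v + s *\<^sub>R u) - ?D (x + s *\<^sub>R u))"
    using MVT2[OF assms(2), of ?G "\<lambda>s. ?D (x + h *\<^sub>R v + s *\<^sub>R u) - ?D (x + s *\<^sub>R u)"] G by auto
  have K: "((\<lambda>t. ?D ((x + s *\<^sub>R u) + t *\<^sub>R v)) has_real_derivative
      frechet_derivative ?D (at (x + s *\<^sub>R u + t *\<^sub>R v)) v) (at t)"
    if "0 \<le> t" "t \<le> h" for t
    using line[OF smooth_on_derivative[OF assms(1)] assms(3)[OF _ _ that, of s]] s by simp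
  obtain t where t: "0 < t" "t < h"
    "?D ((x + s *\<^sub>R u) + h *\<^sub>R v) - ?D ((x + s *\<^sub>R u) + 0 *\<^sub>R v) =
      (h - 0) * frechet_derivative ?D (at (x + s *\<^sub>R u + t *\<^sub>R v)) v"
    using MVT2[OF assms(2), of "\<lambda>t. ?D ((x + s *\<^sub>R u) + t *\<^sub>R v)", OF K] by auto
  have "?G h - ?G 0 = f (x + h *\<^sub>R u + h *\<^sub>R v) - f (x + h *\<^sub>R u) - f (x + h *\<^sub>R v) + f x"
    by (simp add: ac_simps)
  moreover have "?G h - ?G 0 = h * (?D (x + s *\<^sub>R u + h *\<^sub>R v) - ?D (x + s *\<^sub>R u))"
    using s(3) by (simp add: ac_simps)
  moreover have "?D (x + s *\<^sub>R u + h *\<^sub>R v) - ?D (x + s *\<^sub>R u) =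
      h * frechet_derivative ?D (at (x + s *\<^sub>R u + t *\<^sub>R v)) v"
    using t(3) by simp
  ultimately have "f (x + h *\<^sub>R u + h *\<^sub>R v) - f (x + h *\<^sub>R u) - f (x + h *\<^sub>R v) + f x =
      h * h * frechet_derivative ?D (at (x + s *\<^sub>R u + t *\<^sub>R v)) v"
    by (metis mult.assoc)
  then show ?thesis
    using s t less_imp_le by blast
qed

text \<open>The second difference is symmetric in \<open>u\<close> and \<open>v\<close>. It equals h
  * h times either mixed derivative at some point near \<open>x\<close>, so continuity at
  \<open>x\<close> forces the two to agree.\<close>

lemma frechet_derivative_commute:
  fixes f :: "'a::real_normed_vector \<Rightarrow> real"
  assumes "open S" "smooth_on S f" "x \<in> S"
  shows "frechet_derivative (\<lambda>y. frechet_derivative f (at y) u) (at x) v =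
    frechet_derivative (\<lambda>y. frechet_derivative f (at y) v) (at x) u" (is "?P x = ?Q x")
proof (rule ccontr)
  assume ne: "?P x \<noteq> ?Q x"
  define e where "e = \<bar>?P x - ?Q x\<bar> / 2"
  have "e > 0" using ne by (simp add: e_def)
  have cont: "isCont (\<lambda>y. frechet_derivative (\<lambda>y. frechet_derivative f (at y) u) (at y) v) x" for u v
    using smooth_on_imp_continuous_on[OF smooth_on_derivative[OF smooth_on_derivative[OF assms(2)]]]
      assms(1,3) continuous_on_eq_continuous_at by blast
  obtain d1 where d1: "d1 > 0" "\<And>y. dist y x < d1 \<Longrightarrow> dist (?P y) (?P x) < e"
    using cont[of u v] \<open>e > 0\<close> unfolding continuous_at_eps_delta by blast
  obtain d2 where d2: "d2 > 0" "\<And>y. dist y x < d2 \<Longrightarrow> dist (?Q y) (?Q x) < e"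
    using cont[of v u] \<open>e > 0\<close> unfolding continuous_at_eps_delta by blast
  obtain d3 where d3: "d3 > 0" "ball x d3 \<subseteq> S"
    using assms(1,3) openE by blast
  \<comment> \<open>\<open>d\<close> serves both continuity bounds and the inclusion in
    \<open>S\<close>; the summand 1 keeps \<open>c\<close> positive when \<open>u\<close> and
    \<open>v\<close> vanish. With h = d / (2 c) the whole parallelogram stays within d / 2 of
    \<open>x\<close>.\<close>
  define d where "d = min d1 (min d2 d3)"
  define c where "c = norm u + norm v + 1"
  have "c > 0" by (simp add: c_def add_nonneg_pos)
  define h where "h = d / (2 * c)"
  have "d > 0" "h > 0" using d1 d2 d3 \<open>c > 0\<close> by (simp_all add: d_def h_def)
  have near: "dist (x + s *\<^sub>R u + t *\<^sub>R v) x < d" if "0 \<le> s" "s \<le> h" "0 \<le> t" "t \<le> h" for s t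
  proof -
    have "norm (s *\<^sub>R u + t *\<^sub>R v) \<le> s * norm u + t * norm v"
      using norm_triangle_ineq[of "s *\<^sub>R u" "t *\<^sub>R v"] that by simp
    also have "\<dots> \<le> h * norm u + h * norm v"
      using that by (intro add_mono mult_right_mono) auto
    also have "\<dots> \<le> h * c"
      using \<open>h > 0\<close> by (simp add: c_def algebra_simps)
    also have "\<dots> = d / 2"
      using \<open>c > 0\<close> by (simp add: h_def)
    also have "\<dots> < d" using \<open>d > 0\<close> by simp
    finally show ?thesis by (simp add: dist_norm add.assoc)
  qed
  have S: "x + s *\<^sub>R u + t *\<^sub>R v \<in> S" if "0 \<le> s" "s \<le> h" "0 \<le> t" "t \<le> h" for s t
    using near[OF that] d3 by (auto simp: d_def dist_commute)
  have S': "x + t *\<^sub>R v + s *\<^sub>R u \<in> S" if "0 \<le> t" "t \<le> h" "0 \<le> s" "s \<le> h" for s t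
    using S[OF that(3,4,1,2)] by (simp add: algebra_simps)
  obtain s t where st: "0 \<le> s" "s \<le> h" "0 \<le> t" "t \<le> h"
    "f (x + h *\<^sub>R u + h *\<^sub>R v) - f (x + h *\<^sub>R u) - f (x + h *\<^sub>R v) + f x =
    h * h * ?P (x + s *\<^sub>R u + t *\<^sub>R v)"
    using second_difference_mean_value[OF assms(2) \<open>h > 0\<close>, of x u v, OF S] by blast
  obtain s' t' where st': "0 \<le> s'" "s' \<le> h" "0 \<le> t'" "t' \<le> h"
    "f (x + h *\<^sub>R v + h *\<^sub>R u) - f (x + h *\<^sub>R v) - f (x + h *\<^sub>R u) + f x =
    h * h * ?Q (x + t' *\<^sub>R v + s' *\<^sub>R u)"
    using second_difference_mean_value[OF assms(2) \<open>h > 0\<close>, of x v u, OF S'] by blast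
  have "h * h * ?P (x + s *\<^sub>R u + t *\<^sub>R v) = h * h * ?Q (x + t' *\<^sub>R v + s' *\<^sub>R u)"
    unfolding st(5)[symmetric] st'(5)[symmetric] by (simp add: ac_simps)
  then have "?P (x + s *\<^sub>R u + t *\<^sub>R v) = ?Q (x + t' *\<^sub>R v + s' *\<^sub>R u)"
    using \<open>h > 0\<close> by simp
  moreover have "x + t' *\<^sub>R v + s' *\<^sub>R u = x + s' *\<^sub>R u + t' *\<^sub>R v"
    by (simp add: ac_simps)
  ultimately have "?P (x + s *\<^sub>R u + t *\<^sub>R v) = ?Q (x + s' *\<^sub>R u + t' *\<^sub>R v)"
    by simp
  moreover have "dist (?P (x + s *\<^sub>R u + t *\<^sub>R v)) (?P x) < e"
    using d1(2) near[OF st(1-4)] by (simp add: d_def)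
  moreover have "dist (?Q (x + s' *\<^sub>R u + t' *\<^sub>R v)) (?Q x) < e"
    using d2(2) near[OF st'(1-4)] by (simp add: d_def)
  ultimately show False
    unfolding e_def dist_real_def by argo
qed

text \<open>These integrals are the coefficient functions of Hadamard's lemma, where
  \<open>m = 0\<close>. Each differentiation under the integral brings out a factor t, so the
  induction has to run over all weights \<open>t ^ m\<close>.\<close>

lemma Ck_on_radial_mean:
  fixes f :: "'a::euclidean_space \<Rightarrow> real"
  assumes "open S" "convex S" "x0 \<in> S" "smooth_on S f"
  shows "Ck_on k S (\<lambda>x. integral {0..1} (\<lambda>t. t ^ m * f (x0 + t *\<^sub>R (x - x0))))"
proof -
  let ?p = "\<lambda>x t. x0 + t *\<^sub>R (x - x0)"
  have p: "?p x t \<in> S" if "x \<in> S" "t \<in> {0..1}" for x t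
    using convexD[OF assms(2,3) that(1), of "1 - t" t] that(2) by (simp add: algebra_simps)
  have deriv: "((\<lambda>x. integral {0..1} (\<lambda>t. t ^ m * f (?p x t))) has_derivative
      (\<lambda>v. integral {0..1} (\<lambda>t. t ^ Suc m * frechet_derivative f (at (?p x t)) v))) (at x)"
    if f: "smooth_on S f" and x: "x \<in> S" for f :: "'a \<Rightarrow> real" and m x
  proof -
    \<comment> \<open>The Leibniz rule wants the derivative as a bounded linear function, jointly
      continuous in \<open>x\<close> and \<open>t\<close>. Joint continuity is checked on basis
      vectors, where it concerns directional derivatives of \<open>f\<close>.\<close>
    let ?B = "\<lambda>x t. t ^ Suc m *\<^sub>R Blinfun (frechet_derivative f (at (?p x t)))"
    have bl: "bounded_linear (frechet_derivative f (at (?p x t)))" if "x \<in> S" "t \<in> {0..1}" for x t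
      using smooth_onD_derivative[OF f p[OF that]] has_derivative_bounded_linear by blast
    have contp: "continuous_on T (\<lambda>z. ?p (fst z) (snd z))" for T :: "('a \<times> real) set"
      by (intro continuous_intros)
    have cont: "continuous_on (S \<times> {0..1}) (\<lambda>(x, t). ?B x t)"
      unfolding split_beta
    proof (rule continuous_on_blinfun_componentwise)
      fix b :: 'a assume "b \<in> Basis"
      have "continuous_on (S \<times> {0..1}) (\<lambda>z. snd z ^ Suc m * frechet_derivative f (at (?p (fst z) (snd z))) b)"
        using p by (intro continuous_intros contp
          continuous_on_compose2[OF smooth_on_imp_continuous_on[OF smooth_on_derivative[OF f]]]) auto
      then show "continuous_on (S \<times> {0..1}) (\<lambda>z. blinfun_apply (?B (fst z) (snd z)) b)"
        by (rule continuous_on_eq) (use bl in \<open>auto simp: blinfun.scaleR_left bounded_linear_Blinfun_apply\<close>)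
    qed
    have fx: "((\<lambda>x. t ^ m * f (?p x t)) has_derivative blinfun_apply (?B x t)) (at x within S)"
      if "x \<in> S" "t \<in> {0..1}" for x t
    proof -
      have "((\<lambda>x. ?p x t) has_derivative (\<lambda>v. t *\<^sub>R v)) (at x)"
        by (auto intro!: derivative_eq_intros)
      from has_derivative_compose[OF this smooth_onD_derivative[OF f p[OF that]]]
      have "((\<lambda>x. t ^ m * f (?p x t)) has_derivative (\<lambda>v. t ^ m * frechet_derivative f (at (?p x t)) (t *\<^sub>R v))) (at x)"
        by (rule has_derivative_mult_right)
      moreover have "(\<lambda>v. t ^ m * frechet_derivative f (at (?p x t)) (t *\<^sub>R v)) = blinfun_apply (?B x t)"
        using bl[OF that] by (auto simp: blinfun.scaleR_left bounded_linear_Blinfun_apply linear_simps)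
      ultimately show ?thesis
        using has_derivative_at_withinI by fastforce
    qed
    have int: "(\<lambda>t. t ^ m * f (?p x t)) integrable_on cbox 0 1" if "x \<in> S" for x
      using p[OF that] by (intro integrable_continuous continuous_intros
        continuous_on_compose2[OF smooth_on_imp_continuous_on[OF f]]) auto
    have "((\<lambda>x. integral (cbox 0 1) (\<lambda>t. t ^ m * f (?p x t))) has_derivative
        blinfun_apply (integral (cbox 0 1) (?B x))) (at x within S)"
    proof (rule leibniz_rule[where f = "\<lambda>x t. t ^ m * f (?p x t)" and fx = ?B])
      show "((\<lambda>x. t ^ m * f (?p x t)) has_derivative blinfun_apply (?B x t)) (at x within S)"
        if "x \<in> S" "t \<in> cbox 0 1" for x t
        using fx that by (simp only: box_real)
      show "continuous_on (S \<times> cbox 0 1) (\<lambda>(x, t). ?B x t)"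
        using cont by (simp only: box_real)
    qed (fact int x assms(2))+
    moreover have "blinfun_apply (integral (cbox 0 1) (?B x)) v =
        integral (cbox 0 1) (\<lambda>t. t ^ Suc m * frechet_derivative f (at (?p x t)) v)" for v
    proof -
      have "continuous_on (cbox 0 1) (\<lambda>t. (\<lambda>(x, t). ?B x t) (x, t))"
        by (rule continuous_on_compose2[OF cont continuous_on_Pair[OF continuous_on_const continuous_on_id]])
          (use x in auto)
      then have "continuous_on (cbox 0 1) (?B x)"
        unfolding prod.case .
      then have "(?B x) integrable_on cbox 0 1"
        by (rule integrable_continuous)
      from integral_linear[OF this, of "\<lambda>B. blinfun_apply B v"]
      have "blinfun_apply (integral (cbox 0 1) (?B x)) v = integral (cbox 0 1) (\<lambda>t. blinfun_apply (?B x t) v)"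
        by (auto simp: o_def intro: bounded_linear_intros)
      also have "\<dots> = integral (cbox 0 1) (\<lambda>t. t ^ Suc m * frechet_derivative f (at (?p x t)) v)"
        by (rule integral_cong) (use bl[OF x] in \<open>auto simp: blinfun.scaleR_left bounded_linear_Blinfun_apply\<close>)
      finally show ?thesis .
    qed
    then have "blinfun_apply (integral (cbox 0 1) (?B x)) =
        (\<lambda>v. integral (cbox 0 1) (\<lambda>t. t ^ Suc m * frechet_derivative f (at (?p x t)) v))"
      by blast
    ultimately show ?thesis
      unfolding at_within_open[OF x assms(1)] by (simp only: box_real)
  qed
  show ?thesis
    using assms(4)
  proof (induction k arbitrary: m f)
    case 0
    show ?case
      unfolding Ck_on.simps
      by (intro continuous_at_imp_continuous_on ballI has_derivative_continuous[OF deriv[OF 0]])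
  next
    case (Suc k)
    show ?case
      by (rule Ck_on_SucI[OF assms(1) deriv[OF Suc.prems]])
        (assumption | rule Suc.IH[OF smooth_on_derivative[OF Suc.prems]])+
  qed
qed

text \<open>The fundamental theorem of calculus on the segment from \<open>x0\<close> to
  \<open>x\<close>, with x - x0 expanded in the basis. The coefficient \<open>g b\<close> is the
  mean over that segment of the derivative of \<open>f\<close> along \<open>b\<close>.\<close>

lemma hadamard_decomposition:
  fixes f :: "'a::euclidean_space \<Rightarrow> real"
  assumes "open S" "convex S" "x0 \<in> S" "smooth_on S f"
  obtains g where "\<And>b. smooth_on S (g b)" "\<And>b. g b x0 = frechet_derivative f (at x0) b"
    "\<And>x. x \<in> S \<Longrightarrow> f x = f x0 + (\<Sum>b\<in>Basis. ((x - x0) \<bullet> b) * g b x)"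
proof
  let ?p = "\<lambda>x t. x0 + t *\<^sub>R (x - x0)"
  define g where "g b x = integral {0..1} (\<lambda>t. frechet_derivative f (at (?p x t)) b)" for b x
  show "smooth_on S (g b)" for b
    using Ck_on_radial_mean[OF assms(1-3) smooth_on_derivative[OF assms(4)], of _ 0 b]
    unfolding smooth_on_def g_def[abs_def] by simp
  show "g b x0 = frechet_derivative f (at x0) b" for b
    by (simp add: g_def)
  fix x assume x: "x \<in> S"
  have p: "?p x t \<in> S" if "t \<in> {0..1}" for t
    using convexD[OF assms(2,3) x, of "1 - t" t] that by (simp add: algebra_simps)
  have D: "(f has_derivative frechet_derivative f (at (?p x t))) (at (?p x t))" if "t \<in> {0..1}" for t
    using smooth_onD_derivative[OF assms(4) p[OF that]] .
  have fund: "((\<lambda>t. frechet_derivative f (at (?p x t)) (x - x0)) has_integral f (?p x 1) - f (?p x 0)) {0..1}"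
  proof (rule fundamental_theorem_of_calculus)
    fix t :: real assume "t \<in> {0..1}"
    then have "((\<lambda>t. f (?p x t)) has_vector_derivative frechet_derivative f (at (?p x t)) (x - x0)) (at t)"
      using has_real_derivative_along_line[OF D] has_real_derivative_iff_has_vector_derivative by blast
    then show "((\<lambda>t. f (?p x t)) has_vector_derivative frechet_derivative f (at (?p x t)) (x - x0)) (at t within {0..1})"
      by (rule has_vector_derivative_at_within)
  qed simp
  have int: "(\<lambda>t. frechet_derivative f (at (?p x t)) b) integrable_on {0..1}" for b
    using p by (intro integrable_continuous_interval continuous_intros
      continuous_on_compose2[OF smooth_on_imp_continuous_on[OF smooth_on_derivative[OF assms(4)]]]) auto
  have "((\<lambda>t. \<Sum>b\<in>Basis. ((x - x0) \<bullet> b) * frechet_derivative f (at (?p x t)) b) has_integral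
      (\<Sum>b\<in>Basis. ((x - x0) \<bullet> b) * g b x)) {0..1}"
    unfolding g_def
    by (rule has_integral_sum[OF finite_Basis]) (rule has_integral_mult_right[OF integrable_integral[OF int]])
  then have "((\<lambda>t. frechet_derivative f (at (?p x t)) (x - x0)) has_integral
      (\<Sum>b\<in>Basis. ((x - x0) \<bullet> b) * g b x)) {0..1}"
  proof (rule has_integral_eq[rotated])
    fix t :: real assume "t \<in> {0..1}"
    then interpret linear "frechet_derivative f (at (?p x t))"
      using D has_derivative_linear by blast
    show "(\<Sum>b\<in>Basis. ((x - x0) \<bullet> b) * frechet_derivative f (at (?p x t)) b) =
        frechet_derivative f (at (?p x t)) (x - x0)"
      using arg_cong[OF euclidean_representation[of "x - x0"], of "frechet_derivative f (at (?p x t))"]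
      by (simp only: sum scale real_scaleR_def)
  qed
  with fund have "f (?p x 1) - f (?p x 0) = (\<Sum>b\<in>Basis. ((x - x0) \<bullet> b) * g b x)"
    by (rule has_integral_unique)
  then show "f x = f x0 + (\<Sum>b\<in>Basis. ((x - x0) \<bullet> b) * g b x)"
    by simp
qed

section \<open>The alternating sum defining the form \<open>a \<and> \<omega>\<^sup>n\<close>\<close>

text \<open>Reindexing by the transposition reverses every sign and keeps \<open>Q\<close>, so the
  sum is its own negative. Composition on the right exchanges two argument slots of the tensor
  product.\<close>

lemma sum_permutations_sign_right_eq_0:
  fixes Q :: "('a \<Rightarrow> 'a) \<Rightarrow> real"
  assumes "finite S" "p \<in> S" "q \<in> S" "p \<noteq> q"
    and "\<And>\<sigma>. \<sigma> permutes S \<Longrightarrow> Q (\<sigma> \<circ> Transposition.transpose p q) = Q \<sigma>"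
  shows "(\<Sum>\<sigma> | \<sigma> permutes S. of_int (sign \<sigma>) * Q \<sigma>) = 0"
proof -
  have \<tau>: "Transposition.transpose p q permutes S"
    using assms(2,3) by (rule permutes_swap_id)
  have "(\<Sum>\<sigma> | \<sigma> permutes S. of_int (sign \<sigma>) * Q \<sigma>) =
      (\<Sum>\<sigma> | \<sigma> permutes S. of_int (sign (\<sigma> \<circ> Transposition.transpose p q)) * Q (\<sigma> \<circ> Transposition.transpose p q))"
    by (rule sum_permutations_compose_right[OF \<tau>])
  also have "\<dots> = (\<Sum>\<sigma> | \<sigma> permutes S. - (of_int (sign \<sigma>) * Q \<sigma>))"
  proof (rule sum.cong[OF refl])
    fix \<sigma> assume "\<sigma> \<in> {\<sigma>. \<sigma> permutes S}"
    then have \<sigma>: "\<sigma> permutes S" by simp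
    have "sign (\<sigma> \<circ> Transposition.transpose p q) = - sign \<sigma>"
      using permutation_permutes assms(1) \<sigma> \<tau>
      by (subst sign_compose) (auto simp: sign_swap_id assms(4))
    then show "of_int (sign (\<sigma> \<circ> Transposition.transpose p q)) * Q (\<sigma> \<circ> Transposition.transpose p q) = - (of_int (sign \<sigma>) * Q \<sigma>)"
      using assms(5)[OF \<sigma>] by simp
  qed
  finally show ?thesis by (simp add: sum_negf)
qed

text \<open>The same cancellation, but composition on the left exchanges two of the vectors instead
  of two slots.\<close>

lemma sum_permutations_sign_left_eq_0:
  fixes Q :: "('a \<Rightarrow> 'a) \<Rightarrow> real"
  assumes "finite S" "p \<in> S" "q \<in> S" "p \<noteq> q"
    and "\<And>\<sigma>. \<sigma> permutes S \<Longrightarrow> Q (Transposition.transpose p q \<circ> \<sigma>) = Q \<sigma>"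
  shows "(\<Sum>\<sigma> | \<sigma> permutes S. of_int (sign \<sigma>) * Q \<sigma>) = 0"
proof -
  have \<tau>: "Transposition.transpose p q permutes S"
    using assms(2,3) by (rule permutes_swap_id)
  have "(\<Sum>\<sigma> | \<sigma> permutes S. of_int (sign \<sigma>) * Q \<sigma>) =
      (\<Sum>\<sigma> | \<sigma> permutes S. of_int (sign (Transposition.transpose p q \<circ> \<sigma>)) * Q (Transposition.transpose p q \<circ> \<sigma>))"
    by (rule setum_permutations_compose_left[OF \<tau>])
  also have "\<dots> = (\<Sum>\<sigma> | \<sigma> permutes S. - (of_int (sign \<sigma>) * Q \<sigma>))"
  proof (rule sum.cong[OF refl])
    fix \<sigma> assume "\<sigma> \<in> {\<sigma>. \<sigma> permutes S}"
    then have \<sigma>: "\<sigma> permutes S" by simp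
    have "sign (Transposition.transpose p q \<circ> \<sigma>) = - sign \<sigma>"
      using permutation_permutes assms(1) \<sigma> \<tau>
      by (subst sign_compose) (auto simp: sign_swap_id assms(4))
    then show "of_int (sign (Transposition.transpose p q \<circ> \<sigma>)) * Q (Transposition.transpose p q \<circ> \<sigma>) = - (of_int (sign \<sigma>) * Q \<sigma>)"
      using assms(5)[OF \<sigma>] by simp
  qed
  finally show ?thesis by (simp add: sum_negf)
qed

text \<open>Only values on members of the family enter, so the two families may have different
  types. This moves a computation from tangent vectors to the model space, or to the bare
  indices.\<close>

lemma wedge_power_cong:
  assumes "\<And>i. i \<le> 2 * n \<Longrightarrow> a (v i) = a' (v' i)"
    "\<And>i j. i \<le> 2 * n \<Longrightarrow> j \<le> 2 * n \<Longrightarrow> \<omega> (v i) (v j) = \<omega>' (v' i) (v' j)"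
  shows "wedge_power n a \<omega> v = wedge_power n a' \<omega>' v'"
  unfolding wedge_power_def
proof (intro arg_cong2[of _ _ _ _ "(/)"] sum.cong refl arg_cong2[of _ _ _ _ "(*)"] prod.cong)
  fix \<sigma> assume "\<sigma> \<in> {\<sigma>. \<sigma> permutes {..2 * n}}"
  then have \<sigma>: "\<sigma> k \<le> 2 * n" if "k \<le> 2 * n" for k
    using permutes_in_image[of \<sigma> "{..2 * n}" k] that by simp
  show "a (v (\<sigma> 0)) = a' (v' (\<sigma> 0))"
    using assms(1) \<sigma> by simp
  show "\<omega> (v (\<sigma> (2 * i + 1))) (v (\<sigma> (2 * i + 2))) = \<omega>' (v' (\<sigma> (2 * i + 1))) (v' (\<sigma> (2 * i + 2)))"
    if "i \<in> {..<n}" for i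
    using that by (intro assms(2) \<sigma>) auto
qed

lemma wedge_power_scale:
  "wedge_power n (\<lambda>u. c * a u) (\<lambda>u w. c * \<omega> u w) v = c ^ Suc n * wedge_power n a \<omega> v"
  unfolding wedge_power_def
  by (simp add: prod.distrib sum_distrib_left mult.assoc mult.left_commute)

text \<open>\<open>a \<and> (\<omega> + \<theta> \<and> a)\<^sup>n = a \<and> \<omega>\<^sup>n\<close>. The factors are exchanged one at a time; each term of the
  difference contains \<open>a\<close> twice.\<close>

lemma wedge_power_add_wedge:
  assumes "\<And>i j. i \<le> 2 * n \<Longrightarrow> j \<le> 2 * n \<Longrightarrow>
    \<omega>' (v i) (v j) = \<omega> (v i) (v j) + \<theta> i * a (v j) - a (v i) * \<theta> j"
  shows "wedge_power n a \<omega>' v = wedge_power n a \<omega> v"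
proof -
  \<comment> \<open>Interpolates between the two products: the first \<open>k\<close> factors are
    already \<open>\<omega>'\<close>, the others still \<open>\<omega>\<close>.\<close>
  define F where "F k i \<sigma> = (if i < k then \<omega>' else \<omega>) (v (\<sigma> (2 * i + 1))) (v (\<sigma> (2 * i + 2)))"
    for k i :: nat and \<sigma> :: "nat \<Rightarrow> nat"
  define W where "W k = (\<Sum>\<sigma> | \<sigma> permutes {..2 * n}. of_int (sign \<sigma>) * (a (v (\<sigma> 0)) * (\<Prod>i<n. F k i \<sigma>)))"
    for k
  have step: "W (Suc k) = W k" if "k < n" for k
  proof -
    let ?p = "2 * k + 1" and ?q = "2 * k + 2"
    define R where "R \<sigma> = (\<Prod>i\<in>{..<n} - {k}. F k i \<sigma>)" for \<sigma>
    \<comment> \<open>The excess terms from factor \<open>k\<close>. Besides slot 0, the form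
      \<open>a\<close> occupies slot \<open>?q\<close> in \<open>Q1\<close> and slot
      \<open>?p\<close> in \<open>Q2\<close>, so exchanging that slot with slot 0 leaves the term
      unchanged; \<open>R\<close> involves none of the three slots.\<close>
    define Q1 where "Q1 \<sigma> = a (v (\<sigma> 0)) * a (v (\<sigma> ?q)) * \<theta> (\<sigma> ?p) * R \<sigma>" for \<sigma>
    define Q2 where "Q2 \<sigma> = a (v (\<sigma> 0)) * a (v (\<sigma> ?p)) * \<theta> (\<sigma> ?q) * R \<sigma>" for \<sigma>
    have R: "R (\<sigma> \<circ> Transposition.transpose 0 r) = R \<sigma>" if r: "r = ?p \<or> r = ?q" for \<sigma> r
      unfolding R_def F_def
    proof (rule prod.cong[OF refl])
      fix i assume i: "i \<in> {..<n} - {k}"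
      then have "i \<noteq> k" by simp
      then have "2 * i + 1 \<noteq> r \<and> 2 * i + 2 \<noteq> r"
        using r by presburger
      then show "(if i < k then \<omega>' else \<omega>) (v ((\<sigma> \<circ> Transposition.transpose 0 r) (2 * i + 1)))
          (v ((\<sigma> \<circ> Transposition.transpose 0 r) (2 * i + 2))) =
        (if i < k then \<omega>' else \<omega>) (v (\<sigma> (2 * i + 1))) (v (\<sigma> (2 * i + 2)))"
        by (simp add: Transposition.transpose_def)
    qed
    have "W (Suc k) - W k = (\<Sum>\<sigma> | \<sigma> permutes {..2 * n}. of_int (sign \<sigma>) * (Q1 \<sigma> - Q2 \<sigma>))"
      unfolding W_def sum_subtractf[symmetric]
    proof (rule sum.cong[OF refl])
      fix \<sigma> assume "\<sigma> \<in> {\<sigma>. \<sigma> permutes {..2 * n}}"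
      then have \<sigma>: "\<sigma> i \<le> 2 * n" if "i \<le> 2 * n" for i
        using permutes_in_image[of \<sigma> "{..2 * n}" i] that by simp
      have 1: "(\<Prod>i<n. F k i \<sigma>) = \<omega> (v (\<sigma> ?p)) (v (\<sigma> ?q)) * R \<sigma>"
        unfolding R_def using that by (subst prod.remove[of _ k]) (auto simp: F_def)
      have "(\<Prod>i\<in>{..<n} - {k}. F (Suc k) i \<sigma>) = R \<sigma>"
        unfolding R_def by (rule prod.cong) (auto simp: F_def less_Suc_eq)
      then have 2: "(\<Prod>i<n. F (Suc k) i \<sigma>) = \<omega>' (v (\<sigma> ?p)) (v (\<sigma> ?q)) * R \<sigma>"
        using that by (subst prod.remove[of _ k]) (auto simp: F_def)
      have 3: "\<omega>' (v (\<sigma> ?p)) (v (\<sigma> ?q)) =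
          \<omega> (v (\<sigma> ?p)) (v (\<sigma> ?q)) + \<theta> (\<sigma> ?p) * a (v (\<sigma> ?q)) - a (v (\<sigma> ?p)) * \<theta> (\<sigma> ?q)"
        using that by (intro assms \<sigma>) auto
      show "of_int (sign \<sigma>) * (a (v (\<sigma> 0)) * (\<Prod>i<n. F (Suc k) i \<sigma>)) -
          of_int (sign \<sigma>) * (a (v (\<sigma> 0)) * (\<Prod>i<n. F k i \<sigma>)) = of_int (sign \<sigma>) * (Q1 \<sigma> - Q2 \<sigma>)"
        unfolding 1 2 3 Q1_def Q2_def by (simp add: algebra_simps)
    qed
    also have "\<dots> = (\<Sum>\<sigma> | \<sigma> permutes {..2 * n}. of_int (sign \<sigma>) * Q1 \<sigma>) -
        (\<Sum>\<sigma> | \<sigma> permutes {..2 * n}. of_int (sign \<sigma>) * Q2 \<sigma>)"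
      by (simp add: right_diff_distrib sum_subtractf)
    also have "(\<Sum>\<sigma> | \<sigma> permutes {..2 * n}. of_int (sign \<sigma>) * Q1 \<sigma>) = 0"
      by (rule sum_permutations_sign_right_eq_0[of _ 0 ?q])
        (use that R[of ?q] in \<open>auto simp: Q1_def Transposition.transpose_def\<close>)
    also have "(\<Sum>\<sigma> | \<sigma> permutes {..2 * n}. of_int (sign \<sigma>) * Q2 \<sigma>) = 0"
      by (rule sum_permutations_sign_right_eq_0[of _ 0 ?p])
        (use that R[of ?p] in \<open>auto simp: Q2_def Transposition.transpose_def\<close>)
    finally show ?thesis by simp
  qed
  have "k \<le> n \<Longrightarrow> W k = W 0" for k
    by (induction k) (auto simp: step)
  from this[of n] show ?thesis
    unfolding W_def wedge_power_def by (simp add: F_def mult.assoc)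
qed

text \<open>Locates vector \<open>j\<close> in the term of \<open>\<sigma>\<close>: it is the
  argument of \<open>a\<close>, or the first or the second argument of the \<open>k\<close>-th
  factor \<open>\<omega>\<close>.\<close>

lemma permutes_atMost_double_cases:
  assumes "\<sigma> permutes {..2 * n}" "j \<le> 2 * (n::nat)"
  obtains "\<sigma> 0 = j" | k where "k < n" "\<sigma> (2 * k + 1) = j" | k where "k < n" "\<sigma> (2 * k + 2) = j"
proof -
  obtain p where p: "\<sigma> p = j" "p \<le> 2 * n"
    using permutes_surj[OF assms(1)] permutes_in_image[OF assms(1)] assms(2)
    by (metis atMost_iff surjD)
  consider "p = 0" | k where "p = 2 * k + 1" | k where "p = 2 * k + 2"
    by (metis One_nat_def Suc_1 add.right_neutral add_Suc_right evenE mult_Suc_right not0_implies_Suc oddE plus_1_eq_Suc)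
  then show ?thesis
  proof cases
    case 1
    then show ?thesis using p that(1) by simp
  next
    case (2 k)
    then show ?thesis using p that(2)[of k] by simp
  next
    case (3 k)
    then show ?thesis using p that(3)[of k] by simp
  qed
qed

text \<open>Vector \<open>j\<close> occurs in every term, and whichever factor receives it
  vanishes.\<close>

lemma wedge_power_eq_0_if_contraction_0:
  assumes "j \<le> 2 * n" "a (v j) = 0"
    "\<And>i. i \<le> 2 * n \<Longrightarrow> \<omega> (v j) (v i) = 0" "\<And>i. i \<le> 2 * n \<Longrightarrow> \<omega> (v i) (v j) = 0"
  shows "wedge_power n a \<omega> v = 0"
proof -
  have "a (v (\<sigma> 0)) * (\<Prod>i<n. \<omega> (v (\<sigma> (2 * i + 1))) (v (\<sigma> (2 * i + 2)))) = 0"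
    if \<sigma>: "\<sigma> permutes {..2 * n}" for \<sigma>
  proof -
    have le: "\<sigma> i \<le> 2 * n" if "i \<le> 2 * n" for i
      using permutes_in_image[OF \<sigma>, of i] that by simp
    from \<sigma> assms(1) show ?thesis
    proof (cases rule: permutes_atMost_double_cases)
      case 1
      then show ?thesis using assms(2) by simp
    next
      case (2 k)
      then have "\<omega> (v (\<sigma> (2 * k + 1))) (v (\<sigma> (2 * k + 2))) = 0"
        using assms(3) le by simp
      then show ?thesis using 2(1) by (auto intro!: prod_zero)
    next
      case (3 k)
      then have "\<omega> (v (\<sigma> (2 * k + 1))) (v (\<sigma> (2 * k + 2))) = 0"
        using assms(4) le by simp
      then show ?thesis using 3(1) by (auto intro!: prod_zero)
    qed
  qed
  then have "(\<Sum>\<sigma> | \<sigma> permutes {..2 * n}. of_int (sign \<sigma>) * a (v (\<sigma> 0)) *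
      (\<Prod>i<n. \<omega> (v (\<sigma> (2 * i + 1))) (v (\<sigma> (2 * i + 2))))) = 0"
    unfolding mult.assoc by (intro sum.neutral) force
  then show ?thesis
    unfolding wedge_power_def by simp
qed

lemma wedge_power_repeated:
  assumes "i \<le> 2 * n" "j \<le> 2 * n" "i \<noteq> j" "v i = v j"
  shows "wedge_power n a \<omega> v = 0"
proof -
  have "v (Transposition.transpose i j k) = v k" for k
    using assms(4) by (auto simp: Transposition.transpose_def)
  then show ?thesis
    unfolding wedge_power_def mult.assoc
    by (subst sum_permutations_sign_left_eq_0[of _ i j]) (use assms in auto)
qed

text \<open>A permutation puts vector \<open>j\<close> in exactly one slot, so each term is a
  constant times a single factor that is linear in \<open>u\<close>.\<close>

lemma linear_wedge_power_slot:
  fixes a :: "'v::real_vector \<Rightarrow> real"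
  assumes "linear a" "\<And>u. linear (\<omega> u)" "\<And>w. linear (\<lambda>u. \<omega> u w)" "j \<le> 2 * n"
  shows "linear (\<lambda>u. wedge_power n a \<omega> (v(j := u)))"
proof -
  have "linear (\<lambda>u. a ((v(j := u)) (\<sigma> 0)) *
      (\<Prod>i<n. \<omega> ((v(j := u)) (\<sigma> (2 * i + 1))) ((v(j := u)) (\<sigma> (2 * i + 2)))))" (is "linear (\<lambda>u. ?T u)")
    if \<sigma>: "\<sigma> permutes {..2 * n}" for \<sigma>
  proof -
    have inj: "\<sigma> p = j \<Longrightarrow> \<sigma> q = j \<longleftrightarrow> q = p" for p q
      using injD[OF permutes_inj[OF \<sigma>]] by blast
    have mult: "linear (\<lambda>u. c * g u)" if "linear g" for g :: "'v \<Rightarrow> real" and c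
      using linear_compose_scale_right[OF that, of c] by simp
    let ?v = "\<lambda>i. v (\<sigma> i)"
    from \<sigma> assms(4) show ?thesis
    proof (cases rule: permutes_atMost_double_cases)
      case 1
      have "?T = (\<lambda>u. (\<Prod>i<n. \<omega> (?v (2 * i + 1)) (?v (2 * i + 2))) * a u)"
        using inj[OF 1] 1 by (auto simp: fun_eq_iff)
      then show ?thesis using mult[OF assms(1)] by simp
    next
      case (2 k)
      define C where "C = a (?v 0) * (\<Prod>i\<in>{..<n} - {k}. \<omega> (?v (2 * i + 1)) (?v (2 * i + 2)))"
      have P: "(\<Prod>i\<in>{..<n} - {k}. \<omega> ((v(j := u)) (\<sigma> (2 * i + 1))) ((v(j := u)) (\<sigma> (2 * i + 2)))) =
          (\<Prod>i\<in>{..<n} - {k}. \<omega> (?v (2 * i + 1)) (?v (2 * i + 2)))" for u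
      proof (rule prod.cong[OF refl])
        fix i assume i: "i \<in> {..<n} - {k}"
        then have "i \<noteq> k" by simp
        then have "2 * i + 1 \<noteq> 2 * k + 1 \<and> 2 * i + 2 \<noteq> 2 * k + 1"
          by presburger
        then show "\<omega> ((v(j := u)) (\<sigma> (2 * i + 1))) ((v(j := u)) (\<sigma> (2 * i + 2))) =
            \<omega> (?v (2 * i + 1)) (?v (2 * i + 2))"
          using inj[OF 2(2)] by simp
      qed
      have "?T u = C * \<omega> u (?v (2 * k + 2))" for u
        using 2 inj[OF 2(2), of 0] inj[OF 2(2), of "2 * k + 2"]
        by (subst prod.remove[of _ k]) (simp_all add: P[simplified] C_def)
      then show ?thesis using mult[OF assms(3)] by simp
    next
      case (3 k)
      define C where "C = a (?v 0) * (\<Prod>i\<in>{..<n} - {k}. \<omega> (?v (2 * i + 1)) (?v (2 * i + 2)))"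
      have P: "(\<Prod>i\<in>{..<n} - {k}. \<omega> ((v(j := u)) (\<sigma> (2 * i + 1))) ((v(j := u)) (\<sigma> (2 * i + 2)))) =
          (\<Prod>i\<in>{..<n} - {k}. \<omega> (?v (2 * i + 1)) (?v (2 * i + 2)))" for u
      proof (rule prod.cong[OF refl])
        fix i assume i: "i \<in> {..<n} - {k}"
        then have "i \<noteq> k" by simp
        then have "2 * i + 1 \<noteq> 2 * k + 2 \<and> 2 * i + 2 \<noteq> 2 * k + 2"
          by presburger
        then show "\<omega> ((v(j := u)) (\<sigma> (2 * i + 1))) ((v(j := u)) (\<sigma> (2 * i + 2))) =
            \<omega> (?v (2 * i + 1)) (?v (2 * i + 2))"
          using inj[OF 3(2)] by simp
      qed
      have "?T u = C * \<omega> (?v (2 * k + 1)) u" for u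
        using 3 inj[OF 3(2), of 0] inj[OF 3(2), of "2 * k + 1"]
        by (subst prod.remove[of _ k]) (simp_all add: P[simplified] C_def)
      then show ?thesis using mult[OF assms(2)] by simp
    qed
  qed
  note T = this
  have "linear (\<lambda>u. inverse (2 ^ n) *\<^sub>R (\<Sum>\<sigma> | \<sigma> permutes {..2 * n}. of_int (sign \<sigma>) *\<^sub>R (a ((v(j := u)) (\<sigma> 0)) *
      (\<Prod>i<n. \<omega> ((v(j := u)) (\<sigma> (2 * i + 1))) ((v(j := u)) (\<sigma> (2 * i + 2)))))))"
    by (rule linear_compose_scale_right, rule linear_compose_sum, rule ballI,
      rule linear_compose_scale_right) (use T in blast)
  then show ?thesis
    unfolding wedge_power_def by (simp add: mult.assoc field_simps)
qed

text \<open>A set forgets repetitions, so a family with two equal members is treated apart, with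
  coefficients 1 and -1.\<close>

lemma dependent_family:
  fixes w :: "nat \<Rightarrow> 'a::euclidean_space"
  assumes "DIM('a) < m"
  shows "\<exists>c. (\<exists>i<m. c i \<noteq> 0) \<and> (\<Sum>i<m. c i *\<^sub>R w i) = 0"
proof (cases "inj_on w {..<m}")
  case False
  then obtain i j where ij: "i < m" "j < m" "i \<noteq> j" "w i = w j"
    by (auto simp: inj_on_def)
  let ?c = "\<lambda>k. if k = i then 1 else if k = j then -1 else (0::real)"
  have "(\<Sum>k<m. ?c k *\<^sub>R w k) = (\<Sum>k\<in>{i, j}. ?c k *\<^sub>R w k)"
    using ij by (intro sum.mono_neutral_right) auto
  also have "\<dots> = 0" using ij by simp
  finally show ?thesis using ij by (intro exI[of _ ?c]) auto
next
  case True
  then have "card (w ` {..<m}) = m" by (simp add: card_image)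
  then have "dependent (w ` {..<m})"
    using dependent_biggerset[of "w ` {..<m}"] assms by simp
  then obtain u where u: "\<exists>v\<in>w ` {..<m}. u v \<noteq> 0" "(\<Sum>v\<in>w ` {..<m}. u v *\<^sub>R v) = 0"
    using dependent_finite[of "w ` {..<m}"] by auto
  then show ?thesis
    using sum.reindex[OF True, of "\<lambda>v. u v *\<^sub>R v"] by (intro exI[of _ "u \<circ> w"]) auto
qed

text \<open>The form vanishes as soon as \<open>z\<close> stands in some slot. The 2 n + 2 vectors
  \<open>z\<close>, \<open>v 0\<close>, ..., \<open>v (2 n)\<close> are dependent, and since
  \<open>z\<close> is not 0 some \<open>v j\<close> has a nonzero coefficient. With the relation in
  slot \<open>j\<close>, the term of \<open>z\<close> is zero and, by alternation, so are all others
  except that of \<open>v j\<close>.\<close>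

lemma wedge_power_degenerate:
  fixes a :: "'v::euclidean_space \<Rightarrow> real"
  assumes "DIM('v) = 2 * n + 1" "linear a" "\<And>u. linear (\<omega> u)" "\<And>w. linear (\<lambda>u. \<omega> u w)"
    and anti: "\<And>u w. \<omega> u w = - \<omega> w u"
    and z: "z \<noteq> 0" "a z = 0" "\<And>u. \<omega> z u = c * a u"
  shows "wedge_power n a \<omega> v = 0"
proof -
  have z0: "wedge_power n a \<omega> (v(j := z)) = 0" if j: "j \<le> 2 * n" for j
  proof -
    \<comment> \<open>Adding \<theta> \<and> a with value -c of \<theta> at index \<open>j\<close>
      cancels \<omega>(z, .) = c a and leaves the wedge power unchanged. Here \<theta> is a function
      of the indices and not a linear form, so it may be 0 at all other indices whatever relations
      hold among the vectors.\<close>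
    let ?v = "v(j := z)" and ?\<theta> = "\<lambda>i. if i = j then - c else 0"
    let ?\<omega> = "\<lambda>i k. \<omega> (?v i) (?v k) + ?\<theta> i * a (?v k) - a (?v i) * ?\<theta> k"
    have "wedge_power n a \<omega> ?v = wedge_power n (\<lambda>i. a (?v i)) (\<lambda>i k. \<omega> (?v i) (?v k)) id"
      by (rule wedge_power_cong) auto
    also have "\<dots> = wedge_power n (\<lambda>i. a (?v i)) ?\<omega> id"
      by (rule wedge_power_add_wedge[symmetric]) auto
    also have "\<dots> = 0"
    proof (rule wedge_power_eq_0_if_contraction_0[OF j])
      show "a (?v (id j)) = 0" using z by simp
      show "?\<omega> (id j) (id i) = 0" for i using z by simp
      show "?\<omega> (id i) (id j) = 0" for i
        using z anti[of _ z] by simp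
    qed
    finally show ?thesis .
  qed
  let ?m = "2 * n + 2"
  let ?w = "\<lambda>i. if i = 2 * n + 1 then z else v i"
  obtain b where b: "\<exists>i<?m. b i \<noteq> 0" "(\<Sum>i<?m. b i *\<^sub>R ?w i) = 0"
    using dependent_family[of ?m ?w] assms(1) by auto
  have sum: "(\<Sum>i\<le>2 * n. b i *\<^sub>R v i) + b (2 * n + 1) *\<^sub>R z = 0"
  proof -
    have "{..<?m} = insert (2 * n + 1) {..2 * n}" by auto
    then have "(\<Sum>i<?m. b i *\<^sub>R ?w i) = b (2 * n + 1) *\<^sub>R z + (\<Sum>i\<le>2 * n. b i *\<^sub>R ?w i)"
      by (simp only: sum.insert finite_atMost atMost_iff simp_thms) simp
    with b(2) have "b (2 * n + 1) *\<^sub>R z + (\<Sum>i\<le>2 * n. b i *\<^sub>R ?w i) = 0" by simp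
    moreover have "(\<Sum>i\<le>2 * n. b i *\<^sub>R ?w i) = (\<Sum>i\<le>2 * n. b i *\<^sub>R v i)"
      by (rule sum.cong) auto
    ultimately show ?thesis by (simp add: add.commute)
  qed
  obtain j where j: "j \<le> 2 * n" "b j \<noteq> 0"
  proof (rule ccontr)
    assume "\<not> thesis"
    then have 0: "\<And>j. j \<le> 2 * n \<Longrightarrow> b j = 0" using that by blast
    then have "b (2 * n + 1) *\<^sub>R z = 0" using sum by simp
    then have "b (2 * n + 1) = 0" using z(1) by simp
    with 0 b(1) show False
      by (metis Suc_eq_plus1 Suc_leI add_2_eq_Suc' leD le_SucE linorder_not_le not_less_eq)
  qed
  interpret W: linear "\<lambda>u. wedge_power n a \<omega> (v(j := u))"
    by (rule linear_wedge_power_slot[OF assms(2-4) j(1)])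
  have "0 = wedge_power n a \<omega> (v(j := (\<Sum>i\<le>2 * n. b i *\<^sub>R v i) + b (2 * n + 1) *\<^sub>R z))"
    unfolding sum using W.zero by simp
  also have "\<dots> = (\<Sum>i\<le>2 * n. b i * wedge_power n a \<omega> (v(j := v i)))"
    by (simp only: W.add W.sum W.scale) (simp add: z0[OF j(1)])
  also have "\<dots> = (\<Sum>i\<in>{j}. b i * wedge_power n a \<omega> (v(j := v i)))"
    using j(1) wedge_power_repeated[of _ n j "v(j := v _)"]
    by (intro sum.mono_neutral_right) auto
  finally show ?thesis using j(2) by simp
qed

section \<open>Functions on manifolds\<close>

locale smooth_mfd =
  fixes A :: "('m::{t2_space, second_countable_topology}, 'e::euclidean_space) chart set" and d :: nat
  assumes smooth_manifold: "smooth_manifold d A"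
begin

lemma dim_model: "DIM('e) = d"
proof -
  obtain B :: "'e set" where "finite B" "independent B" "span B = UNIV" "card B = d"
    using smooth_manifold unfolding smooth_manifold_def by (elim conjE exE) (rule that)
  then have "dim (UNIV :: 'e set) = d"
    by (subst dim_eq_card[of B UNIV]) simp_all
  then show ?thesis by simp
qed

lemma chart_exists: obtains U \<phi> where "(U, \<phi>) \<in> A" "x \<in> U"
proof -
  have "x \<in> (\<Union>(U, \<phi>)\<in>A. U)"
    using smooth_manifold unfolding smooth_manifold_def by simp
  then show thesis using that by blast
qed

lemma
  assumes "(U, \<phi>) \<in> A"
  shows chart_open: "open U" and chart_image_open: "open (\<phi> ` U)"
    and chart_homeomorphism: "homeomorphism U (\<phi> ` U) \<phi> (inv_into U \<phi>)"
  using smooth_manifold assms unfolding smooth_manifold_def by blast+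

lemma chart_transition:
  "(U, \<phi>) \<in> A \<Longrightarrow> (V, \<psi>) \<in> A \<Longrightarrow> smooth_on (\<phi> ` (U \<inter> V)) (\<psi> \<circ> inv_into U \<phi>)"
  using smooth_manifold unfolding smooth_manifold_def by blast

lemma chart_inv: "(U, \<phi>) \<in> A \<Longrightarrow> x \<in> U \<Longrightarrow> inv_into U \<phi> (\<phi> x) = x"
  using chart_homeomorphism homeomorphism_apply1 by blast

lemma chart_image_open_subset:
  assumes "(U, \<phi>) \<in> A" "open S"
  shows "open (\<phi> ` (U \<inter> S))"
proof -
  have "openin (top_of_set U) (U \<inter> S)"
    using assms(2) by (auto simp: openin_open)
  then have "openin (top_of_set (\<phi> ` U)) (\<phi> ` (U \<inter> S))"
    using homeomorphism_imp_open_map[OF chart_homeomorphism[OF assms(1)]] by blast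
  then show ?thesis
    using chart_image_open[OF assms(1)] openin_open_trans by blast
qed

lemma smooth_fun_chart:
  assumes "smooth_fun A S f" "(U, \<phi>) \<in> A"
  shows "smooth_on (\<phi> ` (U \<inter> S)) (f \<circ> inv_into U \<phi>)"
  using assms unfolding smooth_map_on_def real_atlas_def by fastforce

text \<open>One chart suffices, because every other coordinate expression is this one composed with
  a transition map.\<close>

lemma smooth_funI_chart:
  assumes "(U, \<phi>) \<in> A" "open S" "S \<subseteq> U" "smooth_on (\<phi> ` S) (f \<circ> inv_into U \<phi>)"
  shows "smooth_fun A S f"
proof -
  have f: "f x = (f \<circ> inv_into U \<phi>) (\<phi> x)" if "x \<in> U" for x
    using chart_inv[OF assms(1) that] by simp
  have "continuous_on S \<phi>"
    using chart_homeomorphism[OF assms(1)] assms(3) continuous_on_subset homeomorphism_cont1 by blast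
  then have "continuous_on S (\<lambda>x. (f \<circ> inv_into U \<phi>) (\<phi> x))"
    by (rule continuous_on_compose2[OF smooth_on_imp_continuous_on[OF assms(4)]]) simp
  then have cont: "continuous_on S f"
    by (rule continuous_on_eq) (use f assms(3) in force)
  have "smooth_on (\<psi> ` (V \<inter> S)) (f \<circ> inv_into V \<psi>)" if V: "(V, \<psi>) \<in> A" for V \<psi>
  proof -
    have op: "open (\<psi> ` (V \<inter> S))"
      by (rule chart_image_open_subset[OF V assms(2)])
    have "smooth_on (\<psi> ` (V \<inter> S)) (\<phi> \<circ> inv_into V \<psi>)"
      by (rule smooth_on_subset[OF chart_transition[OF V assms(1)]]) (use assms(3) in auto)
    then have "smooth_on (\<psi> ` (V \<inter> S)) (\<lambda>p. (f \<circ> inv_into U \<phi>) ((\<phi> \<circ> inv_into V \<psi>) p))"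
      by (rule smooth_on_compose[OF op _ assms(4)]) (use chart_inv[OF V] in auto)
    then show ?thesis
      by (rule iffD1[OF smooth_on_cong[OF op], rotated])
        (use chart_inv[OF V] chart_inv[OF assms(1)] assms(3) in auto)
  qed
  with cont show ?thesis
    unfolding smooth_map_on_def real_atlas_def by (auto simp: case_prod_unfold o_def)
qed

lemma smooth_near_chart_iff:
  assumes "(U, \<phi>) \<in> A" "x \<in> U"
  shows "smooth_near A x f \<longleftrightarrow> (\<exists>W. open W \<and> x \<in> W \<and> W \<subseteq> U \<and> smooth_on (\<phi> ` W) (f \<circ> inv_into U \<phi>))"
proof
  assume "smooth_near A x f"
  then obtain V where "open V" "x \<in> V" "smooth_fun A V f"
    unfolding smooth_near_def by blast
  then show "\<exists>W. open W \<and> x \<in> W \<and> W \<subseteq> U \<and> smooth_on (\<phi> ` W) (f \<circ> inv_into U \<phi>)"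
    using assms chart_open[OF assms(1)] smooth_fun_chart[OF _ assms(1)]
    by (intro exI[of _ "U \<inter> V"]) auto
next
  assume "\<exists>W. open W \<and> x \<in> W \<and> W \<subseteq> U \<and> smooth_on (\<phi> ` W) (f \<circ> inv_into U \<phi>)"
  then show "smooth_near A x f"
    using smooth_funI_chart[OF assms(1)] unfolding smooth_near_def by blast
qed

lemma smooth_near_eventually:
  assumes "smooth_near A x f"
  shows "\<exists>V. open V \<and> x \<in> V \<and> smooth_fun A V f \<and> (\<forall>y\<in>V. smooth_near A y f)"
  using assms unfolding smooth_near_def by blast

text \<open>Reduces smoothness on an open set to a property at single points, the form in which the
  later closure rules are stated.\<close>

lemma smooth_fun_iff_near:
  assumes "open S"
  shows "smooth_fun A S f \<longleftrightarrow> (\<forall>x\<in>S. smooth_near A x f)"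
proof
  assume "smooth_fun A S f"
  then show "\<forall>x\<in>S. smooth_near A x f"
    using assms unfolding smooth_near_def by blast
next
  assume near: "\<forall>x\<in>S. smooth_near A x f"
  have "isCont f x" if x: "x \<in> S" for x
  proof -
    obtain V where "open V" "x \<in> V" "smooth_fun A V f"
      using smooth_near_eventually[OF bspec[OF near x]] by blast
    then show ?thesis
      unfolding smooth_map_on_def using continuous_on_eq_continuous_at by blast
  qed
  then have "continuous_on S f"
    by (simp add: continuous_at_imp_continuous_on)
  moreover have "smooth_on (\<phi> ` (U \<inter> S)) (f \<circ> inv_into U \<phi>)" if U: "(U, \<phi>) \<in> A" for U \<phi>
  proof (rule smooth_on_local)
    fix p assume "p \<in> \<phi> ` (U \<inter> S)"
    then obtain x where x: "x \<in> U" "x \<in> S" "p = \<phi> x" by blast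
    obtain V where "open V" "x \<in> V" "smooth_fun A V f"
      using smooth_near_eventually[OF bspec[OF near x(2)]] by blast
    then show "\<exists>T. open T \<and> p \<in> T \<and> smooth_on T (f \<circ> inv_into U \<phi>)"
      using smooth_fun_chart[OF _ U] chart_image_open_subset[OF U] x by blast
  qed
  ultimately show "smooth_fun A S f"
    unfolding smooth_map_on_def real_atlas_def by (auto simp: case_prod_unfold o_def)
qed

lemma smooth_near_cong:
  assumes "smooth_near A x f" "open V" "x \<in> V" "\<And>y. y \<in> V \<Longrightarrow> f y = g y"
  shows "smooth_near A x g"
proof -
  obtain U \<phi> where U: "(U, \<phi>) \<in> A" "x \<in> U" by (rule chart_exists)
  obtain W where W: "open W" "x \<in> W" "W \<subseteq> U" "smooth_on (\<phi> ` W) (f \<circ> inv_into U \<phi>)"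
    using assms(1) smooth_near_chart_iff[OF U] by blast
  have "smooth_on (\<phi> ` (W \<inter> V)) (f \<circ> inv_into U \<phi>)"
    by (rule smooth_on_subset[OF W(4)]) auto
  moreover have "open (\<phi> ` (W \<inter> V))"
    using chart_image_open_subset[OF U(1), of "W \<inter> V"] W assms(2) by (simp add: Int_absorb1 le_infI1 open_Int)
  moreover have "(f \<circ> inv_into U \<phi>) p = (g \<circ> inv_into U \<phi>) p" if "p \<in> \<phi> ` (W \<inter> V)" for p
    using that W(3) chart_inv[OF U(1)] assms(4) by auto
  ultimately have "smooth_on (\<phi> ` (W \<inter> V)) (g \<circ> inv_into U \<phi>)"
    using smooth_on_cong by blast
  then show ?thesis
    unfolding smooth_near_chart_iff[OF U] using W assms by (intro exI[of _ "W \<inter> V"]) auto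
qed

section \<open>Closure rules for functions smooth near a point\<close>

lemma smooth_near_binop:
  assumes "\<And>(W :: 'e set) f g. open W \<Longrightarrow> smooth_on W f \<Longrightarrow> smooth_on W g \<Longrightarrow> smooth_on W (\<lambda>p. h (f p) (g p :: real) :: real)"
    and "smooth_near A x f" "smooth_near A x g"
  shows "smooth_near A x (\<lambda>y. h (f y) (g y))"
proof -
  obtain U \<phi> where U: "(U, \<phi>) \<in> A" "x \<in> U" by (rule chart_exists)
  obtain W1 where W1: "open W1" "x \<in> W1" "W1 \<subseteq> U" "smooth_on (\<phi> ` W1) (f \<circ> inv_into U \<phi>)"
    using assms(2) smooth_near_chart_iff[OF U] by blast
  obtain W2 where W2: "open W2" "x \<in> W2" "W2 \<subseteq> U" "smooth_on (\<phi> ` W2) (g \<circ> inv_into U \<phi>)"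
    using assms(3) smooth_near_chart_iff[OF U] by blast
  have "U \<inter> (W1 \<inter> W2) = W1 \<inter> W2" using W1 by blast
  then have "open (\<phi> ` (W1 \<inter> W2))"
    using chart_image_open_subset[OF U(1), of "W1 \<inter> W2"] W1 W2 by (simp add: open_Int)
  moreover have "smooth_on (\<phi> ` (W1 \<inter> W2)) (f \<circ> inv_into U \<phi>)"
    "smooth_on (\<phi> ` (W1 \<inter> W2)) (g \<circ> inv_into U \<phi>)"
    using smooth_on_subset[OF W1(4)] smooth_on_subset[OF W2(4)] by (meson Int_lower1 Int_lower2 image_mono)+
  ultimately have "smooth_on (\<phi> ` (W1 \<inter> W2)) (\<lambda>p. h ((f \<circ> inv_into U \<phi>) p) ((g \<circ> inv_into U \<phi>) p))"
    by (rule assms(1))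
  then have "smooth_on (\<phi> ` (W1 \<inter> W2)) ((\<lambda>y. h (f y) (g y)) \<circ> inv_into U \<phi>)"
    by (simp add: o_def)
  then show ?thesis
    unfolding smooth_near_chart_iff[OF U] using W1 W2 by (intro exI[of _ "W1 \<inter> W2"]) auto
qed

lemma smooth_near_const: "smooth_near A x (\<lambda>y. c)"
proof -
  obtain U \<phi> where U: "(U, \<phi>) \<in> A" "x \<in> U" by (rule chart_exists)
  then show ?thesis
    unfolding smooth_near_chart_iff[OF U] using chart_open[OF U(1)]
    by (intro exI[of _ U]) (simp add: o_def smooth_on_const)
qed

lemma smooth_near_add: "smooth_near A x f \<Longrightarrow> smooth_near A x g \<Longrightarrow> smooth_near A x (\<lambda>y. f y + g y)"
  by (rule smooth_near_binop[OF smooth_on_add])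

lemma smooth_near_mult: "smooth_near A x f \<Longrightarrow> smooth_near A x g \<Longrightarrow> smooth_near A x (\<lambda>y. f y * g y)"
  by (rule smooth_near_binop[OF smooth_on_mult])

lemma smooth_near_diff:
  assumes "smooth_near A x f" "smooth_near A x g"
  shows "smooth_near A x (\<lambda>y. f y - g y)"
  using smooth_near_add[OF assms(1) smooth_near_mult[OF smooth_near_const[of x "-1"] assms(2)]] by simp

lemma smooth_near_sum:
  "(\<And>i. i \<in> I \<Longrightarrow> smooth_near A x (f i)) \<Longrightarrow> smooth_near A x (\<lambda>y. \<Sum>i\<in>I. f i y)"
  by (induction I rule: infinite_finite_induct) (auto intro: smooth_near_const smooth_near_add)

lemma smooth_near_isCont: "smooth_near A x f \<Longrightarrow> isCont f x"
  unfolding smooth_near_def smooth_map_on_def using continuous_on_eq_continuous_at by blast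

lemma isCont_nonzero_nbhd:
  fixes f :: "'m \<Rightarrow> real"
  assumes "isCont f x" "f x \<noteq> 0"
  obtains V where "open V" "x \<in> V" "\<And>y. y \<in> V \<Longrightarrow> f y \<noteq> 0"
proof -
  have "\<forall>\<^sub>F y in nhds x. f y \<noteq> 0"
    using assms by (intro tendsto_imp_eventually_ne) (simp_all add: isCont_def tendsto_at_iff_tendsto_nhds)
  then show ?thesis
    using that unfolding eventually_nhds by blast
qed

lemma smooth_near_inverse:
  assumes "smooth_near A x f" "f x \<noteq> 0"
  shows "smooth_near A x (\<lambda>y. inverse (f y))"
proof -
  obtain V where V: "open V" "x \<in> V" "\<And>y. y \<in> V \<Longrightarrow> f y \<noteq> 0"
    using isCont_nonzero_nbhd[OF smooth_near_isCont[OF assms(1)] assms(2)] by blast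
  obtain U \<phi> where U: "(U, \<phi>) \<in> A" "x \<in> U" by (rule chart_exists)
  obtain W where W: "open W" "x \<in> W" "W \<subseteq> U" "smooth_on (\<phi> ` W) (f \<circ> inv_into U \<phi>)"
    using assms(1) smooth_near_chart_iff[OF U] by blast
  have "U \<inter> (W \<inter> V) = W \<inter> V" using W by blast
  then have op: "open (\<phi> ` (W \<inter> V))"
    using chart_image_open_subset[OF U(1), of "W \<inter> V"] W V by (simp add: open_Int)
  have "smooth_on (\<phi> ` (W \<inter> V)) (\<lambda>p. inverse ((f \<circ> inv_into U \<phi>) p))"
  proof (rule smooth_on_inverse[OF op])
    show "smooth_on (\<phi> ` (W \<inter> V)) (f \<circ> inv_into U \<phi>)"
      by (rule smooth_on_subset[OF W(4)]) auto
    show "(f \<circ> inv_into U \<phi>) p \<noteq> 0" if "p \<in> \<phi> ` (W \<inter> V)" for p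
      using that W(3) V(3) chart_inv[OF U(1)] by auto
  qed
  then have "smooth_on (\<phi> ` (W \<inter> V)) ((\<lambda>y. inverse (f y)) \<circ> inv_into U \<phi>)"
    by (simp add: o_def)
  then show ?thesis
    unfolding smooth_near_chart_iff[OF U] using W V by (intro exI[of _ "W \<inter> V"]) auto
qed

lemma smooth_near_coordinate:
  assumes "(U, \<phi>) \<in> A" "x \<in> U"
  shows "smooth_near A x (\<lambda>y. \<phi> y \<bullet> b)"
proof -
  have "smooth_on (\<phi> ` U) (\<lambda>p. p \<bullet> b)"
    by (rule smooth_on_bounded_linear[OF bounded_linear_inner_left])
      (use chart_image_open[OF assms(1)] smooth_on_id in auto)
  then have "smooth_on (\<phi> ` U) ((\<lambda>y. \<phi> y \<bullet> b) \<circ> inv_into U \<phi>)"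
    by (rule iffD1[OF smooth_on_cong[OF chart_image_open[OF assms(1)]], rotated])
      (use chart_inv[OF assms(1)] in auto)
  then show ?thesis
    unfolding smooth_near_chart_iff[OF assms] using chart_open[OF assms(1)] assms(2)
    by (intro exI[of _ U]) simp
qed

section \<open>Tangent vectors and vector fields\<close>

lemma tangent_not_smooth: "v \<in> tangent_space A x \<Longrightarrow> \<not> smooth_near A x f \<Longrightarrow> v f = 0"
  by (simp add: tangent_space_def)

lemma tangent_lincomb:
  "v \<in> tangent_space A x \<Longrightarrow> smooth_near A x f \<Longrightarrow> smooth_near A x g \<Longrightarrow>
    v (\<lambda>y. a * f y + b * g y) = a * v f + b * v g"
  by (simp add: tangent_space_def)

lemma tangent_mult:
  "v \<in> tangent_space A x \<Longrightarrow> smooth_near A x f \<Longrightarrow> smooth_near A x g \<Longrightarrow>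
    v (\<lambda>y. f y * g y) = f x * v g + g x * v f"
  by (simp add: tangent_space_def)

lemma tangent_add:
  "v \<in> tangent_space A x \<Longrightarrow> smooth_near A x f \<Longrightarrow> smooth_near A x g \<Longrightarrow>
    v (\<lambda>y. f y + g y) = v f + v g"
  using tangent_lincomb[of v x f g 1 1] by simp

lemma tangent_diff:
  "v \<in> tangent_space A x \<Longrightarrow> smooth_near A x f \<Longrightarrow> smooth_near A x g \<Longrightarrow>
    v (\<lambda>y. f y - g y) = v f - v g"
  using tangent_lincomb[of v x f g 1 "-1"] by simp

lemma tangent_const:
  assumes "v \<in> tangent_space A x"
  shows "v (\<lambda>y. c) = 0"
proof -
  have "v (\<lambda>y. 1) = 0"
    using tangent_mult[OF assms smooth_near_const smooth_near_const, of 1 1] by simp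
  then show ?thesis
    using tangent_lincomb[OF assms smooth_near_const smooth_near_const, of c 1 0 0] by simp
qed

lemma tangent_sum:
  assumes "v \<in> tangent_space A x" "\<And>i. i \<in> I \<Longrightarrow> smooth_near A x (f i)"
  shows "v (\<lambda>y. \<Sum>i\<in>I. f i y) = (\<Sum>i\<in>I. v (f i))"
  using assms(2)
proof (induction I rule: infinite_finite_induct)
  case (insert i I)
  then show ?case
    using tangent_add[OF assms(1), of "f i" "\<lambda>y. \<Sum>i\<in>I. f i y"] by (simp add: smooth_near_sum)
qed (simp_all add: tangent_const[OF assms(1)])

text \<open>Derivations are local: the indicator of \<open>V\<close> is smooth near \<open>x\<close> and idempotent, so \<open>v\<close> kills it.\<close>

lemma tangent_cong:
  assumes "v \<in> tangent_space A x" "open V" "x \<in> V" "\<And>y. y \<in> V \<Longrightarrow> f y = g y"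
  shows "v f = v g"
proof (cases "smooth_near A x f")
  case True
  then have g: "smooth_near A x g"
    using smooth_near_cong[OF True assms(2,3)] assms(4) by simp
  let ?i = "indicator V :: 'm \<Rightarrow> real"
  have i: "smooth_near A x ?i"
    by (rule smooth_near_cong[OF smooth_near_const assms(2,3)]) simp
  have "(\<lambda>y. ?i y * ?i y) = ?i"
    by (auto simp: indicator_def)
  then have "v ?i = 0"
    using tangent_mult[OF assms(1) i i] assms(3) by simp
  then have "v (\<lambda>y. h y * ?i y) = v h" if "smooth_near A x h" for h
    using tangent_mult[OF assms(1) that i] assms(3) by simp
  moreover have "(\<lambda>y. f y * ?i y) = (\<lambda>y. g y * ?i y)"
    using assms(4) by (auto simp: indicator_def)
  ultimately show ?thesis
    using True g by metis
next
  \<comment> \<open>Smoothness near \<open>x\<close> is local as well, so \<open>g\<close> is not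
    smooth there either and both values are the default 0.\<close>
  case False
  then have "\<not> smooth_near A x g"
    using smooth_near_cong[of x g V f] assms(2-4) by auto
  then show ?thesis
    using False tangent_not_smooth[OF assms(1)] by simp
qed

lemma tlincomb_in_tangent_space:
  assumes "u \<in> tangent_space A x" "v \<in> tangent_space A x"
  shows "tlincomb a u b v \<in> tangent_space A x"
  unfolding tangent_space_def tlincomb_def
  using tangent_not_smooth[OF assms(1)] tangent_not_smooth[OF assms(2)]
    tangent_lincomb[OF assms(1)] tangent_lincomb[OF assms(2)] tangent_mult[OF assms(1)] tangent_mult[OF assms(2)]
  by (simp add: algebra_simps)

lemma tzero_in_tangent_space: "tzero \<in> tangent_space A x"
  by (simp add: tangent_space_def tzero_def)

lemma tangent_eqI:
  assumes "u \<in> tangent_space A x" "v \<in> tangent_space A x" "\<And>f. smooth_near A x f \<Longrightarrow> u f = v f"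
  shows "u = v"
proof
  fix f
  show "u f = v f"
    using assms(3) tangent_not_smooth[OF assms(1)] tangent_not_smooth[OF assms(2)]
    by (cases "smooth_near A x f") auto
qed

text \<open>The tangent vector with components \<open>u\<close> in the chart. The value 0 on
  functions that are not smooth near \<open>x\<close> is the convention imposed by
  \<open>tangent_space\<close>. The components are recovered by \<open>coords\<close> from the
  coordinate functions.\<close>

definition cvec :: "'m set \<Rightarrow> ('m \<Rightarrow> 'e) \<Rightarrow> 'm \<Rightarrow> 'e \<Rightarrow> 'm tvec" where
  "cvec U \<phi> x u = (\<lambda>f. if smooth_near A x f then frechet_derivative (f \<circ> inv_into U \<phi>) (at (\<phi> x)) u else 0)"

definition coords :: "('m \<Rightarrow> 'e) \<Rightarrow> 'm tvec \<Rightarrow> 'e" where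
  "coords \<phi> v = (\<Sum>b\<in>Basis. v (\<lambda>y. \<phi> y \<bullet> b) *\<^sub>R b)"

lemma smooth_near_chart_derivative:
  assumes "(U, \<phi>) \<in> A" "x \<in> U" "smooth_near A x f"
  shows "((f \<circ> inv_into U \<phi>) has_derivative frechet_derivative (f \<circ> inv_into U \<phi>) (at (\<phi> x))) (at (\<phi> x))"
proof -
  obtain W where "x \<in> W" "smooth_on (\<phi> ` W) (f \<circ> inv_into U \<phi>)"
    using assms(3) smooth_near_chart_iff[OF assms(1,2)] by blast
  then show ?thesis
    using smooth_onD_derivative by blast
qed

lemma cvec_in_tangent_space:
  assumes "(U, \<phi>) \<in> A" "x \<in> U"
  shows "cvec U \<phi> x u \<in> tangent_space A x"
proof -
  let ?i = "inv_into U \<phi>"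
  note D = smooth_near_chart_derivative[OF assms]
  have "frechet_derivative ((\<lambda>y. a * f y + b * g y) \<circ> ?i) (at (\<phi> x)) u =
      a * frechet_derivative (f \<circ> ?i) (at (\<phi> x)) u + b * frechet_derivative (g \<circ> ?i) (at (\<phi> x)) u"
    if "smooth_near A x f" "smooth_near A x g" for f g a b
    using frechet_derivative_eqI[OF has_derivative_add[OF
        has_derivative_mult_right[OF D[OF that(1)]] has_derivative_mult_right[OF D[OF that(2)]]]]
    by (simp add: o_def)
  moreover have "frechet_derivative ((\<lambda>y. f y * g y) \<circ> ?i) (at (\<phi> x)) u =
      f x * frechet_derivative (g \<circ> ?i) (at (\<phi> x)) u + g x * frechet_derivative (f \<circ> ?i) (at (\<phi> x)) u"
    if "smooth_near A x f" "smooth_near A x g" for f g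
    using frechet_derivative_eqI[OF has_derivative_mult[OF D[OF that(1)] D[OF that(2)]]]
      chart_inv[OF assms]
    by (simp add: o_def mult.commute)
  moreover have "smooth_near A x (\<lambda>y. a * f y + b * g y)" "smooth_near A x (\<lambda>y. f y * g y)"
    if "smooth_near A x f" "smooth_near A x g" for f g a b
    using that by (simp_all add: smooth_near_add smooth_near_mult smooth_near_const)
  ultimately show ?thesis
    unfolding tangent_space_def cvec_def by simp
qed

lemma linear_cvec:
  assumes "(U, \<phi>) \<in> A" "x \<in> U"
  shows "linear (\<lambda>u. cvec U \<phi> x u f)"
proof (cases "smooth_near A x f")
  case True
  then show ?thesis
    using has_derivative_linear[OF smooth_near_chart_derivative[OF assms True]] by (simp add: cvec_def)
next
  case False
  then show ?thesis
    by (simp add: cvec_def linear_iff)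
qed

lemma cvec_coordinate:
  assumes "(U, \<phi>) \<in> A" "x \<in> U"
  shows "cvec U \<phi> x u (\<lambda>y. \<phi> y \<bullet> b) = u \<bullet> b"
proof -
  have "frechet_derivative ((\<lambda>y. \<phi> y \<bullet> b) \<circ> inv_into U \<phi>) (at (\<phi> x)) = frechet_derivative (\<lambda>p. p \<bullet> b) (at (\<phi> x))"
    by (rule frechet_derivative_cong_open[OF chart_image_open[OF assms(1)]])
      (use assms chart_inv[OF assms(1)] in auto)
  moreover have "frechet_derivative (\<lambda>p. p \<bullet> b) (at (\<phi> x)) u = u \<bullet> b"
    by (rule frechet_derivative_eqI[OF bounded_linear_imp_has_derivative[OF bounded_linear_inner_left]])
  ultimately show ?thesis
    using smooth_near_coordinate[OF assms] by (simp add: cvec_def)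
qed

text \<open>Hadamard's lemma writes f near \<open>x\<close> as f(x) plus a sum of products (\<phi>_b
  - \<phi>_b(x)) g_b. A derivation kills the constant and, as the first factor vanishes at
  \<open>x\<close>, sends each product to g_b(x) v(\<phi>_b), where g_b(x) is a partial derivative
  of f. So \<open>v\<close> is a directional derivative.\<close>

lemma cvec_coords:
  assumes "(U, \<phi>) \<in> A" "x \<in> U" "v \<in> tangent_space A x"
  shows "cvec U \<phi> x (coords \<phi> v) = v"
proof (rule tangent_eqI[OF cvec_in_tangent_space[OF assms(1,2)] assms(3)])
  fix f assume f: "smooth_near A x f"
  let ?i = "inv_into U \<phi>"
  obtain W where W: "open W" "x \<in> W" "W \<subseteq> U" "smooth_on (\<phi> ` W) (f \<circ> ?i)"
    using f smooth_near_chart_iff[OF assms(1,2)] by blast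
  have "U \<inter> W = W" using W(3) by blast
  then have "open (\<phi> ` W)"
    using chart_image_open_subset[OF assms(1) W(1)] by simp
  \<comment> \<open>A ball, because Hadamard's lemma needs a convex domain.\<close>
  then obtain r where r: "r > 0" "ball (\<phi> x) r \<subseteq> \<phi> ` W"
    using W(2) by (meson image_eqI openE)
  let ?B = "ball (\<phi> x) r"
  obtain g where g: "\<And>b. smooth_on ?B (g b)"
    "\<And>b. g b (\<phi> x) = frechet_derivative (f \<circ> ?i) (at (\<phi> x)) b"
    "\<And>p. p \<in> ?B \<Longrightarrow> (f \<circ> ?i) p = (f \<circ> ?i) (\<phi> x) + (\<Sum>b\<in>Basis. ((p - \<phi> x) \<bullet> b) * g b p)"
    by (rule hadamard_decomposition[OF open_ball convex_ball _ smooth_on_subset[OF W(4) r(2)], of "\<phi> x"])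
      (use r(1) in \<open>simp; fail\<close>, metis)
  define N where "N = U \<inter> \<phi> -` ?B"
  have "open N"
    unfolding N_def
    using continuous_open_preimage[OF homeomorphism_cont1[OF chart_homeomorphism[OF assms(1)]] chart_open[OF assms(1)]]
    by simp
  have "x \<in> N" using assms(2) r(1) by (simp add: N_def)
  have sm: "smooth_near A x (\<lambda>y. g b (\<phi> y))" for b
  proof -
    have im: "\<phi> ` N \<subseteq> ?B" by (auto simp: N_def)
    have op: "open (\<phi> ` N)"
      using chart_image_open_subset[OF assms(1) \<open>open N\<close>] by (simp add: N_def Int_absorb1 Int_assoc[symmetric])
    have "smooth_on (\<phi> ` N) ((\<lambda>y. g b (\<phi> y)) \<circ> ?i)"
      by (rule iffD1[OF smooth_on_cong[OF op] smooth_on_subset[OF g(1) im]])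
        (use chart_inv[OF assms(1)] in \<open>auto simp: N_def\<close>)
    then show ?thesis
      unfolding smooth_near_chart_iff[OF assms(1,2)]
      using \<open>open N\<close> \<open>x \<in> N\<close> by (intro exI[of _ N]) (auto simp: N_def)
  qed
  have sc: "smooth_near A x (\<lambda>y. \<phi> y \<bullet> b - \<phi> x \<bullet> b)" for b
    by (rule smooth_near_diff[OF smooth_near_coordinate[OF assms(1,2)] smooth_near_const])
  have "v f = v (\<lambda>y. f x + (\<Sum>b\<in>Basis. (\<phi> y \<bullet> b - \<phi> x \<bullet> b) * g b (\<phi> y)))"
  proof (rule tangent_cong[OF assms(3) \<open>open N\<close> \<open>x \<in> N\<close>])
    fix y assume "y \<in> N"
    then show "f y = f x + (\<Sum>b\<in>Basis. (\<phi> y \<bullet> b - \<phi> x \<bullet> b) * g b (\<phi> y))"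
      using g(3)[of "\<phi> y"] chart_inv[OF assms(1)] assms(2) by (auto simp: N_def inner_diff_left)
  qed
  also have "\<dots> = v (\<lambda>y. \<Sum>b\<in>Basis. (\<phi> y \<bullet> b - \<phi> x \<bullet> b) * g b (\<phi> y))"
    using tangent_add[OF assms(3) smooth_near_const
        smooth_near_sum[where f = "\<lambda>b y. (\<phi> y \<bullet> b - \<phi> x \<bullet> b) * g b (\<phi> y)" and I = Basis, OF smooth_near_mult[OF sc sm]], of "f x"]
      tangent_const[OF assms(3)] by simp
  also have "\<dots> = (\<Sum>b\<in>Basis. v (\<lambda>y. (\<phi> y \<bullet> b - \<phi> x \<bullet> b) * g b (\<phi> y)))"
    by (rule tangent_sum[OF assms(3) smooth_near_mult[OF sc sm]])
  also have "\<dots> = (\<Sum>b\<in>Basis. v (\<lambda>y. \<phi> y \<bullet> b) * frechet_derivative (f \<circ> ?i) (at (\<phi> x)) b)"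
  proof (rule sum.cong[OF refl])
    fix b :: 'e assume "b \<in> Basis"
    show "v (\<lambda>y. (\<phi> y \<bullet> b - \<phi> x \<bullet> b) * g b (\<phi> y)) = v (\<lambda>y. \<phi> y \<bullet> b) * frechet_derivative (f \<circ> ?i) (at (\<phi> x)) b"
      using tangent_mult[OF assms(3) sc sm, of b b] g(2)
        tangent_diff[OF assms(3) smooth_near_coordinate[OF assms(1,2)] smooth_near_const, of b "\<phi> x \<bullet> b"]
        tangent_const[OF assms(3)] by simp
  qed
  also have "\<dots> = cvec U \<phi> x (coords \<phi> v) f"
  proof -
    interpret linear "frechet_derivative (f \<circ> ?i) (at (\<phi> x))"
      by (rule has_derivative_linear[OF smooth_near_chart_derivative[OF assms(1,2) f]])
    show ?thesis
      using f by (simp add: cvec_def coords_def sum scale)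
  qed
  finally show "cvec U \<phi> x (coords \<phi> v) f = v f" ..
qed

lemma tangent_expand:
  assumes "(U, \<phi>) \<in> A" "x \<in> U" "v \<in> tangent_space A x"
  shows "v = (\<lambda>f. \<Sum>b\<in>Basis. v (\<lambda>y. \<phi> y \<bullet> b) * cvec U \<phi> x b f)"
proof
  fix f
  interpret linear "\<lambda>u. cvec U \<phi> x u f"
    by (rule linear_cvec[OF assms(1,2)])
  have "v f = cvec U \<phi> x (coords \<phi> v) f"
    using cvec_coords[OF assms] by simp
  then show "v f = (\<Sum>b\<in>Basis. v (\<lambda>y. \<phi> y \<bullet> b) * cvec U \<phi> x b f)"
    unfolding coords_def sum scale by simp
qed

section \<open>Smooth vector fields and the Lie bracket\<close>

lemma vector_field_iff:
  assumes "open V"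
  shows "vector_field A V X \<longleftrightarrow> (\<forall>x\<in>V. X x \<in> tangent_space A x) \<and>
    (\<forall>x\<in>V. \<forall>f. smooth_near A x f \<longrightarrow> smooth_near A x (\<lambda>y. X y f))"
proof (intro iffI conjI ballI allI impI)
  fix x assume X: "vector_field A V X" and x: "x \<in> V"
  then show "X x \<in> tangent_space A x" by (simp add: vector_field_def)
  fix f assume f: "smooth_near A x f"
  obtain N where N: "open N" "x \<in> N" "\<forall>y\<in>N. smooth_near A y f"
    using smooth_near_eventually[OF f] by blast
  then have "smooth_fun A (N \<inter> V) f"
    using smooth_fun_iff_near[of "N \<inter> V" f] assms by auto
  then have "smooth_fun A (N \<inter> V) (\<lambda>y. X y f)"
    using X N(1) assms unfolding vector_field_def by (meson open_Int Int_lower2)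
  then show "smooth_near A x (\<lambda>y. X y f)"
    using smooth_fun_iff_near[of "N \<inter> V"] N(1,2) assms x by auto
next
  assume X: "(\<forall>x\<in>V. X x \<in> tangent_space A x) \<and>
    (\<forall>x\<in>V. \<forall>f. smooth_near A x f \<longrightarrow> smooth_near A x (\<lambda>y. X y f))"
  have "smooth_fun A W (\<lambda>x. X x f)" if W: "open W" "W \<subseteq> V" "smooth_fun A W f" for W f
  proof -
    have "\<forall>x\<in>W. smooth_near A x f"
      using smooth_fun_iff_near[OF W(1)] W(3) by blast
    then have "\<forall>x\<in>W. smooth_near A x (\<lambda>x. X x f)"
      using X W(2) by blast
    then show ?thesis
      using smooth_fun_iff_near[OF W(1)] by blast
  qed
  then show "vector_field A V X"
    using X unfolding vector_field_def by blast
qed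

lemma vector_fieldD:
  assumes "vector_field A V X" "open V" "x \<in> V"
  shows "X x \<in> tangent_space A x" "smooth_near A x f \<Longrightarrow> smooth_near A x (\<lambda>y. X y f)"
  using assms vector_field_iff by blast+

lemma vector_field_subset: "vector_field A V X \<Longrightarrow> W \<subseteq> V \<Longrightarrow> vector_field A W X"
  unfolding vector_field_def by (meson subset_trans subsetD)

lemma vector_field_lincomb:
  assumes "open V" "vector_field A V X" "vector_field A V Y"
    "\<And>x. x \<in> V \<Longrightarrow> smooth_near A x f" "\<And>x. x \<in> V \<Longrightarrow> smooth_near A x g"
  shows "vector_field A V (\<lambda>x. tlincomb (f x) (X x) (g x) (Y x))"
  unfolding vector_field_iff[OF assms(1)]
  using vector_fieldD[OF assms(2,1)] vector_fieldD[OF assms(3,1)] assms(4,5)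
  by (auto simp: tlincomb_def[abs_def] intro!: tlincomb_in_tangent_space[unfolded tlincomb_def]
      smooth_near_add smooth_near_mult)

lemma vector_field_cvec:
  assumes "(U, \<phi>) \<in> A"
  shows "vector_field A U (\<lambda>x. cvec U \<phi> x u)"
  unfolding vector_field_iff[OF chart_open[OF assms]]
proof (intro conjI ballI allI impI cvec_in_tangent_space[OF assms])
  fix x f assume x: "x \<in> U" and f: "smooth_near A x f"
  let ?i = "inv_into U \<phi>"
  obtain W where W: "open W" "x \<in> W" "W \<subseteq> U" "smooth_on (\<phi> ` W) (f \<circ> ?i)"
    using f smooth_near_chart_iff[OF assms x] by blast
  have "U \<inter> W = W" using W(3) by blast
  then have op: "open (\<phi> ` W)"
    using chart_image_open_subset[OF assms W(1)] by simp
  have near: "smooth_near A y f" if "y \<in> W" for y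
    unfolding smooth_near_chart_iff[OF assms subsetD[OF W(3) that]] using W that by blast
  have "smooth_on (\<phi> ` W) ((\<lambda>y. cvec U \<phi> y u f) \<circ> ?i)"
    by (rule iffD1[OF smooth_on_cong[OF op] smooth_on_derivative[OF W(4), of u]])
      (use W(3) chart_inv[OF assms] near in \<open>auto simp: cvec_def\<close>)
  then show "smooth_near A x (\<lambda>y. cvec U \<phi> y u f)"
    unfolding smooth_near_chart_iff[OF assms x] using W by blast
qed

lemma lie_bracket_apply:
  "smooth_near A x f \<Longrightarrow> lie_bracket A X Y x f = X x (\<lambda>y. Y y f) - Y x (\<lambda>y. X y f)"
  by (simp add: lie_bracket_def)

text \<open>In X(Y(f g)) the mixed products of first derivatives, X f Y g + X g Y f, are symmetric
  in the two fields. They cancel in the commutator, which leaves the product rule.\<close>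

lemma lie_bracket_in_tangent_space:
  assumes V: "open V" "vector_field A V X" "vector_field A V Y" and x: "x \<in> V"
  shows "lie_bracket A X Y x \<in> tangent_space A x"
proof -
  note X = vector_fieldD[OF V(2,1)] and Y = vector_fieldD[OF V(3,1)]
  have lin: "Z x (\<lambda>y. Z' y (\<lambda>y. a * f y + b * g y)) = a * Z x (\<lambda>y. Z' y f) + b * Z x (\<lambda>y. Z' y g)"
    if Z: "\<And>y. y \<in> V \<Longrightarrow> Z y \<in> tangent_space A y" and Z': "\<And>y. y \<in> V \<Longrightarrow> Z' y \<in> tangent_space A y"
      "\<And>y f. y \<in> V \<Longrightarrow> smooth_near A y f \<Longrightarrow> smooth_near A y (\<lambda>y. Z' y f)"
      and fg: "smooth_near A x f" "smooth_near A x g" for Z Z' f g a b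
  proof -
    obtain N where N: "open N" "x \<in> N" "\<forall>y\<in>N. smooth_near A y f"
      using smooth_near_eventually[OF fg(1)] by blast
    obtain N' where N': "open N'" "x \<in> N'" "\<forall>y\<in>N'. smooth_near A y g"
      using smooth_near_eventually[OF fg(2)] by blast
    have "Z x (\<lambda>y. Z' y (\<lambda>y. a * f y + b * g y)) = Z x (\<lambda>y. a * Z' y f + b * Z' y g)"
      by (rule tangent_cong[OF Z[OF x], of "N \<inter> N' \<inter> V"])
        (use N N' V(1) x tangent_lincomb[OF Z'(1)] in auto)
    then show ?thesis
      using tangent_lincomb[OF Z[OF x] Z'(2)[OF x fg(1)] Z'(2)[OF x fg(2)]] by simp
  qed
  have mul: "Z x (\<lambda>y. Z' y (\<lambda>y. f y * g y)) = f x * Z x (\<lambda>y. Z' y g) + Z' x g * Z x f +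
      (g x * Z x (\<lambda>y. Z' y f) + Z' x f * Z x g)"
    if Z: "\<And>y. y \<in> V \<Longrightarrow> Z y \<in> tangent_space A y" and Z': "\<And>y. y \<in> V \<Longrightarrow> Z' y \<in> tangent_space A y"
      "\<And>y f. y \<in> V \<Longrightarrow> smooth_near A y f \<Longrightarrow> smooth_near A y (\<lambda>y. Z' y f)"
      and fg: "smooth_near A x f" "smooth_near A x g" for Z Z' f g
  proof -
    obtain N where N: "open N" "x \<in> N" "\<forall>y\<in>N. smooth_near A y f"
      using smooth_near_eventually[OF fg(1)] by blast
    obtain N' where N': "open N'" "x \<in> N'" "\<forall>y\<in>N'. smooth_near A y g"
      using smooth_near_eventually[OF fg(2)] by blast
    note s = Z'(2)[OF x fg(1)] Z'(2)[OF x fg(2)]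
    have "Z x (\<lambda>y. Z' y (\<lambda>y. f y * g y)) = Z x (\<lambda>y. f y * Z' y g + g y * Z' y f)"
      by (rule tangent_cong[OF Z[OF x], of "N \<inter> N' \<inter> V"])
        (use N N' V(1) x tangent_mult[OF Z'(1)] in auto)
    also have "\<dots> = Z x (\<lambda>y. f y * Z' y g) + Z x (\<lambda>y. g y * Z' y f)"
      by (rule tangent_add[OF Z[OF x] smooth_near_mult[OF fg(1) s(2)] smooth_near_mult[OF fg(2) s(1)]])
    finally show ?thesis
      using tangent_mult[OF Z[OF x] fg(1) s(2)] tangent_mult[OF Z[OF x] fg(2) s(1)] by simp
  qed
  show ?thesis
    unfolding tangent_space_def
  proof (intro CollectI conjI allI impI)
    show "lie_bracket A X Y x f = 0" if "\<not> smooth_near A x f" for f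
      using that by (simp add: lie_bracket_def)
    fix f g assume fg: "smooth_near A x f \<and> smooth_near A x g"
    then have fg': "smooth_near A x f" "smooth_near A x g" by simp_all
    show "lie_bracket A X Y x (\<lambda>y. a * f y + b * g y) = a * lie_bracket A X Y x f + b * lie_bracket A X Y x g" for a b
      using lin[OF X(1) Y fg', of a b] lin[OF Y(1) X fg', of a b] fg'
      by (simp add: lie_bracket_apply smooth_near_add smooth_near_mult smooth_near_const algebra_simps)
    show "lie_bracket A X Y x (\<lambda>y. f y * g y) = f x * lie_bracket A X Y x g + g x * lie_bracket A X Y x f"
      using mul[OF X(1) Y fg'] mul[OF Y(1) X fg'] fg'
      by (simp add: lie_bracket_apply smooth_near_mult algebra_simps)
  qed
qed

lemma vector_field_lie_bracket:
  assumes "open V" "vector_field A V X" "vector_field A V Y"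
  shows "vector_field A V (lie_bracket A X Y)"
  unfolding vector_field_iff[OF assms(1)]
proof (intro conjI ballI allI impI lie_bracket_in_tangent_space[OF assms])
  fix x f assume x: "x \<in> V" and f: "smooth_near A x f"
  note X = vector_fieldD[OF assms(2,1)] and Y = vector_fieldD[OF assms(3,1)]
  obtain N where N: "open N" "x \<in> N" "\<forall>y\<in>N. smooth_near A y f"
    using smooth_near_eventually[OF f] by blast
  have "smooth_near A x (\<lambda>y. X y (\<lambda>z. Y z f) - Y y (\<lambda>z. X z f))"
    by (intro smooth_near_diff X(2)[OF x] Y(2)[OF x] f)
  then show "smooth_near A x (\<lambda>y. lie_bracket A X Y y f)"
    by (rule smooth_near_cong[OF _ N(1,2)]) (use N(3) lie_bracket_apply in auto)
qed

text \<open>The inner functions change only off \<open>V\<close>, where a derivation at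
  \<open>x\<close> does not look.\<close>

lemma lie_bracket_cong:
  assumes "open V" "x \<in> V" "X x \<in> tangent_space A x" "Y x \<in> tangent_space A x"
    "\<And>y. y \<in> V \<Longrightarrow> X y = X' y" "\<And>y. y \<in> V \<Longrightarrow> Y y = Y' y"
  shows "lie_bracket A X Y x = lie_bracket A X' Y' x"
proof
  fix f
  have "X x (\<lambda>y. Y y f) = X x (\<lambda>y. Y' y f)" "Y x (\<lambda>y. X y f) = Y x (\<lambda>y. X' y f)"
    by (rule tangent_cong[OF assms(3,1,2)] tangent_cong[OF assms(4,1,2)]; use assms(5,6) in simp)+
  then show "lie_bracket A X Y x f = lie_bracket A X' Y' x f"
    using assms(2,5,6) by (simp add: lie_bracket_def)
qed

text \<open>Meant for the projection of a field to \<open>H\<close>, which subtracts a variable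
  multiple of another field.\<close>

lemma lie_bracket_add_scaled:
  assumes V: "open V" "vector_field A V X" "vector_field A V Y" "vector_field A V Z" and x: "x \<in> V"
    and c: "smooth_near A x c"
  shows "lie_bracket A X (\<lambda>y. tlincomb 1 (Y y) (c y) (Z y)) x =
    tlincomb 1 (tlincomb 1 (lie_bracket A X Y x) (X x c) (Z x)) (c x) (lie_bracket A X Z x)"
proof
  fix f
  note X = vector_fieldD[OF V(2,1) x] and Y = vector_fieldD[OF V(3,1) x] and Z = vector_fieldD[OF V(4,1) x]
  show "lie_bracket A X (\<lambda>y. tlincomb 1 (Y y) (c y) (Z y)) x f =
    tlincomb 1 (tlincomb 1 (lie_bracket A X Y x) (X x c) (Z x)) (c x) (lie_bracket A X Z x) f"
  proof (cases "smooth_near A x f")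
    case True
    have "X x (\<lambda>y. Y y f + c y * Z y f) = X x (\<lambda>y. Y y f) + (c x * X x (\<lambda>y. Z y f) + Z x f * X x c)"
      using tangent_add[OF X(1) Y(2)[OF True] smooth_near_mult[OF c Z(2)[OF True]]]
        tangent_mult[OF X(1) c Z(2)[OF True]] by simp
    then show ?thesis
      using True by (simp add: lie_bracket_apply tlincomb_def algebra_simps)
  next
    case False
    then show ?thesis
      using tangent_not_smooth[OF Z(1)] by (simp add: lie_bracket_def tlincomb_def)
  qed
qed

text \<open>Stated as a Leibniz rule for two purposes: if brackets with X and with Y preserve the
  sections of a distribution, so do brackets with [X, Y]; and a field that commutes with two others
  near a point commutes with their bracket there.\<close>

lemma jacobi_identity:
  assumes V: "open V" "vector_field A V X" "vector_field A V Y" "vector_field A V Z" and x: "x \<in> V"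
  shows "lie_bracket A (lie_bracket A X Y) Z x =
    tlincomb 1 (lie_bracket A X (lie_bracket A Y Z) x) (-1) (lie_bracket A Y (lie_bracket A X Z) x)"
proof
  fix f
  note X = vector_fieldD[OF V(2,1) x] and Y = vector_fieldD[OF V(3,1) x] and Z = vector_fieldD[OF V(4,1) x]
  show "lie_bracket A (lie_bracket A X Y) Z x f =
    tlincomb 1 (lie_bracket A X (lie_bracket A Y Z) x) (-1) (lie_bracket A Y (lie_bracket A X Z) x) f"
  proof (cases "smooth_near A x f")
    case f: True
    obtain N where N: "open N" "x \<in> N" "\<forall>y\<in>N. smooth_near A y f"
      using smooth_near_eventually[OF f] by blast
    have d: "v (\<lambda>y. lie_bracket A P Q y f) = v (\<lambda>y. P y (\<lambda>z. Q z f)) - v (\<lambda>y. Q y (\<lambda>z. P z f))"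
      if v: "v \<in> tangent_space A x" and P: "vector_field A V P" and Q: "vector_field A V Q" for v P Q
    proof -
      note P = vector_fieldD(2)[OF P V(1) x] and Q = vector_fieldD(2)[OF Q V(1) x]
      have "v (\<lambda>y. lie_bracket A P Q y f) = v (\<lambda>y. P y (\<lambda>z. Q z f) - Q y (\<lambda>z. P z f))"
        by (rule tangent_cong[OF v N(1,2)]) (use N(3) lie_bracket_apply in auto)
      then show ?thesis
        using tangent_diff[OF v P[OF Q[OF f]] Q[OF P[OF f]]] by simp
    qed
    show ?thesis
      using f d[OF X(1) V(3,4)] d[OF Y(1) V(2,4)] d[OF Z(1) V(2,3)] X(2) Y(2) Z(2)
      by (simp add: lie_bracket_apply tlincomb_def)
  next
    case False
    then show ?thesis by (simp add: lie_bracket_def tlincomb_def)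
  qed
qed

section \<open>One-forms and exterior derivatives\<close>

lemma one_form_lincomb:
  "one_form A V \<alpha> \<Longrightarrow> x \<in> V \<Longrightarrow> u \<in> tangent_space A x \<Longrightarrow> v \<in> tangent_space A x \<Longrightarrow>
    \<alpha> x (tlincomb a u b v) = a * \<alpha> x u + b * \<alpha> x v"
  by (simp add: one_form_def)

lemma one_form_tzero: "one_form A V \<alpha> \<Longrightarrow> x \<in> V \<Longrightarrow> \<alpha> x tzero = 0"
  using one_form_lincomb[OF _ _ tzero_in_tangent_space tzero_in_tangent_space, of V \<alpha> x 0 0]
  by (simp add: tlincomb_def tzero_def)

lemma one_form_smooth_near:
  assumes "open V" "one_form A V \<alpha>" "open W" "vector_field A W X" "x \<in> V" "x \<in> W"
  shows "smooth_near A x (\<lambda>y. \<alpha> y (X y))"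
proof -
  have "smooth_fun A (V \<inter> W) (\<lambda>y. \<alpha> y (X y))"
    using assms(1-3) vector_field_subset[OF assms(4), of "V \<inter> W"] unfolding one_form_def
    by (meson Int_lower1 Int_lower2 open_Int)
  then show ?thesis
    using smooth_fun_iff_near[of "V \<inter> W"] assms by blast
qed

lemma one_form_sum:
  assumes "one_form A V \<alpha>" "x \<in> V" "finite I" "\<And>i. i \<in> I \<Longrightarrow> w i \<in> tangent_space A x"
  shows "(\<lambda>f. \<Sum>i\<in>I. c i * w i f) \<in> tangent_space A x \<and>
    \<alpha> x (\<lambda>f. \<Sum>i\<in>I. c i * w i f) = (\<Sum>i\<in>I. c i * \<alpha> x (w i))"
  using assms(3,4)
proof (induction I)
  case empty
  then show ?case
    using tzero_in_tangent_space one_form_tzero[OF assms(1,2)] by (simp add: tzero_def)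
next
  case (insert i I)
  have "(\<lambda>f. \<Sum>i\<in>insert i I. c i * w i f) = tlincomb (c i) (w i) 1 (\<lambda>f. \<Sum>i\<in>I. c i * w i f)"
    using insert by (simp add: tlincomb_def)
  then show ?case
    using insert tlincomb_in_tangent_space one_form_lincomb[OF assms(1,2)] by simp
qed

lemma one_form_expand:
  assumes "one_form A V \<alpha>" "x \<in> V" "(U, \<phi>) \<in> A" "x \<in> U" "v \<in> tangent_space A x"
  shows "\<alpha> x v = (\<Sum>b\<in>Basis. v (\<lambda>y. \<phi> y \<bullet> b) * \<alpha> x (cvec U \<phi> x b))"
proof -
  have "\<alpha> x v = \<alpha> x (\<lambda>f. \<Sum>b\<in>Basis. v (\<lambda>y. \<phi> y \<bullet> b) * cvec U \<phi> x b f)"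
    using tangent_expand[OF assms(3-5)] by (rule arg_cong)
  then show ?thesis
    using one_form_sum[OF assms(1,2) finite_Basis, of "cvec U \<phi> x"] cvec_in_tangent_space[OF assms(3,4)] by simp
qed

text \<open>The product rule for \<alpha>(Y), written as the sum over b of Y(\<phi>_b) \<alpha>(e_b)
  with the coordinate fields e_b given by \<open>cvec\<close>.\<close>

lemma tangent_one_form_field:
  assumes "open V" "one_form A V \<alpha>" "open W" "vector_field A W Y" "x \<in> V" "x \<in> W"
    "(U, \<phi>) \<in> A" "x \<in> U" "v \<in> tangent_space A x"
  shows "v (\<lambda>y. \<alpha> y (Y y)) = (\<Sum>b\<in>Basis. v (\<lambda>y. Y y (\<lambda>z. \<phi> z \<bullet> b)) * \<alpha> x (cvec U \<phi> x b) +
    Y x (\<lambda>z. \<phi> z \<bullet> b) * v (\<lambda>y. \<alpha> y (cvec U \<phi> y b)))"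
proof -
  have s1: "smooth_near A x (\<lambda>y. Y y (\<lambda>z. \<phi> z \<bullet> b))" for b
    by (rule vector_fieldD(2)[OF assms(4,3,6) smooth_near_coordinate[OF assms(7,8)]])
  have s2: "smooth_near A x (\<lambda>y. \<alpha> y (cvec U \<phi> y b))" for b
    by (rule one_form_smooth_near[OF assms(1,2) chart_open[OF assms(7)] vector_field_cvec[OF assms(7)] assms(5,8)])
  have "v (\<lambda>y. \<alpha> y (Y y)) = v (\<lambda>y. \<Sum>b\<in>Basis. Y y (\<lambda>z. \<phi> z \<bullet> b) * \<alpha> y (cvec U \<phi> y b))"
  proof (rule tangent_cong[OF assms(9), of "U \<inter> V \<inter> W"])
    show "open (U \<inter> V \<inter> W)" "x \<in> U \<inter> V \<inter> W"
      using assms chart_open[OF assms(7)] by auto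
    show "\<alpha> y (Y y) = (\<Sum>b\<in>Basis. Y y (\<lambda>z. \<phi> z \<bullet> b) * \<alpha> y (cvec U \<phi> y b))" if "y \<in> U \<inter> V \<inter> W" for y
      using that one_form_expand[OF assms(2) _ assms(7), of y "Y y"] vector_fieldD(1)[OF assms(4,3)] by simp
  qed
  also have "\<dots> = (\<Sum>b\<in>Basis. v (\<lambda>y. Y y (\<lambda>z. \<phi> z \<bullet> b) * \<alpha> y (cvec U \<phi> y b)))"
    by (rule tangent_sum[OF assms(9) smooth_near_mult[OF s1 s2]])
  also have "\<dots> = (\<Sum>b\<in>Basis. v (\<lambda>y. Y y (\<lambda>z. \<phi> z \<bullet> b)) * \<alpha> x (cvec U \<phi> x b) +
      Y x (\<lambda>z. \<phi> z \<bullet> b) * v (\<lambda>y. \<alpha> y (cvec U \<phi> y b)))"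
    by (simp add: tangent_mult[OF assms(9) s1 s2] algebra_simps)
  finally show ?thesis .
qed

lemma one_form_lie_bracket:
  assumes "open V" "one_form A V \<alpha>" "open W" "vector_field A W X" "vector_field A W Y" "x \<in> V" "x \<in> W"
    "(U, \<phi>) \<in> A" "x \<in> U"
  shows "\<alpha> x (lie_bracket A X Y x) = (\<Sum>b\<in>Basis. (X x (\<lambda>y. Y y (\<lambda>z. \<phi> z \<bullet> b)) -
    Y x (\<lambda>y. X y (\<lambda>z. \<phi> z \<bullet> b))) * \<alpha> x (cvec U \<phi> x b))"
  unfolding one_form_expand[OF assms(2,6,8,9) lie_bracket_in_tangent_space[OF assms(3-5,7)]]
    lie_bracket_apply[OF smooth_near_coordinate[OF assms(8,9)]] ..

text \<open>The coordinate expression of \<open>d\<alpha>\<close>, which shows that it does not depend on the chosen extensions.\<close>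

definition dcoord where
  "dcoord U \<phi> \<alpha> u v = (\<Sum>b\<in>Basis. v (\<lambda>z. \<phi> z \<bullet> b) * u (\<lambda>y. \<alpha> y (cvec U \<phi> y b)) -
    u (\<lambda>z. \<phi> z \<bullet> b) * v (\<lambda>y. \<alpha> y (cvec U \<phi> y b)))"

text \<open>The derivatives of the components of \<open>X\<close> and \<open>Y\<close> in the first
  two terms are those of \<alpha>([X, Y]) and cancel. What remains uses the two fields only through
  their values at \<open>x\<close>.\<close>

lemma dcoord_fields:
  assumes "open V" "one_form A V \<alpha>" "open W" "vector_field A W X" "vector_field A W Y" "x \<in> V" "x \<in> W"
    "(U, \<phi>) \<in> A" "x \<in> U"
  shows "X x (\<lambda>y. \<alpha> y (Y y)) - Y x (\<lambda>y. \<alpha> y (X y)) - \<alpha> x (lie_bracket A X Y x) = dcoord U \<phi> \<alpha> (X x) (Y x)"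
  unfolding one_form_lie_bracket[OF assms] dcoord_def
    tangent_one_form_field[OF assms(1-3,5-9) vector_fieldD(1)[OF assms(4,3,7)]]
    tangent_one_form_field[OF assms(1-4,6-9) vector_fieldD(1)[OF assms(5,3,7)]]
    sum_subtractf[symmetric]
  by (rule sum.cong[OF refl]) (simp add: algebra_simps)

section \<open>Independence of the chosen local extensions\<close>

lemma local_extension_exists:
  assumes "v \<in> tangent_space A x"
  obtains X where "local_extension A x v X"
proof -
  obtain U \<phi> where U: "(U, \<phi>) \<in> A" "x \<in> U" by (rule chart_exists)
  have "local_extension A x v (\<lambda>y. cvec U \<phi> y (coords \<phi> v))"
    unfolding local_extension_def
    using chart_open[OF U(1)] U(2) vector_field_cvec[OF U(1)] cvec_coords[OF U assms] by blast
  then show thesis by (rule that)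
qed

lemma local_extensions_common:
  assumes "local_extension A x u X" "local_extension A x v Y"
  obtains W where "open W" "x \<in> W" "vector_field A W X" "vector_field A W Y" "X x = u" "Y x = v"
proof -
  obtain W1 where W1: "open W1" "x \<in> W1" "vector_field A W1 X" "X x = u"
    using assms(1) unfolding local_extension_def by blast
  obtain W2 where W2: "open W2" "x \<in> W2" "vector_field A W2 Y" "Y x = v"
    using assms(2) unfolding local_extension_def by blast
  show thesis
    by (rule that[of "W1 \<inter> W2"])
      (use W1 W2 vector_field_subset[OF W1(3)] vector_field_subset[OF W2(3)] in auto)
qed

text \<open>The description in \<open>ext_deriv\<close> denotes: extensions exist, namely those with
  constant components in a chart, and every pair of them yields the same value
  \<open>dcoord\<close>.\<close>

lemma ext_deriv_eq_dcoord:
  assumes "open V" "one_form A V \<alpha>" "x \<in> V" "(U, \<phi>) \<in> A" "x \<in> U"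
    "u \<in> tangent_space A x" "v \<in> tangent_space A x"
  shows "ext_deriv A \<alpha> x u v = dcoord U \<phi> \<alpha> u v"
proof -
  have *: "X x (\<lambda>y. \<alpha> y (Y y)) - Y x (\<lambda>y. \<alpha> y (X y)) - \<alpha> x (lie_bracket A X Y x) = dcoord U \<phi> \<alpha> u v"
    if "local_extension A x u X" "local_extension A x v Y" for X Y
    using that by (rule local_extensions_common) (use dcoord_fields[OF assms(1,2) _ _ _ assms(3) _ assms(4,5)] in blast)
  obtain X where X: "local_extension A x u X" by (rule local_extension_exists[OF assms(6)])
  obtain Y where Y: "local_extension A x v Y" by (rule local_extension_exists[OF assms(7)])
  show ?thesis
    unfolding ext_deriv_def
  proof (rule the_equality)
    show "\<exists>X Y. local_extension A x u X \<and> local_extension A x v Y \<and>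
        dcoord U \<phi> \<alpha> u v = X x (\<lambda>y. \<alpha> y (Y y)) - Y x (\<lambda>y. \<alpha> y (X y)) - \<alpha> x (lie_bracket A X Y x)"
      using X Y *[OF X Y] by metis
    show "r = dcoord U \<phi> \<alpha> u v" if "\<exists>X Y. local_extension A x u X \<and> local_extension A x v Y \<and>
        r = X x (\<lambda>y. \<alpha> y (Y y)) - Y x (\<lambda>y. \<alpha> y (X y)) - \<alpha> x (lie_bracket A X Y x)" for r
      using that * by auto
  qed
qed

lemma ext_deriv_fields:
  assumes "open V" "one_form A V \<alpha>" "open W" "vector_field A W X" "vector_field A W Y" "x \<in> V" "x \<in> W"
  shows "ext_deriv A \<alpha> x (X x) (Y x) =
    X x (\<lambda>y. \<alpha> y (Y y)) - Y x (\<lambda>y. \<alpha> y (X y)) - \<alpha> x (lie_bracket A X Y x)"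
proof -
  obtain U \<phi> where U: "(U, \<phi>) \<in> A" "x \<in> U" by (rule chart_exists)
  show ?thesis
    using ext_deriv_eq_dcoord[OF assms(1,2,6) U] dcoord_fields[OF assms U]
      vector_fieldD(1)[OF assms(4,3,7)] vector_fieldD(1)[OF assms(5,3,7)] by simp
qed

text \<open>The relation to \<open>\<alpha>\<close> is asked for tangent vectors only, since the
  form to be built is given by a description whose value elsewhere is unspecified.\<close>

lemma one_form_rescale:
  assumes "open V" "one_form A V \<alpha>" "\<And>x. x \<in> V \<Longrightarrow> smooth_near A x g"
    "\<And>x v. x \<in> V \<Longrightarrow> v \<in> tangent_space A x \<Longrightarrow> \<beta> x v = g x * \<alpha> x v"
  shows "one_form A V \<beta>"
  unfolding one_form_def
proof (intro conjI ballI allI impI)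
  fix x u v a b
  assume "x \<in> V" "u \<in> tangent_space A x" "v \<in> tangent_space A x"
  then show "\<beta> x (tlincomb a u b v) = a * \<beta> x u + b * \<beta> x v"
    using one_form_lincomb[OF assms(2)] tlincomb_in_tangent_space assms(4) by (simp add: algebra_simps)
next
  fix W X assume "open W \<and> W \<subseteq> V \<and> vector_field A W X"
  then have W: "open W" "W \<subseteq> V" "vector_field A W X" by blast+
  have "smooth_near A x (\<lambda>y. \<beta> y (X y))" if x: "x \<in> W" for x
  proof (rule smooth_near_cong[OF _ W(1) x])
    show "smooth_near A x (\<lambda>y. g y * \<alpha> y (X y))"
      using W(2) x by (intro smooth_near_mult assms(3) one_form_smooth_near[OF assms(1,2) W(1,3)]) auto
    show "g y * \<alpha> y (X y) = \<beta> y (X y)" if "y \<in> W" for y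
      using that W(2) assms(4) vector_fieldD(1)[OF W(3,1)] by auto
  qed
  then show "smooth_fun A W (\<lambda>x. \<beta> x (X x))"
    using smooth_fun_iff_near[OF W(1)] by blast
qed

text \<open>This is the rule d(g \<alpha>) = g d\<alpha> + dg \<and> \<alpha>, with
  \<open>u g\<close> for dg(u). The terms with dg come from differentiating \<beta>(Y) and
  \<beta>(X); the bracket term contributes none.\<close>

lemma ext_deriv_rescale:
  assumes "open V" "one_form A V \<alpha>" "\<And>x. x \<in> V \<Longrightarrow> smooth_near A x g"
    "\<And>x v. x \<in> V \<Longrightarrow> v \<in> tangent_space A x \<Longrightarrow> \<beta> x v = g x * \<alpha> x v"
    and "x \<in> V" "u \<in> tangent_space A x" "v \<in> tangent_space A x"
  shows "ext_deriv A \<beta> x u v = g x * ext_deriv A \<alpha> x u v + u g * \<alpha> x v - \<alpha> x u * v g"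
proof -
  obtain X where X: "local_extension A x u X" by (rule local_extension_exists[OF assms(6)])
  obtain Y where Y: "local_extension A x v Y" by (rule local_extension_exists[OF assms(7)])
  obtain W where W: "open W" "x \<in> W" "vector_field A W X" "vector_field A W Y" "X x = u" "Y x = v"
    using local_extensions_common[OF X Y] .
  have \<beta>: "one_form A V \<beta>" by (rule one_form_rescale[OF assms(1-4)])
  have d: "w (\<lambda>y. \<beta> y (Z y)) = g x * w (\<lambda>y. \<alpha> y (Z y)) + \<alpha> x (Z x) * w g"
    if w: "w \<in> tangent_space A x" and Z: "vector_field A W Z" for w Z
  proof -
    have "w (\<lambda>y. \<beta> y (Z y)) = w (\<lambda>y. g y * \<alpha> y (Z y))"
      by (rule tangent_cong[OF w, of "V \<inter> W"])
        (use assms(1,4,5) W(1,2) vector_fieldD(1)[OF Z W(1)] in auto)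
    then show ?thesis
      using tangent_mult[OF w assms(3)[OF assms(5)] one_form_smooth_near[OF assms(1,2) W(1) Z assms(5) W(2)]]
      by simp
  qed
  have \<alpha>: "ext_deriv A \<alpha> x u v = u (\<lambda>y. \<alpha> y (Y y)) - v (\<lambda>y. \<alpha> y (X y)) - \<alpha> x (lie_bracket A X Y x)"
    using ext_deriv_fields[OF assms(1,2) W(1,3,4) assms(5) W(2)] W(5,6) by simp
  have \<beta>: "ext_deriv A \<beta> x u v = u (\<lambda>y. \<beta> y (Y y)) - v (\<lambda>y. \<beta> y (X y)) - \<beta> x (lie_bracket A X Y x)"
    using ext_deriv_fields[OF assms(1) \<beta> W(1,3,4) assms(5) W(2)] W(5,6) by simp
  show ?thesis
    unfolding \<alpha> \<beta> d[OF assms(6) W(4)] d[OF assms(7) W(3)] W(5,6)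
      assms(4)[OF assms(5) lie_bracket_in_tangent_space[OF W(1,3,4,2)]]
    by (simp add: algebra_simps)
qed

text \<open>The summand dg \<and> \<alpha> of d\<beta> equals (dg/g) \<and> \<beta> and drops out of
  the product of \<beta> with the n-th power of d\<beta>. What remains is g ^ (n + 1) times the
  product for \<alpha>.\<close>

lemma contact_form_rescale:
  assumes "contact_form n A V \<alpha>" "\<And>x. x \<in> V \<Longrightarrow> smooth_near A x g" "\<And>x. x \<in> V \<Longrightarrow> g x \<noteq> 0"
    "\<And>x v. x \<in> V \<Longrightarrow> v \<in> tangent_space A x \<Longrightarrow> \<beta> x v = g x * \<alpha> x v"
  shows "contact_form n A V \<beta>"
proof -
  have V: "open V" "one_form A V \<alpha>" using assms(1) by (auto simp: contact_form_def)
  have "\<exists>v. (\<forall>i\<le>2 * n. v i \<in> tangent_space A x) \<and> wedge_power n (\<beta> x) (ext_deriv A \<beta> x) v \<noteq> 0"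
    if x: "x \<in> V" for x
  proof -
    obtain v where v: "\<And>i. i \<le> 2 * n \<Longrightarrow> v i \<in> tangent_space A x" "wedge_power n (\<alpha> x) (ext_deriv A \<alpha> x) v \<noteq> 0"
      using assms(1) x unfolding contact_form_def by blast
    let ?g = "g x"
    have "wedge_power n (\<beta> x) (ext_deriv A \<beta> x) v = wedge_power n (\<lambda>u. ?g * \<alpha> x u) (ext_deriv A \<beta> x) v"
      using v(1) assms(4)[OF x] by (intro wedge_power_cong) auto
    also have "\<dots> = wedge_power n (\<lambda>u. ?g * \<alpha> x u) (\<lambda>u w. ?g * ext_deriv A \<alpha> x u w) v"
      using v(1) assms(3)[OF x] ext_deriv_rescale[OF V assms(2,4) x]
      by (intro wedge_power_add_wedge[where \<theta> = "\<lambda>i. v i g / ?g"]) simp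
    also have "\<dots> = ?g ^ Suc n * wedge_power n (\<alpha> x) (ext_deriv A \<alpha> x) v"
      by (rule wedge_power_scale)
    finally show ?thesis
      using v assms(3)[OF x] by (intro exI[of _ v]) simp
  qed
  then show ?thesis
    using V one_form_rescale[OF V assms(2,4)] unfolding contact_form_def by blast
qed

text \<open>Every term of the alternating sum has a factor \<open>\<alpha> x (v i)\<close>.\<close>

lemma contact_form_nonzero:
  assumes "contact_form n A V \<alpha>" "x \<in> V"
  obtains w where "w \<in> tangent_space A x" "\<alpha> x w \<noteq> 0"
proof -
  obtain v where v: "\<And>i. i \<le> 2 * n \<Longrightarrow> v i \<in> tangent_space A x" "wedge_power n (\<alpha> x) (ext_deriv A \<alpha> x) v \<noteq> 0"
    using assms unfolding contact_form_def by blast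
  have "\<exists>i\<le>2 * n. \<alpha> x (v i) \<noteq> 0"
  proof (rule ccontr)
    assume "\<not> (\<exists>i\<le>2 * n. \<alpha> x (v i) \<noteq> 0)"
    then have "\<alpha> x (v (\<sigma> 0)) = 0" if "\<sigma> permutes {..2 * n}" for \<sigma>
      using permutes_in_image[OF that, of 0] by simp
    then have "wedge_power n (\<alpha> x) (ext_deriv A \<alpha> x) v = 0"
      unfolding wedge_power_def by simp
    with v(2) show False by simp
  qed
  then show thesis using that v(1) by blast
qed

text \<open>In coordinates, the linear form d\<alpha>(z, .) vanishes on the kernel of \<alpha> and
  hence is a multiple of \<alpha>. If \<open>z\<close> were not zero, this degeneracy would make the
  alternating sum vanish on every family of 2 n + 1 tangent vectors, against the contact
  condition.\<close>

lemma contact_form_nondegenerate: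
  assumes "contact_form n A V \<alpha>" "d = 2 * n + 1" "x \<in> V" "z \<in> tangent_space A x" "\<alpha> x z = 0"
    "\<And>w. w \<in> tangent_space A x \<Longrightarrow> \<alpha> x w = 0 \<Longrightarrow> ext_deriv A \<alpha> x z w = 0"
  shows "z = tzero"
proof (rule ccontr)
  assume "z \<noteq> tzero"
  have V: "open V" "one_form A V \<alpha>" using assms(1) by (auto simp: contact_form_def)
  obtain v where v: "\<And>i. i \<le> 2 * n \<Longrightarrow> v i \<in> tangent_space A x" "wedge_power n (\<alpha> x) (ext_deriv A \<alpha> x) v \<noteq> 0"
    using assms(1,3) unfolding contact_form_def by blast
  obtain U \<phi> where U: "(U, \<phi>) \<in> A" "x \<in> U" by (rule chart_exists)
  let ?c = "cvec U \<phi> x"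
  define \<alpha>b where "\<alpha>b b = (\<lambda>y. \<alpha> y (cvec U \<phi> y b))" for b
  define a where "a u = \<alpha> x (?c u)" for u
  define \<omega> where "\<omega> u w = ext_deriv A \<alpha> x (?c u) (?c w)" for u w
  have a: "a u = (\<Sum>b\<in>Basis. (u \<bullet> b) * \<alpha>b b x)" for u
    using one_form_expand[OF V(2) assms(3) U cvec_in_tangent_space[OF U], of u]
    unfolding cvec_coordinate[OF U] a_def \<alpha>b_def .
  have \<omega>: "\<omega> u w = (\<Sum>b\<in>Basis. (w \<bullet> b) * ?c u (\<alpha>b b) - (u \<bullet> b) * ?c w (\<alpha>b b))" for u w
    unfolding \<omega>_def ext_deriv_eq_dcoord[OF V assms(3) U cvec_in_tangent_space[OF U] cvec_in_tangent_space[OF U]]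
      dcoord_def cvec_coordinate[OF U] \<alpha>b_def ..
  have lc: "?c (u + w) f = ?c u f + ?c w f" "?c (r *\<^sub>R u) f = r * ?c u f" for u w r f
    using linear_cvec[OF U, of f] by (simp_all add: linear_iff)
  have la: "linear a"
    by (rule linearI) (simp_all add: a inner_add_left sum.distrib distrib_right sum_distrib_left mult.assoc)
  have l1: "linear (\<omega> u)" for u
    by (rule linearI) (simp_all add: \<omega> lc inner_add_left sum.distrib sum_distrib_left algebra_simps sum_subtractf)
  have anti: "\<omega> u w = - \<omega> w u" for u w
    by (simp add: \<omega> sum_negf[symmetric])
  have l2: "linear (\<lambda>u. \<omega> u w)" for w
  proof -
    have "(\<lambda>u. \<omega> u w) = (\<lambda>u. - \<omega> w u)"
      using anti by blast
    then show ?thesis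
      using linear_compose_neg[OF l1[of w]] by simp
  qed
  have z: "?c (coords \<phi> z) = z"
    by (rule cvec_coords[OF U assms(4)])
  have z0: "coords \<phi> z \<noteq> 0"
  proof
    assume "coords \<phi> z = 0"
    then have "z = ?c 0" using z by simp
    also have "\<dots> = tzero"
      using lc(2)[of 0 0] by (simp add: tzero_def fun_eq_iff)
    finally show False using \<open>z \<noteq> tzero\<close> by simp
  qed
  have az: "a (coords \<phi> z) = 0" using assms(5) z by (simp add: a_def)
  \<comment> \<open>Subtracting a multiple of a vector \<open>u0\<close> with \<open>a u0\<close>
    nonzero moves any vector into the kernel of \<open>a\<close>, which determines \<open>c\<close>.
    If \<open>a\<close> is zero everywhere, the kernel is the whole space and 0 serves.\<close>
  obtain c where c: "\<And>u. \<omega> (coords \<phi> z) u = c * a u"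
  proof (cases "\<exists>u. a u \<noteq> 0")
    case True
    then obtain u0 where u0: "a u0 \<noteq> 0" by blast
    have ker: "\<omega> (coords \<phi> z) w = 0" if "a w = 0" for w
      using assms(6)[OF cvec_in_tangent_space[OF U], of w] that z by (simp add: \<omega>_def a_def)
    have "\<omega> (coords \<phi> z) u = \<omega> (coords \<phi> z) u0 / a u0 * a u" for u
    proof -
      have "a (u - (a u / a u0) *\<^sub>R u0) = 0"
        using u0 la by (simp add: linear_diff linear_scale)
      from ker[OF this] show ?thesis
        using l1[of "coords \<phi> z"] by (simp add: linear_diff linear_scale)
    qed
    then show thesis by (rule that)
  next
    case False
    then have "\<omega> (coords \<phi> z) u = 0 * a u" for u
      using assms(6)[OF cvec_in_tangent_space[OF U], of u] z by (simp add: \<omega>_def a_def)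
    then show thesis by (rule that)
  qed
  have "DIM('e) = 2 * n + 1"
    using dim_model assms(2) by simp
  then have "wedge_power n a \<omega> (\<lambda>i. coords \<phi> (v i)) = 0"
    by (rule wedge_power_degenerate[OF _ la l1 l2 anti z0 az c])
  moreover have "wedge_power n (\<alpha> x) (ext_deriv A \<alpha> x) v = wedge_power n a \<omega> (\<lambda>i. coords \<phi> (v i))"
    by (rule wedge_power_cong) (simp_all add: a_def \<omega>_def cvec_coords[OF U] v(1))
  ultimately show False using v(2) by simp
qed

end

section \<open>Flows of contact fields\<close>

lemma frechet_derivative_slice:
  fixes g :: "real \<times> 'a::real_normed_vector \<Rightarrow> real"
  assumes "smooth_on D g" "(t, p) \<in> D"
  shows "frechet_derivative (\<lambda>p. g (t, p)) (at p) v = frechet_derivative g (at (t, p)) (0, v)"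
proof (rule frechet_derivative_eqI)
  have "((\<lambda>p. (t, p)) has_derivative (\<lambda>v. (0, v))) (at p)"
    by (auto intro!: derivative_eq_intros)
  from has_derivative_compose[OF this smooth_onD_derivative[OF assms]]
  show "((\<lambda>p. g (t, p)) has_derivative (\<lambda>v. frechet_derivative g (at (t, p)) (0, v))) (at p)" .
qed

lemma smooth_on_slice:
  fixes g :: "real \<times> 'a::euclidean_space \<Rightarrow> real"
  assumes "open D" "smooth_on D g"
  shows "open {p. (t, p) \<in> D}" "smooth_on {p. (t, p) \<in> D} (\<lambda>p. g (t, p))"
proof -
  have "open ((\<lambda>p. (t, p)) -` D)"
    by (rule open_vimage[OF assms(1)]) (intro continuous_intros)
  then show op: "open {p. (t, p) \<in> D}"
    by (simp add: vimage_def)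
  have "bounded_linear (\<lambda>p :: 'a. (0 :: real, p))"
    by (intro bounded_linear_Pair bounded_linear_zero bounded_linear_ident)
  then have "smooth_on {p. (t, p) \<in> D} (\<lambda>p. (t, 0) + (0, p))"
    by (rule smooth_on_add[OF op smooth_on_const smooth_on_bounded_linear[OF _ op smooth_on_id[OF op]]])
  then have "smooth_on {p. (t, p) \<in> D} (\<lambda>p. (t, p))"
    by simp
  then show "smooth_on {p. (t, p) \<in> D} (\<lambda>p. g (t, p))"
    by (rule smooth_on_compose[OF op _ assms(2)]) auto
qed

context smooth_mfd
begin

text \<open>Differentiates \<open>\<alpha>(\<Phi>\<^sub>t\<^sub>* w) = 0\<close> at \<open>t = 0\<close>; the mixed partial derivatives of the flow are exchanged.\<close>

lemma contact_field_preserves_kernel: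
  assumes X: "contact_field A H V X" "x \<in> V"
    and \<alpha>: "open V0" "one_form A V0 \<alpha>" "x \<in> V0" "\<And>y. y \<in> V0 \<Longrightarrow> H y = {v \<in> tangent_space A y. \<alpha> y v = 0}"
    and U: "(U, \<phi>) \<in> A" "x \<in> U" and w: "w \<in> H x"
  shows "(\<Sum>b\<in>Basis. w (\<lambda>y. X y (\<lambda>z. \<phi> z \<bullet> b)) * \<alpha> x (cvec U \<phi> x b) +
    w (\<lambda>z. \<phi> z \<bullet> b) * X x (\<lambda>y. \<alpha> y (cvec U \<phi> y b))) = 0"
proof -
  let ?i = "inv_into U \<phi>"
  obtain \<epsilon> N \<Phi> where "\<epsilon> > 0" and N: "open N" "x \<in> N" "N \<subseteq> V" and flow: "local_flow A V X \<epsilon> N \<Phi>"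
    and pres: "\<forall>t\<in>{-\<epsilon><..<\<epsilon>}. \<forall>y\<in>N. differential A A (\<Phi> t) y ` H y = H (\<Phi> t y)"
    using X unfolding contact_field_def by blast
  define I where "I = {-\<epsilon><..<\<epsilon>}"
  define \<Psi> where "\<Psi> = (\<lambda>(t, y). \<Phi> t y)"
  have "open I" "0 \<in> I" using \<open>\<epsilon> > 0\<close> by (simp_all add: I_def)
  have sm: "smooth_map_on (prod_atlas real_atlas A) A (I \<times> N) \<Psi>"
    and \<Phi>0: "\<And>y. y \<in> N \<Longrightarrow> \<Phi> 0 y = y"
    and ic: "\<And>y. y \<in> N \<Longrightarrow> integral_curve A X I (\<lambda>t. \<Phi> t y)"
    using flow unfolding local_flow_def I_def \<Psi>_def by blast+
  have curve: "((\<lambda>s. f (\<Phi> s y)) has_real_derivative X y f) (at 0)" if "y \<in> N" "smooth_near A y f" for y f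
    using ic[OF that(1)] \<open>0 \<in> I\<close> \<Phi>0[OF that(1)] that(2) unfolding integral_curve_def by metis
  have wT: "w \<in> tangent_space A x" using w \<alpha>(3,4) by auto

  \<comment> \<open>\<open>D\<close> consists of the pairs (t, p) such that the flow line starting
    at the point of \<open>N\<close> with coordinates \<open>p\<close> is in the chart domain at
    time \<open>t\<close>. On \<open>D\<close>, \<open>G b\<close> is the coordinate of the flow
    along \<open>b\<close>.\<close>
  define S where "S = (I \<times> N) \<inter> \<Psi> -` U"
  define D where "D = (UNIV \<times> \<phi> ` U) \<inter> (\<lambda>q. (fst q, ?i (snd q))) -` S"
  define G where "G b = (\<lambda>q. \<phi> (\<Phi> (fst q) (?i (snd q))) \<bullet> b)" for b
  have D: "(t, p) \<in> D \<longleftrightarrow> t \<in> I \<and> p \<in> \<phi> ` U \<and> ?i p \<in> N \<and> \<Phi> t (?i p) \<in> U" for t p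
    by (auto simp: D_def S_def \<Psi>_def)
  have D': "(t, \<phi> y) \<in> D \<longleftrightarrow> t \<in> I \<and> y \<in> N \<and> \<Phi> t y \<in> U" if "y \<in> U" for t y
    using that by (auto simp: D chart_inv[OF U(1)])
  have "open S"
    unfolding S_def
    using sm N(1) \<open>open I\<close> chart_open[OF U(1)]
    by (intro continuous_open_preimage) (auto simp: smooth_map_on_def open_Times)
  moreover have "continuous_on (UNIV \<times> \<phi> ` U) (\<lambda>q. (fst q, ?i (snd q)))"
    by (intro continuous_intros continuous_on_compose2[OF homeomorphism_cont2[OF chart_homeomorphism[OF U(1)]]]) auto
  moreover have "open (UNIV \<times> \<phi> ` U)"
    using chart_image_open[OF U(1)] by (simp add: open_Times)
  ultimately have "open D"
    unfolding D_def by (intro continuous_open_preimage)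
  \<comment> \<open>Smoothness of the flow is stated in the product atlas, through
    \<open>inv_into\<close> of a product map; on the image of the chart this is the product of the
    inverses.\<close>
  have inv: "inv_into (UNIV \<times> U) (map_prod id \<phi>) (t, p) = (t, ?i p)" if "p \<in> \<phi> ` U" for t :: real and p
  proof (rule inv_into_f_eq)
    have "inj_on \<phi> U"
      using chart_inv[OF U(1)] by (rule inj_on_inverseI)
    then show "inj_on (map_prod id \<phi>) (UNIV \<times> U)"
      by (auto simp: inj_on_def)
    show "(t, ?i p) \<in> UNIV \<times> U" "map_prod id \<phi> (t, ?i p) = (t, p)"
      using that by (auto simp: inv_into_into f_inv_into_f)
  qed
  have smG: "smooth_on D (G b)" for b
  proof -
    have "(UNIV \<times> U, map_prod id \<phi>) \<in> prod_atlas real_atlas A"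
      using U(1) unfolding prod_atlas_def real_atlas_def by auto
    then have "smooth_on (map_prod id \<phi> ` ((UNIV \<times> U) \<inter> (I \<times> N) \<inter> \<Psi> -` U))
        (\<phi> \<circ> \<Psi> \<circ> inv_into (UNIV \<times> U) (map_prod id \<phi>))"
      using sm U(1) unfolding smooth_map_on_def by blast
    moreover have "map_prod id \<phi> ` ((UNIV \<times> U) \<inter> (I \<times> N) \<inter> \<Psi> -` U) = D"
    proof (intro equalityI subsetI)
      fix q assume "q \<in> map_prod id \<phi> ` ((UNIV \<times> U) \<inter> (I \<times> N) \<inter> \<Psi> -` U)"
      then show "q \<in> D" by (auto simp: D' \<Psi>_def)
    next
      fix q assume q: "q \<in> D"
      obtain t p where tp: "q = (t, p)" by (cases q)
      have "(t, ?i p) \<in> (UNIV \<times> U) \<inter> (I \<times> N) \<inter> \<Psi> -` U" "q = map_prod id \<phi> (t, ?i p)"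
        using q unfolding tp D by (auto simp: \<Psi>_def inv_into_into f_inv_into_f)
      then show "q \<in> map_prod id \<phi> ` ((UNIV \<times> U) \<inter> (I \<times> N) \<inter> \<Psi> -` U)"
        by blast
    qed
    ultimately have "smooth_on D (\<phi> \<circ> \<Psi> \<circ> inv_into (UNIV \<times> U) (map_prod id \<phi>))"
      by simp
    then have "smooth_on D (\<lambda>q. (\<phi> \<circ> \<Psi> \<circ> inv_into (UNIV \<times> U) (map_prod id \<phi>)) q \<bullet> b)"
      by (rule smooth_on_bounded_linear[OF bounded_linear_inner_left \<open>open D\<close>])
    then show ?thesis
    proof (rule iffD1[OF smooth_on_cong[OF \<open>open D\<close>], rotated])
      fix q assume "q \<in> D"
      then show "(\<phi> \<circ> \<Psi> \<circ> inv_into (UNIV \<times> U) (map_prod id \<phi>)) q \<bullet> b = G b q"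
        by (cases q) (simp add: D inv G_def \<Psi>_def)
    qed
  qed
  \<comment> \<open>The differential of the flow in coordinates: the direction \<open>(1, 0)\<close>
    is time, a direction \<open>(0, u)\<close> moves the starting point.\<close>
  define E where "E b q v = frechet_derivative (G b) (at q) v" for b q v
  have smE: "smooth_on D (\<lambda>q. E b q v)" for b v
    unfolding E_def by (rule smooth_on_derivative[OF smG])

  have pushforward: "smooth_near A x (\<lambda>y. \<phi> (\<Phi> t y) \<bullet> b)"
    "w (\<lambda>y. \<phi> (\<Phi> t y) \<bullet> b) = E b (t, \<phi> x) (0, coords \<phi> w)" if t: "(t, \<phi> x) \<in> D" for t b
  proof -
    let ?T = "{p. (t, p) \<in> D}" and ?f = "\<lambda>y. \<phi> (\<Phi> t y) \<bullet> b"
    have f: "?f \<circ> ?i = (\<lambda>p. G b (t, p))"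
      by (simp add: G_def o_def)
    have "?T \<subseteq> \<phi> ` U" by (auto simp: D)
    then have "\<phi> ` (U \<inter> \<phi> -` ?T) = ?T" by blast
    moreover have "open (U \<inter> \<phi> -` ?T)"
      using continuous_open_preimage[OF homeomorphism_cont1[OF chart_homeomorphism[OF U(1)]] chart_open[OF U(1)]
          smooth_on_slice(1)[OF \<open>open D\<close> smG]] .
    ultimately show near: "smooth_near A x ?f"
      unfolding smooth_near_chart_iff[OF U] f
      using smooth_on_slice(2)[OF \<open>open D\<close> smG, of t b] U(2) t by (intro exI[of _ "U \<inter> \<phi> -` ?T"]) auto
    have "w ?f = cvec U \<phi> x (coords \<phi> w) ?f"
      using cvec_coords[OF U wT] by simp
    also have "\<dots> = frechet_derivative (\<lambda>p. G b (t, p)) (at (\<phi> x)) (coords \<phi> w)"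
      using near by (simp add: cvec_def f)
    also have "\<dots> = E b (t, \<phi> x) (0, coords \<phi> w)"
      unfolding E_def by (rule frechet_derivative_slice[OF smG t])
    finally show "w ?f = E b (t, \<phi> x) (0, coords \<phi> w)" .
  qed
  have time: "E b (0, \<phi> y) (1, 0) = X y (\<lambda>z. \<phi> z \<bullet> b)" if y: "y \<in> U" "y \<in> N" for y b
  proof -
    have y0: "(0, \<phi> y) \<in> D"
      using y \<open>0 \<in> I\<close> \<Phi>0 by (simp add: D')
    have "((\<lambda>t. G b ((0, \<phi> y) + t *\<^sub>R (1, 0))) has_real_derivative E b (0, \<phi> y) (1, 0)) (at 0)"
      by (rule has_real_derivative_along_line) (use smooth_onD_derivative[OF smG y0] in \<open>simp add: E_def\<close>)
    then have "((\<lambda>s. \<phi> (\<Phi> s y) \<bullet> b) has_real_derivative E b (0, \<phi> y) (1, 0)) (at 0)"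
      by (simp add: G_def chart_inv[OF U(1) y(1)])
    then show ?thesis
      using curve[OF y(2) smooth_near_coordinate[OF U(1) y(1)]] DERIV_unique by blast
  qed
  have x0: "(0, \<phi> x) \<in> D"
    using U(2) N(2) \<open>0 \<in> I\<close> \<Phi>0 by (simp add: D')
  have vf: "vector_field A N X"
    using X(1) N(3) vector_field_subset unfolding contact_field_def by blast

  \<comment> \<open>After the exchange, the time derivative of the transported vector is the
    derivative along \<open>w\<close> of the time derivative of the flow at 0, whose coordinates are
    the components of \<open>X\<close>.\<close>
  have dE: "((\<lambda>t. E b (t, \<phi> x) (0, coords \<phi> w)) has_real_derivative w (\<lambda>y. X y (\<lambda>z. \<phi> z \<bullet> b))) (at 0)" for b
  proof -
    have "((\<lambda>t. E b ((0, \<phi> x) + t *\<^sub>R (1, 0)) (0, coords \<phi> w)) has_real_derivative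
        frechet_derivative (\<lambda>q. E b q (0, coords \<phi> w)) (at (0, \<phi> x)) (1, 0)) (at 0)"
      by (rule has_real_derivative_along_line) (use smooth_onD_derivative[OF smE x0] in simp)
    moreover have "frechet_derivative (\<lambda>q. E b q (0, coords \<phi> w)) (at (0, \<phi> x)) (1, 0) =
        frechet_derivative (\<lambda>q. E b q (1, 0)) (at (0, \<phi> x)) (0, coords \<phi> w)"
      unfolding E_def by (rule frechet_derivative_commute[OF \<open>open D\<close> smG x0])
    also have "\<dots> = frechet_derivative (\<lambda>p. E b (0, p) (1, 0)) (at (\<phi> x)) (coords \<phi> w)"
      by (rule frechet_derivative_slice[OF smE x0, symmetric])
    also have "\<dots> = frechet_derivative ((\<lambda>y. X y (\<lambda>z. \<phi> z \<bullet> b)) \<circ> ?i) (at (\<phi> x)) (coords \<phi> w)"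
    proof -
      have "frechet_derivative (\<lambda>p. E b (0, p) (1, 0)) (at (\<phi> x)) =
          frechet_derivative ((\<lambda>y. X y (\<lambda>z. \<phi> z \<bullet> b)) \<circ> ?i) (at (\<phi> x))"
      proof (rule frechet_derivative_cong_open[OF smooth_on_slice(1)[OF \<open>open D\<close> smG, of 0]])
        show "\<phi> x \<in> {p. (0, p) \<in> D}" using x0 by simp
        fix p assume "p \<in> {p. (0, p) \<in> D}"
        then obtain y where "y \<in> U" "y \<in> N" "p = \<phi> y"
          by (auto simp: D chart_inv[OF U(1)])
        then show "E b (0, p) (1, 0) = ((\<lambda>y. X y (\<lambda>z. \<phi> z \<bullet> b)) \<circ> ?i) p"
          by (simp add: time chart_inv[OF U(1)])
      qed
      then show ?thesis by simp
    qed
    also have "\<dots> = cvec U \<phi> x (coords \<phi> w) (\<lambda>y. X y (\<lambda>z. \<phi> z \<bullet> b))"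
      using vector_fieldD(2)[OF vf N(1,2) smooth_near_coordinate[OF U]] by (simp add: cvec_def)
    also have "\<dots> = w (\<lambda>y. X y (\<lambda>z. \<phi> z \<bullet> b))"
      by (simp add: cvec_coords[OF U wT])
    ultimately show ?thesis by simp
  qed

  \<comment> \<open>In coordinates, the value of \<alpha> on the vector \<open>w\<close> transported
    by the flow, as long as the flow line of \<open>x\<close> stays in the chart. Its derivative at
    0 is the coordinate formula for the Lie derivative of \<alpha> along \<open>X\<close>, evaluated
    on \<open>w\<close>.\<close>
  define K where "K t = (\<Sum>b\<in>Basis. E b (t, \<phi> x) (0, coords \<phi> w) * \<alpha> (\<Phi> t x) (cvec U \<phi> (\<Phi> t x) b))" for t
  have "smooth_near A x (\<lambda>y. \<alpha> y (cvec U \<phi> y b))" for b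
    by (rule one_form_smooth_near[OF \<alpha>(1,2) chart_open[OF U(1)] vector_field_cvec[OF U(1)] \<alpha>(3) U(2)])
  note d\<alpha> = curve[OF N(2) this]
  have E0: "E b (0, \<phi> x) (0, coords \<phi> w) = w (\<lambda>z. \<phi> z \<bullet> b)" for b
    unfolding pushforward(2)[OF x0, symmetric]
    by (rule tangent_cong[OF wT N(1,2)]) (simp add: \<Phi>0)
  have dK: "(K has_real_derivative (\<Sum>b\<in>Basis. w (\<lambda>y. X y (\<lambda>z. \<phi> z \<bullet> b)) * \<alpha> x (cvec U \<phi> x b) +
      X x (\<lambda>y. \<alpha> y (cvec U \<phi> y b)) * w (\<lambda>z. \<phi> z \<bullet> b))) (at 0)"
    unfolding K_def[abs_def]
  proof (rule DERIV_sum)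
    fix b :: 'e
    show "((\<lambda>t. E b (t, \<phi> x) (0, coords \<phi> w) * \<alpha> (\<Phi> t x) (cvec U \<phi> (\<Phi> t x) b)) has_real_derivative
        w (\<lambda>y. X y (\<lambda>z. \<phi> z \<bullet> b)) * \<alpha> x (cvec U \<phi> x b) +
        X x (\<lambda>y. \<alpha> y (cvec U \<phi> y b)) * w (\<lambda>z. \<phi> z \<bullet> b)) (at 0)"
      using DERIV_mult[OF dE d\<alpha>, of b b] by (simp add: E0 \<Phi>0[OF N(2)])
  qed
  \<comment> \<open>A neighbourhood of time 0 on which the flow line of \<open>x\<close> lies in the
    domains of the chart and of the form. There \<open>K\<close> vanishes, because the transported
    vector is again in \<open>H\<close>.\<close>
  define J where "J = I \<inter> (\<lambda>t. \<Phi> t x) -` (U \<inter> V0)"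
  have "open J"
    unfolding J_def using ic[OF N(2)] \<open>open I\<close> chart_open[OF U(1)] \<alpha>(1)
    by (intro continuous_open_preimage) (auto simp: integral_curve_def)
  have "0 \<in> J"
    using \<open>0 \<in> I\<close> \<Phi>0[OF N(2)] U(2) \<alpha>(3) by (simp add: J_def)
  have K0: "K t = 0" if "t \<in> J" for t
  proof -
    let ?y = "\<Phi> t x"
    let ?v = "differential A A (\<Phi> t) x w"
    have t: "t \<in> I" and y: "?y \<in> U" "?y \<in> V0" using that by (simp_all add: J_def)
    have "?v \<in> H ?y"
      using pres t N(2) w unfolding I_def by blast
    then have v: "?v \<in> tangent_space A ?y" "\<alpha> ?y ?v = 0"
      using \<alpha>(4)[OF y(2)] by auto
    have tD: "(t, \<phi> x) \<in> D"
      using U(2) N(2) t y by (simp add: D')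
    have "?v (\<lambda>z. \<phi> z \<bullet> b) = E b (t, \<phi> x) (0, coords \<phi> w)" for b
      using pushforward(2)[OF tD, of b] smooth_near_coordinate[OF U(1) y(1)]
      by (simp add: differential_def o_def)
    then show ?thesis
      using one_form_expand[OF \<alpha>(2) y(2) U(1) y(1) v(1)] v(2) by (simp add: K_def)
  qed
  have "(K has_real_derivative 0) (at 0)"
    by (rule has_field_derivative_transform_within_open[OF DERIV_const \<open>open J\<close> \<open>0 \<in> J\<close>]) (simp add: K0)
  then show ?thesis
    using DERIV_unique[OF dK] by (simp add: mult.commute)
qed

text \<open>In coordinates, \<alpha>([X, W]) is X(\<alpha>(W)) minus the Lie derivative of \<alpha>
  along \<open>X\<close> evaluated on \<open>W\<close>. The first term is 0 because \<alpha>(W)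
  vanishes near \<open>x\<close>, the second because the flow of \<open>X\<close> preserves
  \<open>H\<close>.\<close>

lemma contact_field_lie_bracket_kernel:
  assumes V: "open V" "contact_field A H V X" "x \<in> V"
    and \<alpha>: "open V0" "one_form A V0 \<alpha>" "x \<in> V0" "\<And>y. y \<in> V0 \<Longrightarrow> H y = {v \<in> tangent_space A y. \<alpha> y v = 0}"
    and N: "open N" "vector_field A N W" "x \<in> N" "\<And>y. y \<in> N \<Longrightarrow> W y \<in> H y"
  shows "\<alpha> x (lie_bracket A X W x) = 0"
proof -
  obtain U \<phi> where U: "(U, \<phi>) \<in> A" "x \<in> U" by (rule chart_exists)
  have X: "vector_field A V X" using V(2) by (simp add: contact_field_def)
  have VN: "open (V \<inter> N)" "vector_field A (V \<inter> N) X" "vector_field A (V \<inter> N) W" "x \<in> V \<inter> N"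
    using V N X by (auto intro: vector_field_subset)
  have "X x (\<lambda>y. \<alpha> y (W y)) = X x (\<lambda>y. 0)"
    by (rule tangent_cong[OF vector_fieldD(1)[OF X V(1,3)], of "V0 \<inter> N"]) (use \<alpha> N in auto)
  then have "X x (\<lambda>y. \<alpha> y (W y)) = 0"
    using tangent_const[OF vector_fieldD(1)[OF X V(1,3)]] by simp
  then show ?thesis
    using contact_field_preserves_kernel[OF V(2,3) \<alpha> U N(4)[OF N(3)]]
      tangent_one_form_field[OF \<alpha>(1,2) N(1,2) \<alpha>(3) N(3) U vector_fieldD(1)[OF X V(1,3)]]
      one_form_lie_bracket[OF \<alpha>(1,2) VN(1-3) \<alpha>(3) VN(4) U]
    by (simp add: left_diff_distrib sum_subtractf sum.distrib)
qed

section \<open>Contact algebras transversal to \<open>H\<close>\<close>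

lemma lie_bracket_tzero_left: "Q x \<in> tangent_space A x \<Longrightarrow> lie_bracket A (\<lambda>x. tzero) Q x = tzero"
  by (simp add: lie_bracket_def tzero_def tangent_const fun_eq_iff)

lemma lie_bracket_tzero_right: "P x \<in> tangent_space A x \<Longrightarrow> lie_bracket A P (\<lambda>x. tzero) x = tzero"
  by (simp add: lie_bracket_def tzero_def tangent_const fun_eq_iff)

lemma representsD:
  assumes "represents n A H V \<alpha>"
  shows "open V" "one_form A V \<alpha>" "contact_form n A V \<alpha>"
    "\<And>y. y \<in> V \<Longrightarrow> H y = {v \<in> tangent_space A y. \<alpha> y v = 0}"
  using assms by (auto simp: represents_def contact_form_def)

lemma contact_form_subset: "contact_form n A V \<alpha> \<Longrightarrow> open W \<Longrightarrow> W \<subseteq> V \<Longrightarrow> contact_form n A W \<alpha>"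
  unfolding contact_form_def one_form_def by (meson subset_trans subsetD)

lemma contact_form_local:
  assumes "open S" "\<And>x. x \<in> S \<Longrightarrow> \<exists>V. x \<in> V \<and> contact_form n A V \<alpha>"
  shows "contact_form n A S \<alpha>"
  unfolding contact_form_def one_form_def
proof (intro conjI ballI allI impI assms(1))
  fix x u v a b
  assume "x \<in> S" "u \<in> tangent_space A x" "v \<in> tangent_space A x"
  then show "\<alpha> x (tlincomb a u b v) = a * \<alpha> x u + b * \<alpha> x v"
    using assms(2) one_form_lincomb unfolding contact_form_def by blast
next
  fix W X assume "open W \<and> W \<subseteq> S \<and> vector_field A W X"
  then have W: "open W" "W \<subseteq> S" "vector_field A W X" by blast+
  have "smooth_near A x (\<lambda>y. \<alpha> y (X y))" if x: "x \<in> W" for x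
  proof -
    obtain V where "x \<in> V" "open V" "one_form A V \<alpha>"
      using assms(2)[of x] W(2) x unfolding contact_form_def by blast
    then show ?thesis
      using one_form_smooth_near[OF _ _ W(1,3)] x by blast
  qed
  then show "smooth_fun A W (\<lambda>x. \<alpha> x (X x))"
    using smooth_fun_iff_near[OF W(1)] by blast
next
  fix x assume "x \<in> S"
  then show "\<exists>v. (\<forall>i\<le>2 * n. v i \<in> tangent_space A x) \<and> wedge_power n (\<alpha> x) (ext_deriv A \<alpha> x) v \<noteq> 0"
    using assms(2) unfolding contact_form_def by blast
qed

end

text \<open>Transversality is phrased through the algebra: the fiber directions at a point are the
  values of its fields there.\<close>

locale transversal_contact_algebra = smooth_mfd A "2 * n + 1"
  for A :: "('m::{t2_space, second_countable_topology}, 'e::euclidean_space) chart set" and n :: nat +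
  fixes H :: "'m \<Rightarrow> 'm tvec set" and \<X> :: "('m \<Rightarrow> 'm tvec) set"
  assumes local_form: "\<And>x. \<exists>U \<alpha>. x \<in> U \<and> represents n A H U \<alpha>"
    and algebra: "abelian_contact_algebra A H \<X>"
    and transversal: "\<And>x v. v \<in> tangent_space A x \<Longrightarrow> \<exists>Y\<in>\<X>. \<exists>w\<in>H x. v = tlincomb 1 (Y x) 1 w"
begin

lemma
  assumes "Y \<in> \<X>"
  shows contact_field_algebra: "contact_field A H UNIV Y" and vector_field_algebra: "vector_field A UNIV Y"
    and algebra_tangent: "Y x \<in> tangent_space A x"
proof -
  have "\<forall>X\<in>\<X>. contact_field A H UNIV X"
    using algebra unfolding abelian_contact_algebra_def by (rule conjunct1)
  then show "contact_field A H UNIV Y" using assms by (rule bspec)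
  then show "vector_field A UNIV Y" unfolding contact_field_def by (rule conjunct1)
  then show "Y x \<in> tangent_space A x" by (rule vector_fieldD) simp_all
qed

lemma algebra_commute: "Y \<in> \<X> \<Longrightarrow> Z \<in> \<X> \<Longrightarrow> lie_bracket A Y Z x = tzero"
  using algebra unfolding abelian_contact_algebra_def by blast

definition nondeg :: "('m \<Rightarrow> 'm tvec) \<Rightarrow> 'm set" where
  "nondeg Y = {y. Y y \<notin> H y}"

text \<open>The contact form with kernel \<open>H\<close> and value 1 on \<open>Y\<close>; junk outside \<^term>\<open>nondeg Y\<close>.\<close>

definition nform :: "('m \<Rightarrow> 'm tvec) \<Rightarrow> 'm \<Rightarrow> 'm tvec \<Rightarrow> real" where
  "nform Y y v = (THE r. tlincomb 1 v (- r) (Y y) \<in> H y)"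

text \<open>For any local form \<alpha>, the vector v - r Y is in the kernel exactly when r =
  \<alpha>(v) / \<alpha>(Y). The description of \<open>nform\<close> mentions only \<open>H\<close>
  and \<open>Y\<close>, so the quotients of different local forms agree on overlaps.\<close>

lemma nform_eq:
  assumes "represents n A H V \<alpha>" "y \<in> V" "Y \<in> \<X>" "y \<in> nondeg Y" "v \<in> tangent_space A y"
  shows "\<alpha> y (Y y) \<noteq> 0" "nform Y y v = inverse (\<alpha> y (Y y)) * \<alpha> y v"
proof -
  note \<alpha> = representsD[OF assms(1)] and Y = algebra_tangent[OF assms(3)]
  show nz: "\<alpha> y (Y y) \<noteq> 0"
    using assms(2,4) \<alpha>(4) Y by (simp add: nondeg_def)
  have "tlincomb 1 v (- r) (Y y) \<in> H y \<longleftrightarrow> \<alpha> y v - r * \<alpha> y (Y y) = 0" for r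
    using \<alpha>(4)[OF assms(2)] one_form_lincomb[OF \<alpha>(2) assms(2,5) Y, of 1 "- r"]
      tlincomb_in_tangent_space[OF assms(5) Y] by simp
  also have "\<dots> r \<longleftrightarrow> r = inverse (\<alpha> y (Y y)) * \<alpha> y v" for r
    using nz by (auto simp: field_simps)
  finally show "nform Y y v = inverse (\<alpha> y (Y y)) * \<alpha> y v"
    unfolding nform_def by simp
qed

lemma nondeg_nbhd:
  assumes "Y \<in> \<X>" "x \<in> nondeg Y"
  obtains V where "x \<in> V" "V \<subseteq> nondeg Y" "represents n A H V (nform Y)"
proof -
  obtain U \<alpha> where x: "x \<in> U" and U: "represents n A H U \<alpha>"
    using local_form by blast
  note \<alpha> = representsD[OF U]
  have g: "smooth_near A y (\<lambda>y. \<alpha> y (Y y))" if "y \<in> U" for y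
    by (rule one_form_smooth_near[OF \<alpha>(1,2) open_UNIV vector_field_algebra[OF assms(1)] that]) simp
  obtain N where N: "open N" "x \<in> N" "\<And>y. y \<in> N \<Longrightarrow> \<alpha> y (Y y) \<noteq> 0"
    using isCont_nonzero_nbhd[OF smooth_near_isCont[OF g[OF x]]]
      nform_eq(1)[OF U x assms algebra_tangent[OF assms(1)]] by blast
  let ?V = "U \<inter> N"
  have V: "y \<in> nondeg Y" if "y \<in> ?V" for y
    using \<alpha>(4) N(3) that by (auto simp: nondeg_def)
  have "contact_form n A ?V \<alpha>"
    by (rule contact_form_subset[OF \<alpha>(3)]) (use \<alpha>(1) N(1) in auto)
  then have "contact_form n A ?V (nform Y)"
    by (rule contact_form_rescale[where g = "\<lambda>y. inverse (\<alpha> y (Y y))"])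
      (use g smooth_near_inverse N(3) V nform_eq(2)[OF U _ assms(1)] in auto)
  moreover have "H y = {v \<in> tangent_space A y. nform Y y v = 0}" if "y \<in> ?V" for y
    using \<alpha>(4)[of y] N(3)[of y] nform_eq(2)[OF U _ assms(1) V[OF that]] that by auto
  ultimately have "represents n A H ?V (nform Y)"
    unfolding represents_def by blast
  then show thesis
    using that[of ?V] x N(2) V by blast
qed

lemma represents_nform:
  assumes "Y \<in> \<X>"
  shows "represents n A H (nondeg Y) (nform Y)"
proof -
  have loc: "\<exists>V. x \<in> V \<and> V \<subseteq> nondeg Y \<and> represents n A H V (nform Y)" if "x \<in> nondeg Y" for x
    using nondeg_nbhd[OF assms that] by metis
  have "open (nondeg Y)"
    unfolding open_subopen[of "nondeg Y"] by (intro ballI) (metis loc representsD(1))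
  moreover have "\<exists>V. x \<in> V \<and> contact_form n A V (nform Y)" if "x \<in> nondeg Y" for x
    using loc[OF that] representsD(3) by blast
  ultimately have "contact_form n A (nondeg Y) (nform Y)"
    by (rule contact_form_local)
  moreover have "H y = {v \<in> tangent_space A y. nform Y y v = 0}" if "y \<in> nondeg Y" for y
    using loc[OF that] representsD(4) by blast
  ultimately show ?thesis
    unfolding represents_def by blast
qed

lemma nform_self:
  assumes "Y \<in> \<X>" "x \<in> nondeg Y"
  shows "nform Y x (Y x) = 1"
proof -
  obtain U \<alpha> where U: "x \<in> U" "represents n A H U \<alpha>"
    using local_form by blast
  show ?thesis
    using nform_eq[OF U(2,1) assms algebra_tangent[OF assms(1)]] by simp
qed

text \<open>Transversality splits a vector outside \<open>H x\<close> into the value of some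
  \<open>Y\<close> and a horizontal vector; the latter does not contribute to \<alpha>, so the
  former is outside \<open>H x\<close>.\<close>

lemma nondeg_cover: obtains Y where "Y \<in> \<X>" "x \<in> nondeg Y"
proof -
  obtain U \<alpha> where x: "x \<in> U" and U: "represents n A H U \<alpha>"
    using local_form by blast
  note \<alpha> = representsD[OF U]
  obtain v where v: "v \<in> tangent_space A x" "\<alpha> x v \<noteq> 0"
    by (rule contact_form_nonzero[OF \<alpha>(3) x])
  obtain Y w where Y: "Y \<in> \<X>" and w: "w \<in> H x" and vYw: "v = tlincomb 1 (Y x) 1 w"
    using transversal[OF v(1)] by blast
  have "\<alpha> x v = \<alpha> x (Y x)"
    using w \<alpha>(4)[OF x] one_form_lincomb[OF \<alpha>(2) x algebra_tangent[OF Y], of w 1 1] vYw by simp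
  then have "x \<in> nondeg Y"
    using v(2) \<alpha>(4)[OF x] by (simp add: nondeg_def)
  with Y show thesis by (rule that)
qed

text \<open>The projection of \<open>W\<close> to \<open>H\<close> along \<open>Y\<close>; it is
  horizontal because \<open>nform Y\<close> is 1 on \<open>Y\<close>. Through it, bracket conditions
  on sections of \<open>H\<close> reach arbitrary fields.\<close>

lemma horizontal_part:
  assumes Y: "Y \<in> \<X>" and W: "open N" "N \<subseteq> nondeg Y" "vector_field A N W"
  shows "vector_field A N (\<lambda>y. tlincomb 1 (W y) (- nform Y y (W y)) (Y y))"
    and "y \<in> N \<Longrightarrow> tlincomb 1 (W y) (- nform Y y (W y)) (Y y) \<in> H y"
    and "y \<in> N \<Longrightarrow> smooth_near A y (\<lambda>y. - nform Y y (W y))"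
proof -
  note \<alpha> = representsD[OF represents_nform[OF Y]]
  show c: "smooth_near A y (\<lambda>y. - nform Y y (W y))" if "y \<in> N" for y
    using smooth_near_mult[OF smooth_near_const[of y "-1"]
        one_form_smooth_near[OF \<alpha>(1,2) W(1,3) subsetD[OF W(2) that] that]] by simp
  show "vector_field A N (\<lambda>y. tlincomb 1 (W y) (- nform Y y (W y)) (Y y))"
    by (rule vector_field_lincomb[OF W(1,3) vector_field_subset[OF vector_field_algebra[OF Y]] smooth_near_const c]) auto
  show "tlincomb 1 (W y) (- nform Y y (W y)) (Y y) \<in> H y" if y: "y \<in> N" for y
  proof -
    have "y \<in> nondeg Y" using W(2) y by blast
    moreover have "W y \<in> tangent_space A y"
      using vector_fieldD(1)[OF W(3,1) y] .
    ultimately show ?thesis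
      using \<alpha>(4)[of y] one_form_lincomb[OF \<alpha>(2), of y "W y" "Y y"] algebra_tangent[OF Y] nform_self[OF Y]
        tlincomb_in_tangent_space by simp
  qed
qed

lemma nform_invariant:
  assumes Y: "Y \<in> \<X>" and Z: "Z \<in> \<X>" and W: "open N" "vector_field A N W" "x \<in> N" "x \<in> nondeg Y"
  shows "Z x (\<lambda>y. nform Y y (W y)) = nform Y x (lie_bracket A Z W x)"
proof -
  note \<alpha> = representsD[OF represents_nform[OF Y]]
  let ?N = "N \<inter> nondeg Y" and ?c = "\<lambda>y. - nform Y y (W y)"
  have N: "open ?N" "?N \<subseteq> nondeg Y" "vector_field A ?N W" "x \<in> ?N"
    using W \<alpha>(1) by (auto intro: vector_field_subset[OF W(2)])
  note h = horizontal_part[OF Y N(1-3)]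
  have Zx: "Z x \<in> tangent_space A x" by (rule algebra_tangent[OF Z])
  have "nform Y x (lie_bracket A Z (\<lambda>y. tlincomb 1 (W y) (?c y) (Y y)) x) = 0"
    by (rule contact_field_lie_bracket_kernel[OF open_UNIV contact_field_algebra[OF Z] UNIV_I \<alpha>(1,2) W(4) \<alpha>(4)
          N(1) h(1) N(4) h(2)])
  \<comment> \<open>Under \<alpha> the three summands become \<alpha>([Z, W]), Z(c) \<alpha>(Y) =
    Z(c) and 0, where c = -\<alpha>(W).\<close>
  moreover have "lie_bracket A Z (\<lambda>y. tlincomb 1 (W y) (?c y) (Y y)) x =
      tlincomb 1 (tlincomb 1 (lie_bracket A Z W x) (Z x ?c) (Y x)) (?c x) tzero"
    using lie_bracket_add_scaled[OF N(1) vector_field_subset[OF vector_field_algebra[OF Z]] N(3)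
        vector_field_subset[OF vector_field_algebra[OF Y]] N(4) h(3)[OF N(4)]] algebra_commute[OF Z Y] by simp
  moreover have "lie_bracket A Z W x \<in> tangent_space A x"
    by (rule lie_bracket_in_tangent_space[OF N(1) vector_field_subset[OF vector_field_algebra[OF Z]] N(3,4)]) simp
  moreover have "Z x ?c = - Z x (\<lambda>y. nform Y y (W y))"
    using tangent_diff[OF Zx smooth_near_const one_form_smooth_near[OF \<alpha>(1,2) N(1,3) W(4) N(4)], of 0]
      tangent_const[OF Zx] by simp
  ultimately show ?thesis
    using one_form_lincomb[OF \<alpha>(2) W(4)] one_form_tzero[OF \<alpha>(2) W(4)] algebra_tangent[OF Y]
      nform_self[OF Y W(4)] tlincomb_in_tangent_space tzero_in_tangent_space by simp
qed

text \<open>By invariance every local extension of \<open>v\<close> yields 0, and an extension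
  exists, so the description denotes 0.\<close>

lemma lie_deriv_nform:
  assumes "Y \<in> \<X>" "Z \<in> \<X>" "x \<in> nondeg Y" "v \<in> tangent_space A x"
  shows "lie_deriv_form A Z (nform Y) x v = 0"
proof -
  have *: "Z x (\<lambda>y. nform Y y (X y)) - nform Y x (lie_bracket A Z X x) = 0" if "local_extension A x v X" for X
    using that nform_invariant[OF assms(1,2) _ _ _ assms(3)] unfolding local_extension_def by force
  obtain X where "local_extension A x v X"
    by (rule local_extension_exists[OF assms(4)])
  then show ?thesis
    unfolding lie_deriv_form_def by (intro the_equality) (use * in force)+
qed

text \<open>Near a point of the curve choose \<open>Z \<in> \<X>\<close> transversal to \<open>H\<close> there. Then \<open>Y \<notin> H\<close> means
  that the \<open>Z\<close>-normalised form does not vanish on \<open>Y\<close>, and its value on \<open>Y\<close> is constant along the curve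
  because \<open>\<X>\<close> is Abelian.\<close>

lemma nondeg_integral_curve:
  assumes Y: "Y \<in> \<X>" and X: "X \<in> \<X>" and \<gamma>: "integral_curve A X I \<gamma>" "s \<in> I" "t \<in> I" "\<gamma> s \<in> nondeg Y"
  shows "\<gamma> t \<in> nondeg Y"
proof -
  have I: "open I" "is_interval I" "continuous_on I \<gamma>"
    and d: "\<And>t f. t \<in> I \<Longrightarrow> smooth_near A (\<gamma> t) f \<Longrightarrow> ((\<lambda>s. f (\<gamma> s)) has_real_derivative X (\<gamma> t) f) (at t)"
    using \<gamma>(1) unfolding integral_curve_def by blast+
  \<comment> \<open>Membership in \<open>nondeg Y\<close> is constant on a relative neighbourhood of
    each time; connectedness of \<open>I\<close> then carries it from \<open>s\<close> to
    \<open>t\<close>.\<close>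
  have "\<exists>T. openin (top_of_set I) T \<and> a \<in> T \<and> (\<forall>p\<in>T. \<forall>q\<in>T. \<gamma> p \<in> nondeg Y \<longrightarrow> \<gamma> q \<in> nondeg Y)"
    if a: "a \<in> I" for a
  proof -
    obtain Z where Z: "Z \<in> \<X>" "\<gamma> a \<in> nondeg Z" by (rule nondeg_cover)
    note \<alpha> = representsD[OF represents_nform[OF Z(1)]]
    define f where "f y = nform Z y (Y y)" for y
    have f: "y \<in> nondeg Y \<longleftrightarrow> f y \<noteq> 0" if "y \<in> nondeg Z" for y
      using \<alpha>(4)[OF that] algebra_tangent[OF Y] by (simp add: nondeg_def[of Y] f_def)
    have "open (I \<inter> \<gamma> -` nondeg Z)"
      by (rule continuous_open_preimage[OF I(3,1) \<alpha>(1)])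
    then obtain e where e: "e > 0" "ball a e \<subseteq> I \<inter> \<gamma> -` nondeg Z"
      using a Z(2) by (auto elim: openE)
    have "((\<lambda>s. f (\<gamma> s)) has_real_derivative 0) (at t)" if t: "t \<in> ball a e" for t
    proof -
      have tI: "t \<in> I" "\<gamma> t \<in> nondeg Z" using t e(2) by auto
      have "smooth_near A (\<gamma> t) f"
        unfolding f_def[abs_def]
        by (rule one_form_smooth_near[OF \<alpha>(1,2) open_UNIV vector_field_algebra[OF Y] tI(2)]) simp
      moreover have "X (\<gamma> t) f = 0"
        using nform_invariant[OF Z(1) X open_UNIV vector_field_algebra[OF Y] UNIV_I tI(2)]
          algebra_commute[OF X Y] one_form_tzero[OF \<alpha>(2) tI(2)] by (simp add: f_def[abs_def])
      ultimately show ?thesis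
        using d[OF tI(1), of f] by simp
    qed
    then obtain c where "\<forall>t\<in>ball a e. f (\<gamma> t) = c"
      using has_field_derivative_zero_constant[OF convex_ball, of a e "\<lambda>s. f (\<gamma> s)"]
        has_field_derivative_at_within by blast
    then have "\<forall>p\<in>ball a e. \<forall>q\<in>ball a e. \<gamma> p \<in> nondeg Y \<longrightarrow> \<gamma> q \<in> nondeg Y"
      using f e(2) by (auto simp: subset_iff)
    moreover have "openin (top_of_set I) (ball a e)"
      using e(2) by (intro open_subset) auto
    ultimately show ?thesis
      using e(1) by (intro exI[of _ "ball a e"]) simp
  qed
  then show ?thesis
    using connected_induction_simple[OF is_interval_connected[OF I(2)], where P = "\<lambda>t. \<gamma> t \<in> nondeg Y" and a = s and b = t] \<gamma>(2-4)
    by blast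
qed

lemma invariant_nondeg:
  assumes "Y \<in> \<X>"
  shows "invariant_set A \<X> (nondeg Y)"
  unfolding invariant_set_def orbit_def
proof (intro ballI subsetI CollectI)
  fix x y
  assume x: "x \<in> nondeg Y" and "y \<in> {y. (\<lambda>y z. \<exists>Y\<in>\<X>. \<exists>I \<gamma> s t. integral_curve A Y I \<gamma> \<and> s \<in> I \<and> t \<in> I \<and>
     \<gamma> s = y \<and> \<gamma> t = z)\<^sup>*\<^sup>* x y}"
  then have "(\<lambda>y z. \<exists>Y\<in>\<X>. \<exists>I \<gamma> s t. integral_curve A Y I \<gamma> \<and> s \<in> I \<and> t \<in> I \<and>
     \<gamma> s = y \<and> \<gamma> t = z)\<^sup>*\<^sup>* x y"
    by simp
  then show "y \<in> nondeg Y"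
    by (induction rule: rtranclp_induct) (use x nondeg_integral_curve[OF assms] in blast)+
qed

text \<open>\<open>[Z, X\<^sub>f]\<close> is again an infinitesimal contact automorphism, with Hamiltonian \<open>Z f = 0\<close>; by
  nondegeneracy it vanishes.\<close>

lemma hamiltonian_commute:
  assumes Y: "Y \<in> \<X>" and Z: "Z \<in> \<X>" and V: "open V" "V \<subseteq> nondeg Y"
    and P: "contact_field A H V P" and f: "\<And>y. y \<in> V \<Longrightarrow> Z y (\<lambda>y. nform Y y (P y)) = 0" and x: "x \<in> V"
  shows "lie_bracket A Z P x = tzero"
proof -
  note \<alpha> = representsD[OF represents_nform[OF Y]]
  have vP: "vector_field A V P" using P by (simp add: contact_field_def)
  have vZ: "vector_field A N Z" for N
    by (rule vector_field_subset[OF vector_field_algebra[OF Z]]) simp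
  let ?K = "lie_bracket A Z P"
  have vK: "vector_field A V ?K" by (rule vector_field_lie_bracket[OF V(1) vZ vP])
  have K0: "nform Y y (?K y) = 0" if "y \<in> V" for y
    using nform_invariant[OF Y Z V(1) vP that] f[OF that] V(2) that by auto
  have xY: "x \<in> nondeg Y" using V(2) x by blast
  show ?thesis
  proof (rule contact_form_nondegenerate[where \<alpha> = "nform Y" and x = x and z = "?K x",
        OF \<alpha>(3) refl xY vector_fieldD(1)[OF vK V(1) x] K0[OF x]])
    fix w assume w: "w \<in> tangent_space A x" "nform Y x w = 0"
    obtain W where "local_extension A x w W"
      by (rule local_extension_exists[OF w(1)])
    then obtain N0 where N0: "open N0" "x \<in> N0" "vector_field A N0 W" "W x = w"
      unfolding local_extension_def by blast
    define N where "N = N0 \<inter> V"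
    have N: "open N" "x \<in> N" "N \<subseteq> V" "N \<subseteq> nondeg Y" "vector_field A N W"
      using N0 V x vector_field_subset[OF N0(3)] by (auto simp: N_def)
    \<comment> \<open>A horizontal extension of \<open>w\<close>: an arbitrary extension projected
      to \<open>H\<close>. The projection does not change the value at \<open>x\<close>, because
      \<open>w\<close> is horizontal.\<close>
    define Q where "Q = (\<lambda>y. tlincomb 1 (W y) (- nform Y y (W y)) (Y y))"
    have vQ: "vector_field A N Q" and QH: "\<And>y. y \<in> N \<Longrightarrow> Q y \<in> H y"
      unfolding Q_def using horizontal_part[OF Y N(1,4,5)] by blast+
    have Qx: "Q x = w"
      using w(2) N0(4) by (simp add: Q_def tlincomb_def)
    have vPN: "vector_field A N P" and vKN: "vector_field A N ?K"
      using vector_field_subset[OF vP N(3)] vector_field_subset[OF vK N(3)] .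
    have PQ: "lie_bracket A P Q y \<in> H y" if "y \<in> N" for y
    proof -
      have y: "y \<in> V" "y \<in> nondeg Y" using that N(3,4) by auto
      show ?thesis
        using contact_field_lie_bracket_kernel[OF V(1) P y(1) \<alpha>(1,2) y(2) \<alpha>(4) N(1) vQ that QH]
          lie_bracket_in_tangent_space[OF N(1) vPN vQ that] \<alpha>(4)[OF y(2)] by simp
    qed
    have ZQ: "lie_bracket A Z Q y \<in> H y" if "y \<in> N" for y
    proof -
      have y: "y \<in> nondeg Y" using that N(4) by auto
      show ?thesis
        using contact_field_lie_bracket_kernel[OF open_UNIV contact_field_algebra[OF Z] UNIV_I \<alpha>(1,2) y \<alpha>(4) N(1) vQ that QH]
          lie_bracket_in_tangent_space[OF N(1) vZ vQ that] \<alpha>(4)[OF y] by simp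
    qed
    have vPQ: "vector_field A N (lie_bracket A P Q)" and vZQ: "vector_field A N (lie_bracket A Z Q)"
      by (rule vector_field_lie_bracket[OF N(1) vPN vQ] vector_field_lie_bracket[OF N(1) vZ vQ])+
    have "nform Y x (lie_bracket A Z (lie_bracket A P Q) x) = 0"
      by (rule contact_field_lie_bracket_kernel[OF open_UNIV contact_field_algebra[OF Z] UNIV_I \<alpha>(1,2) xY \<alpha>(4) N(1) vPQ N(2) PQ])
    moreover have "nform Y x (lie_bracket A P (lie_bracket A Z Q) x) = 0"
      by (rule contact_field_lie_bracket_kernel[OF V(1) P x \<alpha>(1,2) xY \<alpha>(4) N(1) vZQ N(2) ZQ])
    \<comment> \<open>No flow of \<open>?K\<close> is available. Its bracket with a section of
      \<open>H\<close> is controlled by the Jacobi identity from brackets with \<open>Z\<close> and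
      \<open>P\<close>, whose flows preserve \<open>H\<close>.\<close>
    ultimately have KQ: "nform Y x (lie_bracket A ?K Q x) = 0"
      unfolding jacobi_identity[OF N(1) vZ vPN vQ N(2)]
      using one_form_lincomb[OF \<alpha>(2) xY lie_bracket_in_tangent_space[OF N(1) vZ vPQ N(2)]
          lie_bracket_in_tangent_space[OF N(1) vPN vZQ N(2)]] by simp
    \<comment> \<open>The remaining two terms of d\<alpha>(K, Q) differentiate \<alpha>(Q) and
      \<alpha>(K), functions that vanish on a neighbourhood of \<open>x\<close>.\<close>
    have 1: "?K x (\<lambda>y. nform Y y (Q y)) = ?K x (\<lambda>y. 0)"
      by (rule tangent_cong[OF vector_fieldD(1)[OF vKN N(1,2)] N(1,2)]) (use QH \<alpha>(4) N(4) in auto)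
    have 2: "Q x (\<lambda>y. nform Y y (?K y)) = Q x (\<lambda>y. 0)"
      by (rule tangent_cong[OF vector_fieldD(1)[OF vQ N(1,2)] N(1,2)]) (use K0 N(3) in auto)
    show "ext_deriv A (nform Y) x (?K x) w = 0"
      using ext_deriv_fields[OF \<alpha>(1,2) N(1) vKN vQ xY N(2)] Qx KQ 1 2
        tangent_const[OF vector_fieldD(1)[OF vKN N(1,2)]] tangent_const[OF vector_fieldD(1)[OF vQ N(1,2)]] by simp
  qed
qed

lemma complete_foliation_nform:
  assumes Y: "Y \<in> \<X>" and F: "\<And>x. F x = (\<lambda>Z. Z x) ` \<X>"
  shows "complete_foliation A H (nform Y) (nondeg Y) F"
  unfolding complete_foliation_def
proof (intro allI impI, elim conjE)
  fix V f g h
  assume V: "open V" "V \<subseteq> nondeg Y" and f: "first_integral A F V f" and g: "first_integral A F V g"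
    and "is_jacobi_bracket A H (nform Y) V f g h"
  then obtain P Q where P: "contact_field A H V P" "\<And>x. x \<in> V \<Longrightarrow> nform Y x (P x) = f x"
    and Q: "contact_field A H V Q" "\<And>x. x \<in> V \<Longrightarrow> nform Y x (Q x) = g x"
    and h: "\<And>x. x \<in> V \<Longrightarrow> h x = nform Y x (lie_bracket A P Q x)"
    unfolding is_jacobi_bracket_def contact_hamiltonian_def by blast
  note \<alpha> = representsD[OF represents_nform[OF Y]]
  have vP: "vector_field A V P" and vQ: "vector_field A V Q"
    using P(1) Q(1) by (simp_all add: contact_field_def)
  have vPQ: "vector_field A V (lie_bracket A P Q)"
    by (rule vector_field_lie_bracket[OF V(1) vP vQ])
  \<comment> \<open>Here the first integrals enter: \<open>Z\<close> takes values in the foliation,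
    so it annihilates the Hamiltonian \<open>k\<close> of \<open>R\<close>.\<close>
  have comm: "lie_bracket A Z R x = tzero"
    if Z: "Z \<in> \<X>" and R: "contact_field A H V R" and k: "first_integral A F V k"
      and kR: "\<And>x. x \<in> V \<Longrightarrow> nform Y x (R x) = k x" and x: "x \<in> V" for Z R k x
  proof (rule hamiltonian_commute[OF Y Z V R _ x])
    fix y assume y: "y \<in> V"
    have "Z y (\<lambda>y. nform Y y (R y)) = Z y k"
      by (rule tangent_cong[OF algebra_tangent[OF Z] V(1) y kR])
    then show "Z y (\<lambda>y. nform Y y (R y)) = 0"
      using k y Z F unfolding first_integral_def by auto
  qed
  have "smooth_near A x h" if "x \<in> V" for x
    by (rule smooth_near_cong[OF one_form_smooth_near[OF \<alpha>(1,2) V(1) vPQ subsetD[OF V(2) that] that] V(1) that])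
      (simp add: h)
  then have "smooth_fun A V h"
    using smooth_fun_iff_near[OF V(1)] by blast
  moreover have "Z x h = 0" if x: "x \<in> V" and Z: "Z \<in> \<X>" for x Z
  proof -
    have vZ: "vector_field A V Z"
      by (rule vector_field_subset[OF vector_field_algebra[OF Z]]) simp
    have xY: "x \<in> nondeg Y" using V(2) x by blast
    have "Z x h = Z x (\<lambda>y. nform Y y (lie_bracket A P Q y))"
      by (rule tangent_cong[OF algebra_tangent[OF Z] V(1) x h])
    also have "\<dots> = nform Y x (lie_bracket A Z (lie_bracket A P Q) x)"
      by (rule nform_invariant[OF Y Z V(1) vPQ x xY])
    also have "lie_bracket A Z (lie_bracket A P Q) x = tzero"
    proof -
      \<comment> \<open>The inner bracket vanishes on all of \<open>V\<close> and not only at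
        \<open>x\<close>, which permits replacing it by the zero field inside another
        bracket.\<close>
      have "lie_bracket A (lie_bracket A Z P) Q x = lie_bracket A (\<lambda>x. tzero) Q x"
        by (rule lie_bracket_cong[where X = "lie_bracket A Z P" and Y = Q and x = x,
              OF V(1) x lie_bracket_in_tangent_space[OF V(1) vZ vP x] vector_fieldD(1)[OF vQ V(1) x]])
          (simp_all add: comm[OF Z P(1) f P(2)])
      moreover have "lie_bracket A P (lie_bracket A Z Q) x = lie_bracket A P (\<lambda>x. tzero) x"
        by (rule lie_bracket_cong[where X = P and Y = "lie_bracket A Z Q" and x = x,
              OF V(1) x vector_fieldD(1)[OF vP V(1) x] lie_bracket_in_tangent_space[OF V(1) vZ vQ x]])
          (simp_all add: comm[OF Z Q(1) g Q(2)])
      ultimately show ?thesis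
        using jacobi_identity[OF V(1) vZ vP vQ x]
          lie_bracket_tzero_left[where Q = Q and x = x, OF vector_fieldD(1)[OF vQ V(1) x]]
          lie_bracket_tzero_right[where P = P and x = x, OF vector_fieldD(1)[OF vP V(1) x]]
        by (simp add: tlincomb_def tzero_def fun_eq_iff)
    qed
    finally show ?thesis
      using one_form_tzero[OF \<alpha>(2) xY] by simp
  qed
  ultimately show "first_integral A F V h"
    unfolding first_integral_def F by blast
qed

end

theorem theorem3:
  fixes A :: "('m::{t2_space, second_countable_topology}, 'e::euclidean_space) chart set"
    and B :: "('w::{t2_space, second_countable_topology}, 'f::real_normed_vector) chart set"
    and H :: "'m \<Rightarrow> 'm tvec set"
    and \<X> :: "('m \<Rightarrow> 'm tvec) set"
    and \<pi> :: "'m \<Rightarrow> 'w"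
    and n p :: nat
  assumes "contact_manifold n A H"
    and "smooth_manifold p B"
    and "n \<le> p"
    and "proper_submersion A B \<pi>"
    and "complete_pre_isotropic n A B H \<X> \<pi>"
  shows "\<forall>x. \<exists>U \<alpha>. open U \<and> x \<in> U \<and> invariant_set A \<X> U \<and> represents n A H U \<alpha> \<and>
    (\<forall>Y\<in>\<X>. \<forall>y\<in>U. \<forall>v\<in>tangent_space A y. lie_deriv_form A Y \<alpha> y v = 0) \<and>
    complete_foliation A H \<alpha> U (vertical A B \<pi>)"
proof
  fix x
  have F: "vertical A B \<pi> x = (\<lambda>Y. Y x) ` \<X>" for x
    using assms(5) unfolding complete_pre_isotropic_def by simp
  interpret transversal_contact_algebra A n H \<X>
  proof unfold_locales
    show "smooth_manifold (2 * n + 1) A" and "\<exists>U \<alpha>. x \<in> U \<and> represents n A H U \<alpha>" for x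
      using assms(1) unfolding contact_manifold_def by blast+
    show "abelian_contact_algebra A H \<X>"
      using assms(5) unfolding complete_pre_isotropic_def by blast
    fix x v assume "v \<in> tangent_space A x"
    then obtain u w where "u \<in> vertical A B \<pi> x" "w \<in> H x" "v = tlincomb 1 u 1 w"
      using assms(5) unfolding complete_pre_isotropic_def pre_isotropic_def by blast
    \<comment> \<open>The vertical summand is the value at \<open>x\<close> of a field of the
      algebra, as the orbits fill out the fiber directions.\<close>
    moreover from \<open>u \<in> vertical A B \<pi> x\<close> obtain Y where "Y \<in> \<X>" "u = Y x"
      unfolding F by (rule imageE)
    ultimately show "\<exists>Y\<in>\<X>. \<exists>w\<in>H x. v = tlincomb 1 (Y x) 1 w"
      by metis
  qed
  obtain Y where Y: "Y \<in> \<X>" "x \<in> nondeg Y" by (rule nondeg_cover)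
  show "\<exists>U \<alpha>. open U \<and> x \<in> U \<and> invariant_set A \<X> U \<and> represents n A H U \<alpha> \<and>
      (\<forall>Y\<in>\<X>. \<forall>y\<in>U. \<forall>v\<in>tangent_space A y. lie_deriv_form A Y \<alpha> y v = 0) \<and>
      complete_foliation A H \<alpha> U (vertical A B \<pi>)"
    using Y(2) representsD(1)[OF represents_nform[OF Y(1)]] represents_nform[OF Y(1)] invariant_nondeg[OF Y(1)]
      lie_deriv_nform[OF Y(1)] complete_foliation_nform[OF Y(1) F]
    by (intro exI[of _ "nondeg Y"] exI[of _ "nform Y"]) blast
qed

end
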